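(* Let \(N\) be a parallel-path network with \(n\) vertices. There is a data structure of size \(O(n)\) with \(O(n)\) construction time supporting farthest-point queries on \(N\) in \(O(k+\log n)\) time, where \(k\) is the number of farthest points reported.
   Context: A network is a simple, connected, undirected graph with positive edge weights. A point on an edge \(uv\) is specified by \(\lambda\in[0,1]\), splitting \(uv\) into sub-edges of weights \(\lambda w_{uv}\) and \((1-\lambda)w_{uv}\). The network distance \(d_N(p,q)\) between points \(p,q\) on \(N\) is the weighted length of a shortest path between them in \(N\). A point \(\bar p\) is a farthest point from \(p\) if \(d_N(p,\bar p)=\max_{q\in N}d_N(p,q)\). A farthest-point query receives a point \(p\) (given by its edge and \(\lambda\)) and reports all farthest points from \(p\). A parallel-path network consists of two distinct vertices \(u,v\) (terminals) and a collection of pairwise edge-disjoint, internally vertex-disjoint \(u\)-\(v\)-paths whose union is the network. *)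

theory Defs
  imports Complex_Main
begin

section \<open>Networks\<close>

text \<open>
  A network is presented as algorithms receive it: the vertices are \<open>0, \<dots>, vertex_count - 1\<close>
  and an edge is an entry \<open>(a, b, w)\<close> of an edge list in no particular order, with no particular
  choice of which endpoint comes first.  The order of the two endpoints only serves to fix the
  direction in which the parameter \<open>\<lambda>\<close> of a point on the edge is measured.
\<close>

record network =
  vertex_count :: nat
  edge_list :: "(nat \<times> nat \<times> real) list"

definition src :: "network \<Rightarrow> nat \<Rightarrow> nat" where
  "src N i = fst (edge_list N ! i)"

definition tgt :: "network \<Rightarrow> nat \<Rightarrow> nat" where
  "tgt N i = fst (snd (edge_list N ! i))"

definition weight :: "network \<Rightarrow> nat \<Rightarrow> real" where
  "weight N i = snd (snd (edge_list N ! i))"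

definition edge_count :: "network \<Rightarrow> nat" where
  "edge_count N = length (edge_list N)"

definition vertices :: "network \<Rightarrow> nat set" where
  "vertices N = {..<vertex_count N}"

definition edges :: "network \<Rightarrow> nat set set" where
  "edges N = {{src N i, tgt N i} | i. i < edge_count N}"

definition is_network :: "network \<Rightarrow> bool" where
  "is_network N \<longleftrightarrow>
     vertices N \<noteq> {} \<and>
     (\<forall>i < edge_count N. src N i \<in> vertices N \<and> tgt N i \<in> vertices N \<and>
        src N i \<noteq> tgt N i \<and> weight N i > 0) \<and>
     (\<forall>i < edge_count N. \<forall>j < edge_count N.
        {src N i, tgt N i} = {src N j, tgt N j} \<longrightarrow> i = j) \<and>
     (\<forall>a \<in> vertices N. \<forall>b \<in> vertices N. (a, b) \<in> {(x, y). {x, y} \<in> edges N}\<^sup>*)"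

subsection \<open>Parallel-path networks\<close>

definition path_edges :: "nat list \<Rightarrow> nat set set" where
  "path_edges xs = {{xs ! i, xs ! Suc i} | i. Suc i < length xs}"

definition is_path :: "network \<Rightarrow> nat \<Rightarrow> nat \<Rightarrow> nat list \<Rightarrow> bool" where
  "is_path N u v xs \<longleftrightarrow> xs \<noteq> [] \<and> hd xs = u \<and> last xs = v \<and> distinct xs \<and>
     set xs \<subseteq> vertices N \<and> path_edges xs \<subseteq> edges N"

definition parallel_path_network :: "network \<Rightarrow> bool" where
  "parallel_path_network N \<longleftrightarrow> is_network N \<and>
     (\<exists>u v \<P>. u \<in> vertices N \<and> v \<in> vertices N \<and> u \<noteq> v \<and>
        (\<forall>P \<in> \<P>. is_path N u v P) \<and>
        (\<forall>P \<in> \<P>. \<forall>Q \<in> \<P>. P \<noteq> Q \<longrightarrow>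
           path_edges P \<inter> path_edges Q = {} \<and> set P \<inter> set Q = {u, v}) \<and>
        vertices N = (\<Union>P\<in>\<P>. set P) \<and>
        edges N = (\<Union>P\<in>\<P>. path_edges P))"

subsection \<open>Points, network distance, farthest points\<close>

text \<open>
  A pair \<open>(i, l)\<close> specifies the point that splits edge \<open>i\<close> into sub-edges of weight
  \<open>l * weight N i\<close> (on the side of \<open>src N i\<close>) and \<open>(1 - l) * weight N i\<close>.  A vertex is specified
  by one such pair for every incident edge; type \<open>point\<close> identifies these pairs.
\<close>

datatype point = Vertex nat | Inner nat real

definition addresses :: "network \<Rightarrow> (nat \<times> real) set" where
  "addresses N = {..<edge_count N} \<times> {0..1}"

fun point_at :: "network \<Rightarrow> nat \<times> real \<Rightarrow> point" where
  "point_at N (i, l) =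
     (if l = 0 then Vertex (src N i) else if l = 1 then Vertex (tgt N i) else Inner i l)"

definition points :: "network \<Rightarrow> point set" where
  "points N = Vertex ` vertices N \<union> point_at N ` addresses N"

text \<open>
  \<open>route N p q d\<close>: some walk in \<open>N\<close> from \<open>p\<close> to \<open>q\<close> has weighted length \<open>d\<close>.  A walk is a sequence
  of moves along (parts of) single edges.
\<close>

inductive route :: "network \<Rightarrow> point \<Rightarrow> point \<Rightarrow> real \<Rightarrow> bool" for N p where
  start: "p \<in> points N \<Longrightarrow> route N p p 0"
| move: "route N p (point_at N (i, l)) d \<Longrightarrow> (i, l) \<in> addresses N \<Longrightarrow> (i, l') \<in> addresses N \<Longrightarrow>
    route N p (point_at N (i, l')) (d + \<bar>l - l'\<bar> * weight N i)"

definition network_dist :: "network \<Rightarrow> point \<Rightarrow> point \<Rightarrow> real" where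
  "network_dist N p q = Inf {d. route N p q d}"

definition farthest_points :: "network \<Rightarrow> point \<Rightarrow> point set" where
  "farthest_points N p =
     {q \<in> points N. \<forall>r \<in> points N. network_dist N p r \<le> network_dist N p q}"


section \<open>The real RAM\<close>

text \<open>
  Programs of a real RAM.  Word cells hold natural numbers, real cells hold real numbers.  Cells
  are organised in finitely many named registers and finitely many named, dynamically allocated
  arrays.  Words support \<open>+\<close>, truncated \<open>-\<close>, \<open>*\<close>, \<open>div\<close> and comparison, and serve as array indices.
  Reals support exact \<open>+\<close>, \<open>-\<close>, \<open>*\<close>, \<open>/\<close> and comparison only: there is no rounding and no conversion
  from reals to words, and the only real constants are integers.  A program is a finite syntax
  tree, so the same program runs on all inputs.
\<close>

datatype nexp =
    NConst nat
  | NReg string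
  | NGet string nexp
  | NAdd nexp nexp
  | NSub nexp nexp
  | NMul nexp nexp
  | NDiv nexp nexp

datatype rexp =
    RConst int
  | RReg string
  | RGet string nexp
  | RAdd rexp rexp
  | RSub rexp rexp
  | RMul rexp rexp
  | RDiv rexp rexp

datatype bexp =
    NLess nexp nexp
  | NEq nexp nexp
  | RLess rexp rexp
  | BNot bexp
  | BAnd bexp bexp

datatype prog =
    Skip
  | NAssign string nexp
  | RAssign string rexp
  | NNew string nexp
  | RNew string nexp
  | NPut string nexp nexp
  | RPut string nexp rexp
  | Emit nexp rexp
  | Seq prog prog
  | Cond bexp prog prog
  | While bexp prog

text \<open>The component \<open>reported\<close> is a write-only stream, to which \<open>Emit\<close> appends.\<close>

record state =
  nreg :: "string \<Rightarrow> nat"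
  rreg :: "string \<Rightarrow> real"
  narr :: "string \<Rightarrow> nat list"
  rarr :: "string \<Rightarrow> real list"
  reported :: "(nat \<times> real) list"

primrec nval :: "state \<Rightarrow> nexp \<Rightarrow> nat" where
  "nval s (NConst k) = k"
| "nval s (NReg x) = nreg s x"
| "nval s (NGet a e) = narr s a ! nval s e"
| "nval s (NAdd e f) = nval s e + nval s f"
| "nval s (NSub e f) = nval s e - nval s f"
| "nval s (NMul e f) = nval s e * nval s f"
| "nval s (NDiv e f) = nval s e div nval s f"

primrec rval :: "state \<Rightarrow> rexp \<Rightarrow> real" where
  "rval s (RConst k) = of_int k"
| "rval s (RReg x) = rreg s x"
| "rval s (RGet a e) = rarr s a ! nval s e"
| "rval s (RAdd e f) = rval s e + rval s f"
| "rval s (RSub e f) = rval s e - rval s f"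
| "rval s (RMul e f) = rval s e * rval s f"
| "rval s (RDiv e f) = rval s e / rval s f"

primrec bval :: "state \<Rightarrow> bexp \<Rightarrow> bool" where
  "bval s (NLess e f) \<longleftrightarrow> nval s e < nval s f"
| "bval s (NEq e f) \<longleftrightarrow> nval s e = nval s f"
| "bval s (RLess e f) \<longleftrightarrow> rval s e < rval s f"
| "bval s (BNot b) \<longleftrightarrow> \<not> bval s b"
| "bval s (BAnd b c) \<longleftrightarrow> bval s b \<and> bval s c"

text \<open>
  Evaluation is legal if array indices are in range, no divisor is zero and no intermediate word
  exceeds the bound \<open>W\<close>, i.e. words have about \<open>log 2 W\<close> bits.  A program that evaluates an
  illegal expression is stuck.
\<close>

primrec nok :: "nat \<Rightarrow> state \<Rightarrow> nexp \<Rightarrow> bool" where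
  "nok W s (NConst k) \<longleftrightarrow> k \<le> W"
| "nok W s (NReg x) \<longleftrightarrow> nreg s x \<le> W"
| "nok W s (NGet a e) \<longleftrightarrow> nok W s e \<and> nval s e < length (narr s a) \<and> narr s a ! nval s e \<le> W"
| "nok W s (NAdd e f) \<longleftrightarrow> nok W s e \<and> nok W s f \<and> nval s e + nval s f \<le> W"
| "nok W s (NSub e f) \<longleftrightarrow> nok W s e \<and> nok W s f"
| "nok W s (NMul e f) \<longleftrightarrow> nok W s e \<and> nok W s f \<and> nval s e * nval s f \<le> W"
| "nok W s (NDiv e f) \<longleftrightarrow> nok W s e \<and> nok W s f \<and> nval s f \<noteq> 0"

primrec rok :: "nat \<Rightarrow> state \<Rightarrow> rexp \<Rightarrow> bool" where
  "rok W s (RConst k) \<longleftrightarrow> True"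
| "rok W s (RReg x) \<longleftrightarrow> True"
| "rok W s (RGet a e) \<longleftrightarrow> nok W s e \<and> nval s e < length (rarr s a)"
| "rok W s (RAdd e f) \<longleftrightarrow> rok W s e \<and> rok W s f"
| "rok W s (RSub e f) \<longleftrightarrow> rok W s e \<and> rok W s f"
| "rok W s (RMul e f) \<longleftrightarrow> rok W s e \<and> rok W s f"
| "rok W s (RDiv e f) \<longleftrightarrow> rok W s e \<and> rok W s f \<and> rval s f \<noteq> 0"

text \<open>Conjunction is short-circuit, so its left conjunct may guard the right one.\<close>

primrec bok :: "nat \<Rightarrow> state \<Rightarrow> bexp \<Rightarrow> bool" where
  "bok W s (NLess e f) \<longleftrightarrow> nok W s e \<and> nok W s f"
| "bok W s (NEq e f) \<longleftrightarrow> nok W s e \<and> nok W s f"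
| "bok W s (RLess e f) \<longleftrightarrow> rok W s e \<and> rok W s f"
| "bok W s (BNot b) \<longleftrightarrow> bok W s b"
| "bok W s (BAnd b c) \<longleftrightarrow> bok W s b \<and> (bval s b \<longrightarrow> bok W s c)"

text \<open>The time of an evaluation is the number of nodes of the expression.\<close>

primrec ncost :: "nexp \<Rightarrow> nat" where
  "ncost (NConst k) = 1"
| "ncost (NReg x) = 1"
| "ncost (NGet a e) = 1 + ncost e"
| "ncost (NAdd e f) = 1 + ncost e + ncost f"
| "ncost (NSub e f) = 1 + ncost e + ncost f"
| "ncost (NMul e f) = 1 + ncost e + ncost f"
| "ncost (NDiv e f) = 1 + ncost e + ncost f"

primrec rcost :: "rexp \<Rightarrow> nat" where
  "rcost (RConst k) = 1"
| "rcost (RReg x) = 1"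
| "rcost (RGet a e) = 1 + ncost e"
| "rcost (RAdd e f) = 1 + rcost e + rcost f"
| "rcost (RSub e f) = 1 + rcost e + rcost f"
| "rcost (RMul e f) = 1 + rcost e + rcost f"
| "rcost (RDiv e f) = 1 + rcost e + rcost f"

primrec bcost :: "bexp \<Rightarrow> nat" where
  "bcost (NLess e f) = 1 + ncost e + ncost f"
| "bcost (NEq e f) = 1 + ncost e + ncost f"
| "bcost (RLess e f) = 1 + rcost e + rcost f"
| "bcost (BNot b) = 1 + bcost b"
| "bcost (BAnd b c) = 1 + bcost b + bcost c"

text \<open>
  \<open>run W c s t s'\<close>: with word bound \<open>W\<close>, program \<open>c\<close> started in \<open>s\<close> halts in \<open>s'\<close> after time \<open>t\<close>.
  Allocating an array initialises it with zeros and takes time linear in its length.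
\<close>

inductive run :: "nat \<Rightarrow> prog \<Rightarrow> state \<Rightarrow> nat \<Rightarrow> state \<Rightarrow> bool" for W where
  Skip: "run W Skip s 1 s"
| NAssign: "nok W s e \<Longrightarrow>
    run W (NAssign x e) s (1 + ncost e) (s\<lparr>nreg := (nreg s)(x := nval s e)\<rparr>)"
| RAssign: "rok W s e \<Longrightarrow>
    run W (RAssign x e) s (1 + rcost e) (s\<lparr>rreg := (rreg s)(x := rval s e)\<rparr>)"
| NNew: "nok W s e \<Longrightarrow>
    run W (NNew a e) s (1 + ncost e + nval s e)
      (s\<lparr>narr := (narr s)(a := replicate (nval s e) 0)\<rparr>)"
| RNew: "nok W s e \<Longrightarrow>
    run W (RNew a e) s (1 + ncost e + nval s e)
      (s\<lparr>rarr := (rarr s)(a := replicate (nval s e) 0)\<rparr>)"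
| NPut: "nok W s i \<Longrightarrow> nok W s e \<Longrightarrow> nval s i < length (narr s a) \<Longrightarrow>
    run W (NPut a i e) s (1 + ncost i + ncost e)
      (s\<lparr>narr := (narr s)(a := (narr s a)[nval s i := nval s e])\<rparr>)"
| RPut: "nok W s i \<Longrightarrow> rok W s e \<Longrightarrow> nval s i < length (rarr s a) \<Longrightarrow>
    run W (RPut a i e) s (1 + ncost i + rcost e)
      (s\<lparr>rarr := (rarr s)(a := (rarr s a)[nval s i := rval s e])\<rparr>)"
| Emit: "nok W s i \<Longrightarrow> rok W s e \<Longrightarrow>
    run W (Emit i e) s (1 + ncost i + rcost e)
      (s\<lparr>reported := reported s @ [(nval s i, rval s e)]\<rparr>)"
| Seq: "run W c s t s' \<Longrightarrow> run W c' s' t' s'' \<Longrightarrow> run W (Seq c c') s (1 + t + t') s''"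
| CondTrue: "bok W s b \<Longrightarrow> bval s b \<Longrightarrow> run W c s t s' \<Longrightarrow>
    run W (Cond b c c') s (1 + bcost b + t) s'"
| CondFalse: "bok W s b \<Longrightarrow> \<not> bval s b \<Longrightarrow> run W c' s t s' \<Longrightarrow>
    run W (Cond b c c') s (1 + bcost b + t) s'"
| WhileFalse: "bok W s b \<Longrightarrow> \<not> bval s b \<Longrightarrow> run W (While b c) s (1 + bcost b) s"
| WhileTrue: "bok W s b \<Longrightarrow> bval s b \<Longrightarrow> run W c s t s' \<Longrightarrow> run W (While b c) s' t' s'' \<Longrightarrow>
    run W (While b c) s (1 + bcost b + t + t') s''"

text \<open>
  The number of array cells in use.  Registers are not counted: a program has only a constant
  number of them.
\<close>

definition state_size :: "state \<Rightarrow> nat" where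
  "state_size s = (\<Sum>a | narr s a \<noteq> []. length (narr s a)) + (\<Sum>a | rarr s a \<noteq> []. length (rarr s a))"


section \<open>Data structures for farthest-point queries\<close>

definition construction_input :: "network \<Rightarrow> state" where
  "construction_input N = \<lparr>
     nreg = (\<lambda>_. 0)(''n'' := vertex_count N, ''m'' := edge_count N),
     rreg = (\<lambda>_. 0),
     narr = (\<lambda>_. [])(''src'' := map (src N) [0..<edge_count N], ''tgt'' := map (tgt N) [0..<edge_count N]),
     rarr = (\<lambda>_. [])(''weight'' := map (weight N) [0..<edge_count N]),
     reported = []\<rparr>"

definition query_input :: "state \<Rightarrow> nat \<times> real \<Rightarrow> state" where
  "query_input s p = s\<lparr>
     nreg := (nreg s)(''edge'' := fst p),
     rreg := (rreg s)(''lambda'' := snd p),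
     reported := []\<rparr>"

text \<open>
  The states in which the data structure can be found: after its construction, and after any
  finite sequence of queries.
\<close>

inductive ds_state :: "nat \<Rightarrow> prog \<Rightarrow> prog \<Rightarrow> network \<Rightarrow> state \<Rightarrow> bool" for W build query N where
  constructed: "run W build (construction_input N) t s \<Longrightarrow> ds_state W build query N s"
| queried: "ds_state W build query N s \<Longrightarrow> p \<in> addresses N \<Longrightarrow>
    run W query (query_input s p) t s' \<Longrightarrow> ds_state W build query N s'"

text \<open>An output reports a set of points if it specifies every point of the set exactly once.\<close>

definition reports :: "network \<Rightarrow> (nat \<times> real) list \<Rightarrow> point set \<Rightarrow> bool" where
  "reports N out A \<longleftrightarrow> set out \<subseteq> addresses N \<and> distinct (map (point_at N) out) \<and>
     set (map (point_at N) out) = A"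

end

theory Submission
  imports Defs
begin

text \<open>
  Let the paths have lengths \<open>L j\<close>, let \<open>D\<close> be the least of them, and let \<open>p\<close> lie on path \<open>i\<close> at
  distances \<open>du\<close> and \<open>dv\<close> from the terminals.  On any other path \<open>j\<close> the unique farthest point from
  \<open>p\<close> has distance \<open>(du + dv + L j) / 2\<close> and position \<open>(dv - du + L j) / 2\<close>.  So only the longest of
  the other paths matter, and on all of them the farthest point has the same position.  The
  path \<open>i\<close> itself forms a cycle of length \<open>L i + D\<close> with a shortest path; it contributes the
  antipode of \<open>p\<close> on this cycle if that point is an inner point of path \<open>i\<close>, and otherwise no point
  that is not on another path as well.

  It remains to find the edges at one common position \<open>z\<close> on \<open>k\<close> longest paths in time
  \<open>O(k + log n)\<close> after linear preprocessing, which excludes both one binary search per path and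
  merging the paths.  Fractional cascading does it: each path is merged with every second entry
  of the next level, so that the levels have linear total size, and the position of \<open>z\<close> in one
  level determines its position in the next one up to one step.
\<close>

section \<open>Running programs\<close>

text \<open>The terminals are not part of the input, yet every later quantity refers to them. They
  are the vertices of degree different from 2, except when there are exactly two paths: then the
  network is a cycle, and the ends of any edge can serve as terminals, with that edge as one of the
  two paths. Fixing this choice and numbering the paths by the indices of their first edges gives a
  \<open>layout\<close> that the program can reconstruct cell by cell.

  The query time counts distinct points, not paths. If the common position on the other paths is a
  terminal, all candidates are the same point, so reporting has to stop after the first of them. The
  path of the query point may itself be among the longest paths; skipping it costs one iteration
  that reports nothing, and this happens at most once per query.

  The claim about queries concerns every reachable state. Queries write neither arrays nor the
  registers that describe the structure, so a single predicate \<open>ready\<close> survives any run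
  of the query program, and the space never changes after the construction.\<close>

inductive_cases run_SkipE: "run W Skip s t s'"
inductive_cases run_NAssignE: "run W (NAssign x e) s t s'"
inductive_cases run_RAssignE: "run W (RAssign x f) s t s'"
inductive_cases run_NNewE: "run W (NNew a e) s t s'"
inductive_cases run_RNewE: "run W (RNew a e) s t s'"
inductive_cases run_NPutE: "run W (NPut a i e) s t s'"
inductive_cases run_RPutE: "run W (RPut a i f) s t s'"
inductive_cases run_EmitE: "run W (Emit i f) s t s'"
inductive_cases run_SeqE: "run W (Seq c d) s t s'"
inductive_cases run_CondE: "run W (Cond b c d) s t s'"
inductive_cases run_WhileE: "run W (While b c) s t s'"

text \<open>\<open>ds_state\<close> speaks of whatever state a run of the construction ends in,
  whereas the correctness proof exhibits one run. Determinism identifies the two.\<close>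

lemma run_deterministic:
  "run W c s t s' \<Longrightarrow> run W c s t' s'' \<Longrightarrow> t' = t \<and> s'' = s'"
proof (induction arbitrary: t' s'' rule: run.induct)
  case (Seq c s t s' c' t' s'' t'' s''')
  obtain t1 s1 t2 where "t'' = 1 + t1 + t2" "run W c s t1 s1" "run W c' s1 t2 s'''"
    by (rule run_SeqE[OF Seq.prems]) (rule that, auto)
  moreover from this have "t1 = t" "s1 = s'" using Seq.IH(1) by auto
  ultimately show ?case using Seq.IH(2) by auto
next
  case (CondTrue s b c t s' c' t'' s''')
  from CondTrue.prems obtain t1 where "t'' = 1 + bcost b + t1" "run W c s t1 s'''"
    by (cases rule: run_CondE) (use CondTrue.hyps in auto)
  with CondTrue.IH show ?case by auto
next
  case (CondFalse s b c' t s' c t'' s''')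
  from CondFalse.prems obtain t1 where "t'' = 1 + bcost b + t1" "run W c' s t1 s'''"
    by (cases rule: run_CondE) (use CondFalse.hyps in auto)
  with CondFalse.IH show ?case by auto
next
  case (WhileFalse s b c)
  from WhileFalse.prems show ?case by (cases rule: run_WhileE) (use WhileFalse.hyps in auto)
next
  case (WhileTrue s b c t s' t' s'' t'' s''')
  from WhileTrue.prems obtain t1 s1 t2
    where "t'' = 1 + bcost b + t1 + t2" "run W c s t1 s1" "run W (While b c) s1 t2 s'''"
    by (cases rule: run_WhileE) (use WhileTrue.hyps in auto)
  moreover from this have "t1 = t" "s1 = s'" using WhileTrue.IH(1) by auto
  ultimately show ?case using WhileTrue.IH(2) by auto
qed (elim run_SkipE run_NAssignE run_RAssignE run_NNewE run_RNewE run_NPutE run_RPutE run_EmitE;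
    simp)+

lemmas run_intros = run.intros[simplified]

lemma nok_mono: "nok W s e \<Longrightarrow> W \<le> W' \<Longrightarrow> nok W' s e"
  by (induction e) auto

lemma rok_mono: "rok W s e \<Longrightarrow> W \<le> W' \<Longrightarrow> rok W' s e"
  by (induction e) (auto intro: nok_mono)

lemma bok_mono: "bok W s b \<Longrightarrow> W \<le> W' \<Longrightarrow> bok W' s b"
  by (induction b) (auto intro: nok_mono rok_mono)

text \<open>The time bound for allocations is expressed through the word bound, so the construction
  is analysed with the small bound \<open>10 * n\<close>. This lemma carries the run over to the
  bound \<open>C * n\<close> of the theorem, for which the same analysis would exceed the time
  allowed.\<close>

lemma run_mono: "run W c s t s' \<Longrightarrow> W \<le> W' \<Longrightarrow> run W' c s t s'"
proof (induction rule: run.induct)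
  case Seq
  then show ?case by (meson run.Seq)
next
  case WhileTrue
  then show ?case by (meson run.WhileTrue bok_mono)
qed (simp_all add: run_intros nok_mono rok_mono bok_mono)

subsection \<open>Frames\<close>

primrec nreg_writes :: "prog \<Rightarrow> string set" where
  "nreg_writes Skip = {}"
| "nreg_writes (NAssign x e) = {x}"
| "nreg_writes (RAssign x e) = {}"
| "nreg_writes (NNew a e) = {}"
| "nreg_writes (RNew a e) = {}"
| "nreg_writes (NPut a i e) = {}"
| "nreg_writes (RPut a i e) = {}"
| "nreg_writes (Emit i e) = {}"
| "nreg_writes (Seq c d) = nreg_writes c \<union> nreg_writes d"
| "nreg_writes (Cond b c d) = nreg_writes c \<union> nreg_writes d"
| "nreg_writes (While b c) = nreg_writes c"

primrec rreg_writes :: "prog \<Rightarrow> string set" where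
  "rreg_writes Skip = {}"
| "rreg_writes (NAssign x e) = {}"
| "rreg_writes (RAssign x e) = {x}"
| "rreg_writes (NNew a e) = {}"
| "rreg_writes (RNew a e) = {}"
| "rreg_writes (NPut a i e) = {}"
| "rreg_writes (RPut a i e) = {}"
| "rreg_writes (Emit i e) = {}"
| "rreg_writes (Seq c d) = rreg_writes c \<union> rreg_writes d"
| "rreg_writes (Cond b c d) = rreg_writes c \<union> rreg_writes d"
| "rreg_writes (While b c) = rreg_writes c"

primrec narr_writes :: "prog \<Rightarrow> string set" where
  "narr_writes Skip = {}"
| "narr_writes (NAssign x e) = {}"
| "narr_writes (RAssign x e) = {}"
| "narr_writes (NNew a e) = {a}"
| "narr_writes (RNew a e) = {}"
| "narr_writes (NPut a i e) = {a}"
| "narr_writes (RPut a i e) = {}"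
| "narr_writes (Emit i e) = {}"
| "narr_writes (Seq c d) = narr_writes c \<union> narr_writes d"
| "narr_writes (Cond b c d) = narr_writes c \<union> narr_writes d"
| "narr_writes (While b c) = narr_writes c"

primrec rarr_writes :: "prog \<Rightarrow> string set" where
  "rarr_writes Skip = {}"
| "rarr_writes (NAssign x e) = {}"
| "rarr_writes (RAssign x e) = {}"
| "rarr_writes (NNew a e) = {}"
| "rarr_writes (RNew a e) = {a}"
| "rarr_writes (NPut a i e) = {}"
| "rarr_writes (RPut a i e) = {a}"
| "rarr_writes (Emit i e) = {}"
| "rarr_writes (Seq c d) = rarr_writes c \<union> rarr_writes d"
| "rarr_writes (Cond b c d) = rarr_writes c \<union> rarr_writes d"
| "rarr_writes (While b c) = rarr_writes c"

primrec emits :: "prog \<Rightarrow> bool" where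
  "emits Skip \<longleftrightarrow> False"
| "emits (NAssign x e) \<longleftrightarrow> False"
| "emits (RAssign x e) \<longleftrightarrow> False"
| "emits (NNew a e) \<longleftrightarrow> False"
| "emits (RNew a e) \<longleftrightarrow> False"
| "emits (NPut a i e) \<longleftrightarrow> False"
| "emits (RPut a i e) \<longleftrightarrow> False"
| "emits (Emit i e) \<longleftrightarrow> True"
| "emits (Seq c d) \<longleftrightarrow> emits c \<or> emits d"
| "emits (Cond b c d) \<longleftrightarrow> emits c \<or> emits d"
| "emits (While b c) \<longleftrightarrow> emits c"

text \<open>The sets of written names are syntactic over-approximations. A loop invariant then has
  to mention only what the loop changes, and all other facts are recovered from the frame by
  rewriting.\<close>

definition frame :: "prog \<Rightarrow> state \<Rightarrow> state \<Rightarrow> bool" where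
  "frame c s s' \<longleftrightarrow>
     (\<forall>x. x \<notin> nreg_writes c \<longrightarrow> nreg s' x = nreg s x) \<and>
     (\<forall>x. x \<notin> rreg_writes c \<longrightarrow> rreg s' x = rreg s x) \<and>
     (\<forall>a. a \<notin> narr_writes c \<longrightarrow> narr s' a = narr s a) \<and>
     (\<forall>a. a \<notin> rarr_writes c \<longrightarrow> rarr s' a = rarr s a) \<and>
     (\<not> emits c \<longrightarrow> reported s' = reported s)"

lemma frame_refl [simp]: "frame c s s"
  by (simp add: frame_def)

lemma frame_trans: "frame c s s' \<Longrightarrow> frame c s' s'' \<Longrightarrow> frame c s s''"
  by (auto simp: frame_def)

lemma frame_nreg: "frame c s s' \<Longrightarrow> x \<notin> nreg_writes c \<Longrightarrow> nreg s' x = nreg s x"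
  and frame_rreg: "frame c s s' \<Longrightarrow> x \<notin> rreg_writes c \<Longrightarrow> rreg s' x = rreg s x"
  and frame_narr: "frame c s s' \<Longrightarrow> x \<notin> narr_writes c \<Longrightarrow> narr s' x = narr s x"
  and frame_rarr: "frame c s s' \<Longrightarrow> x \<notin> rarr_writes c \<Longrightarrow> rarr s' x = rarr s x"
  and frame_reported: "frame c s s' \<Longrightarrow> \<not> emits c \<Longrightarrow> reported s' = reported s"
  by (auto simp: frame_def)

lemma run_frame: "run W c s t s' \<Longrightarrow> frame c s s'"
  by (induction rule: run.induct) (auto simp: frame_def)

subsection \<open>Straight-line programs\<close>

text \<open>Loop-free programs are evaluated by rewriting, which avoids one rule inversion per
  command. The value at \<open>While\<close> is a dummy; \<open>safe\<close> is false there.\<close>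

primrec exec :: "prog \<Rightarrow> state \<Rightarrow> state" where
  "exec Skip s = s"
| "exec (NAssign x e) s = s\<lparr>nreg := (nreg s)(x := nval s e)\<rparr>"
| "exec (RAssign x e) s = s\<lparr>rreg := (rreg s)(x := rval s e)\<rparr>"
| "exec (NNew a e) s = s\<lparr>narr := (narr s)(a := replicate (nval s e) 0)\<rparr>"
| "exec (RNew a e) s = s\<lparr>rarr := (rarr s)(a := replicate (nval s e) 0)\<rparr>"
| "exec (NPut a i e) s = s\<lparr>narr := (narr s)(a := (narr s a)[nval s i := nval s e])\<rparr>"
| "exec (RPut a i e) s = s\<lparr>rarr := (rarr s)(a := (rarr s a)[nval s i := rval s e])\<rparr>"
| "exec (Emit i e) s = s\<lparr>reported := reported s @ [(nval s i, rval s e)]\<rparr>"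
| "exec (Seq c d) s = exec d (exec c s)"
| "exec (Cond b c d) s = (if bval s b then exec c s else exec d s)"
| "exec (While b c) s = s"

primrec safe :: "nat \<Rightarrow> prog \<Rightarrow> state \<Rightarrow> bool" where
  "safe W Skip s \<longleftrightarrow> True"
| "safe W (NAssign x e) s \<longleftrightarrow> nok W s e"
| "safe W (RAssign x e) s \<longleftrightarrow> rok W s e"
| "safe W (NNew a e) s \<longleftrightarrow> nok W s e"
| "safe W (RNew a e) s \<longleftrightarrow> nok W s e"
| "safe W (NPut a i e) s \<longleftrightarrow> nok W s i \<and> nok W s e \<and> nval s i < length (narr s a)"
| "safe W (RPut a i e) s \<longleftrightarrow> nok W s i \<and> rok W s e \<and> nval s i < length (rarr s a)"
| "safe W (Emit i e) s \<longleftrightarrow> nok W s i \<and> rok W s e"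
| "safe W (Seq c d) s \<longleftrightarrow> safe W c s \<and> safe W d (exec c s)"
| "safe W (Cond b c d) s \<longleftrightarrow> bok W s b \<and> (if bval s b then safe W c s else safe W d s)"
| "safe W (While b c) s \<longleftrightarrow> False"

text \<open>Here \<^term>\<open>B\<close> bounds the lengths of newly allocated arrays.\<close>

primrec max_time :: "nat \<Rightarrow> prog \<Rightarrow> nat" where
  "max_time B Skip = 1"
| "max_time B (NAssign x e) = 1 + ncost e"
| "max_time B (RAssign x e) = 1 + rcost e"
| "max_time B (NNew a e) = 1 + ncost e + B"
| "max_time B (RNew a e) = 1 + ncost e + B"
| "max_time B (NPut a i e) = 1 + ncost i + ncost e"
| "max_time B (RPut a i e) = 1 + ncost i + rcost e"
| "max_time B (Emit i e) = 1 + ncost i + rcost e"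
| "max_time B (Seq c d) = 1 + max_time B c + max_time B d"
| "max_time B (Cond b c d) = 1 + bcost b + max (max_time B c) (max_time B d)"
| "max_time B (While b c) = 0"

primrec allocates :: "prog \<Rightarrow> bool" where
  "allocates Skip \<longleftrightarrow> False"
| "allocates (NAssign x e) \<longleftrightarrow> False"
| "allocates (RAssign x e) \<longleftrightarrow> False"
| "allocates (NNew a e) \<longleftrightarrow> True"
| "allocates (RNew a e) \<longleftrightarrow> True"
| "allocates (NPut a i e) \<longleftrightarrow> False"
| "allocates (RPut a i e) \<longleftrightarrow> False"
| "allocates (Emit i e) \<longleftrightarrow> False"
| "allocates (Seq c d) \<longleftrightarrow> allocates c \<or> allocates d"
| "allocates (Cond b c d) \<longleftrightarrow> allocates c \<or> allocates d"
| "allocates (While b c) \<longleftrightarrow> allocates c"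

text \<open>Subtraction is truncated and division rounds down, so results that \<open>nok\<close>
  does not test are bounded through their operands. In particular no new array is longer than
  \<open>W\<close>.\<close>

lemma nval_le: "nok W s e \<Longrightarrow> nval s e \<le> W"
proof (induction e)
  case (NSub e f)
  then show ?case by simp
next
  case (NDiv e f)
  then show ?case by simp (meson div_le_dividend le_trans)
qed auto

lemma run_exec_alloc:
  "safe W c s \<Longrightarrow> \<exists>t \<le> max_time W c. run W c s t (exec c s)"
proof (induction c arbitrary: s)
  case (Seq c d)
  then obtain t t' where "t \<le> max_time W c" "run W c s t (exec c s)"
    "t' \<le> max_time W d" "run W d (exec c s) t' (exec d (exec c s))"
    by (metis safe.simps(9))
  then show ?case by (intro exI[of _ "1 + t + t'"]) (auto intro: run_intros run.Seq)
next
  case (Cond b c d)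
  show ?case
  proof (cases "bval s b")
    case True
    with Cond obtain t where "t \<le> max_time W c" "run W c s t (exec c s)" by fastforce
    with Cond.prems True show ?thesis
      by (intro exI[of _ "1 + bcost b + t"]) (auto intro: run_intros run.CondTrue)
  next
    case False
    with Cond obtain t where "t \<le> max_time W d" "run W d s t (exec d s)" by fastforce
    with Cond.prems False show ?thesis
      by (intro exI[of _ "1 + bcost b + t"]) (auto intro: run_intros run.CondFalse)
  qed
next
  case (NNew a e)
  then show ?case by (intro exI[of _ "1 + ncost e + nval s e"]) (auto intro: run_intros run.NNew nval_le)
next
  case (RNew a e)
  then show ?case by (intro exI[of _ "1 + ncost e + nval s e"]) (auto intro: run_intros run.RNew nval_le)
next
  case (While b c)
  then show ?case by simp
qed (rule exI, rule conjI, rule order_refl, simp add: run_intros)+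

lemma max_time_no_alloc: "\<not> allocates c \<Longrightarrow> max_time B c = max_time 0 c"
  by (induction c) auto

lemma run_exec:
  "\<not> allocates c \<Longrightarrow> safe W c s \<Longrightarrow> \<exists>t \<le> max_time 0 c. run W c s t (exec c s)"
  using run_exec_alloc[of W c s] max_time_no_alloc[of c W] by simp

primrec block :: "prog list \<Rightarrow> prog" where
  "block [] = Skip"
| "block (c # cs) = Seq c (block cs)"

subsection \<open>Total correctness with time bounds\<close>

text \<open>The frame is part of the postcondition, so the continuation of a sequence or of a loop
  learns what is unchanged without restating it.\<close>

definition runs :: "nat \<Rightarrow> prog \<Rightarrow> state \<Rightarrow> nat \<Rightarrow> (state \<Rightarrow> bool) \<Rightarrow> bool" where
  "runs W c s T Q \<longleftrightarrow> (\<exists>t s'. run W c s t s' \<and> t \<le> T \<and> frame c s s' \<and> Q s')"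

lemma runs_weaken:
  "runs W c s T Q \<Longrightarrow> T \<le> T' \<Longrightarrow> (\<And>s'. frame c s s' \<Longrightarrow> Q s' \<Longrightarrow> Q' s') \<Longrightarrow> runs W c s T' Q'"
  unfolding runs_def by (meson order_trans)

lemma runs_exec:
  "\<not> allocates c \<Longrightarrow> safe W c s \<Longrightarrow> max_time 0 c \<le> T \<Longrightarrow> Q (exec c s) \<Longrightarrow> runs W c s T Q"
  unfolding runs_def using run_exec run_frame by (meson order_trans)

lemma runs_exec_alloc:
  "safe W c s \<Longrightarrow> max_time W c \<le> T \<Longrightarrow> Q (exec c s) \<Longrightarrow> runs W c s T Q"
  unfolding runs_def using run_exec_alloc run_frame by (meson order_trans)

lemma runs_Seq:
  assumes "runs W c s T P" "\<And>s'. frame c s s' \<Longrightarrow> P s' \<Longrightarrow> runs W d s' T' Q" "1 + T + T' \<le> U"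
  shows "runs W (Seq c d) s U Q"
proof -
  from assms(1) obtain t s' where 1: "run W c s t s'" "t \<le> T" "frame c s s'" "P s'"
    unfolding runs_def by blast
  with assms(2) obtain t' s'' where "run W d s' t' s''" "t' \<le> T'" "Q s''"
    unfolding runs_def by blast
  with 1 have "run W (Seq c d) s (1 + t + t') s''" "1 + t + t' \<le> U"
    using assms(3) by (auto intro: run_intros run.Seq)
  with \<open>Q s''\<close> show ?thesis unfolding runs_def using run_frame by blast
qed

lemma runs_Skip: "1 \<le> T \<Longrightarrow> Q s \<Longrightarrow> runs W Skip s T Q"
  by (rule runs_exec) auto

lemma runs_Cond:
  assumes "bok W s b" "bval s b \<Longrightarrow> runs W c s T Q" "\<not> bval s b \<Longrightarrow> runs W d s T Q"
    "1 + bcost b + T \<le> U"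
  shows "runs W (Cond b c d) s U Q"
proof (cases "bval s b")
  case True
  with assms(2) obtain t s' where 1: "run W c s t s'" "t \<le> T" "Q s'"
    unfolding runs_def by blast
  then have "run W (Cond b c d) s (1 + bcost b + t) s'"
    using assms(1) True by (auto intro: run_intros run.CondTrue)
  with 1 assms(4) show ?thesis unfolding runs_def
    by (intro exI[of _ "1 + bcost b + t"] exI[of _ s']) (auto intro: run_frame)
next
  case False
  with assms(3) obtain t s' where 1: "run W d s t s'" "t \<le> T" "Q s'"
    unfolding runs_def by blast
  then have "run W (Cond b c d) s (1 + bcost b + t) s'"
    using assms(1) False by (auto intro: run_intros run.CondFalse)
  with 1 assms(4) show ?thesis unfolding runs_def
    by (intro exI[of _ "1 + bcost b + t"] exI[of _ s']) (auto intro: run_frame)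
qed

definition loop_time :: "bexp \<Rightarrow> prog \<Rightarrow> nat \<Rightarrow> nat" where
  "loop_time b c k = (1 + bcost b + max_time 0 c) * (k + 1)"

text \<open>The index of the invariant is the fuel: a bound on the number of remaining iterations.\<close>

lemma runs_While:
  assumes "\<not> allocates c" and "I k s"
    and ok: "\<And>k s'. frame c s s' \<Longrightarrow> I k s' \<Longrightarrow> bok W s' b"
    and step: "\<And>k s'. frame c s s' \<Longrightarrow> I k s' \<Longrightarrow> bval s' b \<Longrightarrow>
      safe W c s' \<and> (\<exists>k'<k. I k' (exec c s'))"
    and T: "loop_time b c k \<le> T"
    and Q: "\<And>k s'. frame c s s' \<Longrightarrow> I k s' \<Longrightarrow> \<not> bval s' b \<Longrightarrow> Q s'"
  shows "runs W (While b c) s T Q"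
proof -
  have "\<exists>t s''. run W (While b c) s' t s'' \<and> t \<le> loop_time b c k \<and> Q s''"
    if "frame c s s'" "I k s'" for k s'
    using that
  proof (induction k arbitrary: s' rule: less_induct)
    case (less k)
    show ?case
    proof (cases "bval s' b")
      case False
      then have "run W (While b c) s' (1 + bcost b) s'"
        using ok less.prems by (auto intro: run_intros run.WhileFalse)
      moreover have "1 + bcost b \<le> loop_time b c k" by (simp add: loop_time_def)
      ultimately show ?thesis using Q less.prems False by blast
    next
      case True
      from step[OF less.prems True] obtain k' where
        k': "safe W c s'" "k' < k" "I k' (exec c s')" by blast
      obtain t where t: "t \<le> max_time 0 c" "run W c s' t (exec c s')"
        using run_exec[OF assms(1) k'(1)] by blast
      have "frame c s (exec c s')"
        using frame_trans less.prems(1) run_frame[OF t(2)] by blast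
      from less.IH[OF k'(2) this k'(3)] obtain t' s'' where
        t': "run W (While b c) (exec c s') t' s''" "t' \<le> loop_time b c k'" "Q s''" by blast
      have "run W (While b c) s' (1 + bcost b + t + t') s''"
        using ok less.prems True t(2) t'(1) by (auto intro: run_intros run.WhileTrue)
      moreover have "1 + bcost b + t + t' \<le> loop_time b c k"
      proof -
        have "1 + bcost b + t + t' \<le> (1 + bcost b + max_time 0 c) * Suc (k' + 1)"
          using t(1) t'(2) by (simp add: loop_time_def)
        also have "\<dots> \<le> loop_time b c k"
          unfolding loop_time_def using k'(2) by (intro mult_le_mono2) simp
        finally show ?thesis .
      qed
      ultimately show ?thesis using t'(3) by blast
    qed
  qed
  from this[OF frame_refl \<open>I k s\<close>] obtain t s'' where
    r: "run W (While b c) s t s''" "t \<le> loop_time b c k" "Q s''" by blast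
  then have "t \<le> T" using T by simp
  with r show ?thesis unfolding runs_def using run_frame by blast
qed

subsection \<open>Space\<close>

lemma state_size_new:
  fixes f :: "string \<Rightarrow> 'a list"
  assumes "finite {a. f a \<noteq> []}"
  shows "finite {b. (f(a := xs)) b \<noteq> []}"
    and "(\<Sum>b | (f(a := xs)) b \<noteq> []. length ((f(a := xs)) b)) \<le>
      (\<Sum>b | f b \<noteq> []. length (f b)) + length xs"
    and "length xs = length (f a) \<Longrightarrow>
      (\<Sum>b | (f(a := xs)) b \<noteq> []. length ((f(a := xs)) b)) = (\<Sum>b | f b \<noteq> []. length (f b))"
proof -
  let ?A = "{b. f b \<noteq> []}" and ?B = "{b. (f(a := xs)) b \<noteq> []}"
  have sub: "?B \<subseteq> insert a ?A" by auto
  then show fin: "finite ?B" using assms finite_subset by blast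
  \<comment> \<open>The update may add \<open>a\<close> to the range of summation or remove it. Both
    sums are therefore extended to the common range \<open>insert a ?A\<close>, where empty arrays
    contribute zero.\<close>
  have ext: "sum (\<lambda>b. length (g b)) {b. g b \<noteq> []} = sum (\<lambda>b. length (g b)) (insert a ?A)"
    if "{b. g b \<noteq> []} \<subseteq> insert a ?A" for g :: "string \<Rightarrow> 'a list"
    by (rule sum.mono_neutral_left) (use assms that in auto)
  have split: "sum (\<lambda>b. length (g b)) (insert a ?A) =
      length (g a) + sum (\<lambda>b. length (g b)) (?A - {a})" for g :: "string \<Rightarrow> 'a list"
    using assms by (simp add: sum.insert_remove)
  have same: "sum (\<lambda>b. length ((f(a := xs)) b)) (?A - {a}) = sum (\<lambda>b. length (f b)) (?A - {a})"
    by (rule sum.cong) auto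
  show "(\<Sum>b | (f(a := xs)) b \<noteq> []. length ((f(a := xs)) b)) \<le>
      (\<Sum>b | f b \<noteq> []. length (f b)) + length xs"
    using ext[OF sub] ext[OF subset_insertI] split[of f] split[of "f(a := xs)"] same by simp
  show "(\<Sum>b | (f(a := xs)) b \<noteq> []. length ((f(a := xs)) b)) = (\<Sum>b | f b \<noteq> []. length (f b))"
    if "length xs = length (f a)"
    using ext[OF sub] ext[OF subset_insertI] split[of f] split[of "f(a := xs)"] same that by simp
qed

definition finite_state :: "state \<Rightarrow> bool" where
  "finite_state s \<longleftrightarrow> finite {a. narr s a \<noteq> []} \<and> finite {a. rarr s a \<noteq> []}"

text \<open>Memory has to be paid for, since allocation takes time linear in the length of the array.\<close>

lemma run_state_size:
  "run W c s t s' \<Longrightarrow> finite_state s \<Longrightarrow> finite_state s' \<and> state_size s' \<le> state_size s + t"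
proof (induction rule: run.induct)
  case (NNew s e a)
  then show ?case
    using state_size_new[where f = "narr s" and a = a and xs = "replicate (nval s e) 0"]
    by (auto simp: finite_state_def state_size_def simp del: fun_upd_apply)
next
  case (RNew s e a)
  then show ?case
    using state_size_new[where f = "rarr s" and a = a and xs = "replicate (nval s e) 0"]
    by (auto simp: finite_state_def state_size_def simp del: fun_upd_apply)
next
  case (NPut s i e a)
  then show ?case
    using state_size_new[where f = "narr s" and a = a and xs = "(narr s a)[nval s i := nval s e]"]
    by (auto simp: finite_state_def state_size_def simp del: fun_upd_apply)
next
  case (RPut s i e a)
  then show ?case
    using state_size_new[where f = "rarr s" and a = a and xs = "(rarr s a)[nval s i := rval s e]"]
    by (auto simp: finite_state_def state_size_def simp del: fun_upd_apply)
qed (auto simp: finite_state_def state_size_def)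

section \<open>Laying out a parallel-path network\<close>

lemma network_edge_eq:
  "is_network N \<Longrightarrow> i < edge_count N \<Longrightarrow> j < edge_count N \<Longrightarrow>
    {src N i, tgt N i} = {src N j, tgt N j} \<Longrightarrow> i = j"
  unfolding is_network_def by blast

text \<open>The set of paths becomes a table: path \<open>j\<close> has vertices
  \<open>V j 0, ..., V j (len j)\<close> and edges \<open>E j 0, ..., E j (len j - 1)\<close>. The
  axiom \<open>E_first_mono\<close> fixes the numbering of the paths to the order in which a scan of
  the edge list meets their first edges, which is the order in which the traversal finds
  them.\<close>

locale layout =
  fixes N :: network and u v p :: nat and len :: "nat \<Rightarrow> nat" and V E :: "nat \<Rightarrow> nat \<Rightarrow> nat"
  assumes network: "is_network N"
    and terminals: "u \<noteq> v"
    and p_pos: "0 < p"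
    and len_pos: "j < p \<Longrightarrow> 0 < len j"
    and V_first: "j < p \<Longrightarrow> V j 0 = u"
    and V_last: "j < p \<Longrightarrow> V j (len j) = v"
    and V_inner: "j < p \<Longrightarrow> 0 < t \<Longrightarrow> t < len j \<Longrightarrow> V j t \<noteq> u \<and> V j t \<noteq> v"
    and V_inj: "j < p \<Longrightarrow> j' < p \<Longrightarrow> 0 < t \<Longrightarrow> t < len j \<Longrightarrow> 0 < t' \<Longrightarrow> t' < len j' \<Longrightarrow>
      V j t = V j' t' \<Longrightarrow> j = j' \<and> t = t'"
    and V_cover: "a \<in> vertices N \<Longrightarrow> \<exists>j < p. \<exists>t \<le> len j. a = V j t"
    and E_bound: "j < p \<Longrightarrow> t < len j \<Longrightarrow> E j t < edge_count N"
    and E_ends: "j < p \<Longrightarrow> t < len j \<Longrightarrow> {src N (E j t), tgt N (E j t)} = {V j t, V j (Suc t)}"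
    and E_inj: "j < p \<Longrightarrow> j' < p \<Longrightarrow> t < len j \<Longrightarrow> t' < len j' \<Longrightarrow> E j t = E j' t' \<Longrightarrow> j = j' \<and> t = t'"
    and E_cover: "i < edge_count N \<Longrightarrow> \<exists>j < p. \<exists>t < len j. i = E j t"
    and E_first_mono: "j < j' \<Longrightarrow> j' < p \<Longrightarrow> E j 0 < E j' 0"
begin

lemma E_vertices:
  assumes "j < p" "t < len j"
  shows "src N (E j t) < vertex_count N" "tgt N (E j t) < vertex_count N"
    "weight N (E j t) > 0" "src N (E j t) \<noteq> tgt N (E j t)"
  using network E_bound[OF assms] by (auto simp: is_network_def vertices_def)

lemma V_vertex: "j < p \<Longrightarrow> t \<le> len j \<Longrightarrow> V j t < vertex_count N"
proof (cases t)
  case 0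
  assume "j < p" "t \<le> len j"
  then show ?thesis
    using 0 E_ends[of j 0] E_vertices[of j 0] len_pos[of j] by (auto simp: doubleton_eq_iff)
next
  case (Suc t')
  assume "j < p" "t \<le> len j"
  then show ?thesis
    using Suc E_ends[of j t'] E_vertices[of j t'] by (auto simp: doubleton_eq_iff)
qed

text \<open>Inner vertices are pairwise distinct and differ from the terminals, so a common vertex
  of two different paths sits at the same end of both.\<close>

lemma V_eq:
  assumes "j < p" "j' < p" "t \<le> len j" "t' \<le> len j'" "V j t = V j' t'"
  shows "t = 0 \<and> t' = 0 \<or> t = len j \<and> t' = len j' \<or> j = j' \<and> t = t'"
proof -
  have "t = 0 \<and> V j t = u \<or> t = len j \<and> V j t = v \<or> 0 < t \<and> t < len j"
    using assms V_first V_last by (cases "t = 0"; cases "t = len j") auto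
  moreover have "t' = 0 \<and> V j' t' = u \<or> t' = len j' \<and> V j' t' = v \<or> 0 < t' \<and> t' < len j'"
    using assms V_first V_last by (cases "t' = 0"; cases "t' = len j'") auto
  ultimately show ?thesis
    using assms V_inner[of j t] V_inner[of j' t'] V_inj[of j j' t t'] terminals by metis
qed

lemma V_eq_u: "j < p \<Longrightarrow> t \<le> len j \<Longrightarrow> u = V j t \<longleftrightarrow> t = 0"
  using V_first[of j] V_last[of j] V_inner[of j t] terminals
  by (cases "t = 0"; cases "t = len j") auto

lemma V_eq_v: "j < p \<Longrightarrow> t \<le> len j \<Longrightarrow> v = V j t \<longleftrightarrow> t = len j"
  using V_first[of j] V_last[of j] V_inner[of j t] terminals
  by (cases "t = 0"; cases "t = len j") auto

end

section \<open>Incident edges and degrees\<close>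

definition incident :: "network \<Rightarrow> nat \<Rightarrow> nat set" where
  "incident N a = {i. i < edge_count N \<and> (src N i = a \<or> tgt N i = a)}"

context layout begin

lemma incident_iff:
  "i \<in> incident N a \<longleftrightarrow> (\<exists>j < p. \<exists>t < len j. i = E j t \<and> (a = V j t \<or> a = V j (Suc t)))"
proof
  assume i: "i \<in> incident N a"
  then obtain j t where jt: "j < p" "t < len j" "i = E j t"
    using E_cover[of i] by (auto simp: incident_def)
  with i E_ends[of j t] show "\<exists>j < p. \<exists>t < len j. i = E j t \<and> (a = V j t \<or> a = V j (Suc t))"
    by (auto simp: incident_def doubleton_eq_iff)
next
  assume "\<exists>j < p. \<exists>t < len j. i = E j t \<and> (a = V j t \<or> a = V j (Suc t))"
  then obtain j t where "j < p" "t < len j" "i = E j t" "a = V j t \<or> a = V j (Suc t)" by blast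
  with E_bound[of j t] E_ends[of j t] show "i \<in> incident N a"
    by (auto simp: incident_def doubleton_eq_iff)
qed

lemma incident_first: "incident N u = (\<lambda>j. E j 0) ` {..<p}"
proof (intro set_eqI)
  fix i
  have *: "(u = V j t \<or> u = V j (Suc t)) \<longleftrightarrow> t = 0" if "j < p" "t < len j" for j t
    using that V_eq_u[of j t] V_eq_u[of j "Suc t"] by simp
  have "(\<exists>j < p. \<exists>t < len j. i = E j t \<and> (u = V j t \<or> u = V j (Suc t))) \<longleftrightarrow>
      (\<exists>j < p. i = E j 0)"
    using * len_pos by metis
  then show "i \<in> incident N u \<longleftrightarrow> i \<in> (\<lambda>j. E j 0) ` {..<p}"
    unfolding incident_iff by blast
qed

lemma incident_last: "incident N v = (\<lambda>j. E j (len j - 1)) ` {..<p}"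
proof (intro set_eqI)
  fix i
  have *: "(v = V j t \<or> v = V j (Suc t)) \<longleftrightarrow> t = len j - 1" if "j < p" "t < len j" for j t
    using that V_eq_v[of j t] V_eq_v[of j "Suc t"] by auto
  have "(\<exists>j < p. \<exists>t < len j. i = E j t \<and> (v = V j t \<or> v = V j (Suc t))) \<longleftrightarrow>
      (\<exists>j < p. i = E j (len j - 1))"
    using * len_pos by (metis diff_less zero_less_one)
  then show "i \<in> incident N v \<longleftrightarrow> i \<in> (\<lambda>j. E j (len j - 1)) ` {..<p}"
    unfolding incident_iff by blast
qed

lemma incident_inner:
  assumes "j < p" "Suc t < len j"
  shows "incident N (V j (Suc t)) = {E j t, E j (Suc t)}"
proof (intro set_eqI)
  fix i
  have *: "(V j (Suc t) = V j' t' \<or> V j (Suc t) = V j' (Suc t')) \<longleftrightarrow> j' = j \<and> (t' = t \<or> t' = Suc t)"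
    if "j' < p" "t' < len j'" for j' t'
  proof -
    have "V j (Suc t) = V j' t' \<longleftrightarrow> j' = j \<and> t' = Suc t"
      using that assms V_eq[of j j' "Suc t" t'] by auto
    moreover have "V j (Suc t) = V j' (Suc t') \<longleftrightarrow> j' = j \<and> t' = t"
      using that assms V_eq[of j j' "Suc t" "Suc t'"] by auto
    ultimately show ?thesis by blast
  qed
  have "(\<exists>j' < p. \<exists>t' < len j'. i = E j' t' \<and> (V j (Suc t) = V j' t' \<or> V j (Suc t) = V j' (Suc t'))) \<longleftrightarrow>
      i = E j t \<or> i = E j (Suc t)"
    using * assms by (metis Suc_lessD)
  then show "i \<in> incident N (V j (Suc t)) \<longleftrightarrow> i \<in> {E j t, E j (Suc t)}"
    unfolding incident_iff by blast
qed

lemma card_incident_first: "card (incident N u) = p"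
proof -
  have "inj_on (\<lambda>j. E j 0) {..<p}"
    by (rule inj_onI) (use E_inj[of _ _ 0 0] len_pos in auto)
  then show ?thesis by (simp add: incident_first card_image)
qed

lemma card_incident_last: "card (incident N v) = p"
proof -
  have "inj_on (\<lambda>j. E j (len j - 1)) {..<p}"
  proof (rule inj_onI)
    fix j j' assume "j \<in> {..<p}" "j' \<in> {..<p}" "E j (len j - 1) = E j' (len j' - 1)"
    then show "j = j'" using E_inj[of j j' "len j - 1" "len j' - 1"] len_pos by auto
  qed
  then show ?thesis by (simp add: incident_last card_image)
qed

lemma card_incident_inner:
  "j < p \<Longrightarrow> Suc t < len j \<Longrightarrow> card (incident N (V j (Suc t))) = 2"
  using E_inj[of j j t "Suc t"] by (auto simp: incident_inner card_insert_if)

text \<open>Inner vertices have degree 2 and both terminals have degree \<open>p\<close>, so degrees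
  reveal the terminals unless the network is a cycle.\<close>

lemma degree_not_2:
  "{a \<in> vertices N. card (incident N a) \<noteq> 2} = (if p = 2 then {} else {u, v})"
proof -
  have "u \<in> vertices N" "v \<in> vertices N"
    using V_vertex[of 0 0] V_vertex[of 0 "len 0"] V_first[of 0] V_last[of 0] p_pos
    by (auto simp: vertices_def)
  moreover have "card (incident N a) = 2" if a: "a \<in> vertices N" "a \<noteq> u" "a \<noteq> v" for a
  proof -
    from V_cover[OF a(1)] obtain j t where jt: "j < p" "t \<le> len j" "a = V j t" by blast
    with a V_first V_last obtain t' where "t = Suc t'" "t < len j"
      by (metis le_neq_implies_less not0_implies_Suc)
    with jt show ?thesis using card_incident_inner by simp
  qed
  ultimately show ?thesis using card_incident_first card_incident_last by (cases "p = 2") auto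
qed

section \<open>Storing the paths consecutively; linear bounds on the numbers of paths and
  edges\<close>

definition st :: "nat \<Rightarrow> nat" where "st j = (\<Sum>i<j. len i)"

lemma st_0 [simp]: "st 0 = 0" and st_Suc: "st (Suc j) = st j + len j"
  by (simp_all add: st_def)

lemma st_mono: "i \<le> j \<Longrightarrow> st i \<le> st j"
  unfolding st_def by (rule sum_mono2) auto

lemma st_bound: "j < p \<Longrightarrow> t \<le> len j \<Longrightarrow> st j + t \<le> st p"
  using st_mono[of "Suc j" p] by (simp add: st_Suc)

lemma st_inj:
  assumes "t < len j" "t' < len j'" "st j + t = st j' + t'"
  shows "j = j' \<and> t = t'"
proof (cases j j' rule: linorder_cases)
  case less
  then have "st (Suc j) \<le> st j'" by (intro st_mono) simp
  with assms show ?thesis by (simp add: st_Suc)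
next
  case greater
  then have "st (Suc j') \<le> st j" by (intro st_mono) simp
  with assms show ?thesis by (simp add: st_Suc)
qed (use assms in auto)

text \<open>\<open>E\<close> is a bijection between the pairs \<open>(j, t)\<close> and the edge
  indices, so storing all paths one after another fills one cell per edge.\<close>

lemma st_p: "st p = edge_count N"
proof -
  let ?A = "Sigma {..<p} (\<lambda>j. {..<len j})"
  have "bij_betw (\<lambda>(j, t). E j t) ?A {..<edge_count N}"
    unfolding bij_betw_def
  proof
    show "inj_on (\<lambda>(j, t). E j t) ?A"
    proof (rule inj_onI)
      fix x y assume "x \<in> ?A" "y \<in> ?A" "(\<lambda>(j, t). E j t) x = (\<lambda>(j, t). E j t) y"
      then show "x = y"
        using E_inj[of "fst x" "fst y" "snd x" "snd y"] by (auto simp: split_beta prod_eq_iff)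
    qed
    show "(\<lambda>(j, t). E j t) ` ?A = {..<edge_count N}"
      using E_bound E_cover by (force simp: image_iff)
  qed
  then have "card ?A = edge_count N" using bij_betw_same_card by fastforce
  then show ?thesis by (simp add: st_def)
qed

lemma p_le_m: "p \<le> edge_count N"
proof -
  have "(\<Sum>j<p. 1) \<le> (\<Sum>j<p. len j)"
    by (rule sum_mono) (use len_pos in \<open>simp add: Suc_leI\<close>)
  then show ?thesis using st_p by (simp add: st_def)
qed

text \<open>The second vertices of the paths are pairwise distinct: two of them could only agree at
  \<open>v\<close>, but then both paths would consist of the one edge from \<open>u\<close> to
  \<open>v\<close>.\<close>

lemma p_le_n: "p \<le> vertex_count N"
proof -
  have "inj_on (\<lambda>j. V j 1) {..<p}"
  proof (rule inj_onI)
    fix j j' assume j: "j \<in> {..<p}" "j' \<in> {..<p}" "V j 1 = V j' 1"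
    then have "j = j' \<or> len j = 1 \<and> len j' = 1"
      using V_eq[of j j' 1 1] len_pos[of j] len_pos[of j'] by auto
    then show "j = j'"
    proof
      assume l: "len j = 1 \<and> len j' = 1"
      with j E_ends[of j 0] E_ends[of j' 0] V_first[of j] V_first[of j']
      have "{src N (E j 0), tgt N (E j 0)} = {src N (E j' 0), tgt N (E j' 0)}" by simp
      with j l have "E j 0 = E j' 0"
        using network_edge_eq[OF network] E_bound[of j 0] E_bound[of j' 0] by auto
      with j l show ?thesis using E_inj[of j j' 0 0] by simp
    qed
  qed
  moreover have "(\<lambda>j. V j 1) ` {..<p} \<subseteq> {..<vertex_count N}"
    using V_vertex len_pos by (auto simp: Suc_leI)
  ultimately have "card {..<p} \<le> card {..<vertex_count N}"
    using card_inj_on_le by blast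
  then show ?thesis by simp
qed

text \<open>A path has one inner vertex less than edges, and inner vertices are distinct, so the
  number of edges is at most \<open>n + p\<close>. This makes every bound that is linear in the
  edges linear in the vertices.\<close>

lemma m_le_2n: "edge_count N \<le> 2 * vertex_count N"
proof -
  let ?A = "Sigma {..<p} (\<lambda>j. {1..<len j})"
  have "inj_on (\<lambda>(j, t). V j t) ?A"
  proof (rule inj_onI)
    fix x y assume "x \<in> ?A" "y \<in> ?A" "(\<lambda>(j, t). V j t) x = (\<lambda>(j, t). V j t) y"
    then show "x = y"
      using V_inj[of "fst x" "fst y" "snd x" "snd y"] by (auto simp: split_beta prod_eq_iff)
  qed
  moreover have "(\<lambda>(j, t). V j t) ` ?A \<subseteq> {..<vertex_count N}"
    by (auto intro!: V_vertex)
  ultimately have "card ?A \<le> card {..<vertex_count N}"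
    using card_inj_on_le by blast
  then have "(\<Sum>j<p. len j - 1) \<le> vertex_count N" by simp
  moreover have "(\<Sum>j<p. len j - 1) + p = (\<Sum>j<p. len j)"
  proof -
    have "(\<Sum>j<p. len j) = (\<Sum>j<p. (len j - 1) + 1)"
      by (rule sum.cong) (use len_pos in \<open>simp_all add: Suc_leI\<close>)
    then show ?thesis by (simp only: sum.distrib) simp
  qed
  ultimately show ?thesis using p_le_n st_p by (simp add: st_def)
qed

lemma n_ge_2: "2 \<le> vertex_count N"
proof -
  have "{u, v} \<subseteq> {..<vertex_count N}"
    using V_vertex[of 0 0] V_vertex[of 0 "len 0"] V_first[of 0] V_last[of 0] p_pos by auto
  from card_mono[OF _ this] show ?thesis using terminals by simp
qed

end

subsection \<open>Families of paths\<close>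

text \<open>The body of \<open>parallel_path_network\<close> with its witnesses exposed, so that
  they can be exchanged for other witnesses on the same network.\<close>

definition path_family :: "network \<Rightarrow> nat \<Rightarrow> nat \<Rightarrow> nat list set \<Rightarrow> bool" where
  "path_family N u v \<P> \<longleftrightarrow> u \<in> vertices N \<and> v \<in> vertices N \<and> u \<noteq> v \<and>
        (\<forall>P \<in> \<P>. is_path N u v P) \<and>
        (\<forall>P \<in> \<P>. \<forall>Q \<in> \<P>. P \<noteq> Q \<longrightarrow>
           path_edges P \<inter> path_edges Q = {} \<and> set P \<inter> set Q = {u, v}) \<and>
        vertices N = (\<Union>P\<in>\<P>. set P) \<and>
        edges N = (\<Union>P\<in>\<P>. path_edges P)"

lemma parallel_path_network_iff:
  "parallel_path_network N \<longleftrightarrow> is_network N \<and> (\<exists>u v \<P>. path_family N u v \<P>)"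
  by (simp add: parallel_path_network_def path_family_def)

text \<open>Simplicity lets a pair of adjacent vertices name its edge. The paths are then sorted by
  the index of their first edge, as \<open>E_first_mono\<close> demands; these indices differ
  because the paths are edge-disjoint.\<close>

lemma layout_of_path_family:
  assumes N: "is_network N" and fam: "path_family N u v \<P>"
  shows "\<exists>len V E. layout N u v (card \<P>) len V E"
proof -
  define edge where "edge a b = (THE i. i < edge_count N \<and> {src N i, tgt N i} = {a, b})" for a b
  define key where "key P = edge (P ! 0) (P ! 1)" for P
  have path: "is_path N u v P" if "P \<in> \<P>" for P
    using that fam by (auto simp: path_family_def)
  have disj: "path_edges P \<inter> path_edges Q = {}" "set P \<inter> set Q = {u, v}"
    if "P \<in> \<P>" "Q \<in> \<P>" "P \<noteq> Q" for P Q
    using that fam by (auto simp: path_family_def)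
  have uv: "u \<noteq> v" using fam by (simp add: path_family_def)
  have len2: "2 \<le> length P" if "P \<in> \<P>" for P
    using path[OF that] uv by (cases P; cases "tl P") (auto simp: is_path_def)
  have edge: "edge a b < edge_count N \<and> {src N (edge a b), tgt N (edge a b)} = {a, b}"
    if "{a, b} \<in> edges N" for a b
  proof -
    from that obtain i where "i < edge_count N \<and> {src N i, tgt N i} = {a, b}"
      by (auto simp: edges_def)
    moreover have "i = j" if "i < edge_count N \<and> {src N i, tgt N i} = {a, b}"
      "j < edge_count N \<and> {src N j, tgt N j} = {a, b}" for i j
      by (rule network_edge_eq[OF N]) (use that in auto)
    ultimately have "\<exists>!i. i < edge_count N \<and> {src N i, tgt N i} = {a, b}" by blast
    then show ?thesis unfolding edge_def by (rule theI')
  qed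
  have edge_path: "{P ! t, P ! Suc t} \<in> path_edges P" "{P ! t, P ! Suc t} \<in> edges N"
    if "P \<in> \<P>" "t < length P - 1" for P t
  proof -
    show "{P ! t, P ! Suc t} \<in> path_edges P" using that unfolding path_edges_def by force
    then show "{P ! t, P ! Suc t} \<in> edges N" using path[OF that(1)] by (auto simp: is_path_def)
  qed
  have edge_eq: "P = Q \<and> t = t'"
    if *: "P \<in> \<P>" "Q \<in> \<P>" "t < length P - 1" "t' < length Q - 1"
      "edge (P ! t) (P ! Suc t) = edge (Q ! t') (Q ! Suc t')" for P Q t t'
  proof -
    have e: "{P ! t, P ! Suc t} = {Q ! t', Q ! Suc t'}"
      using edge[OF edge_path(2)[OF *(1,3)]] edge[OF edge_path(2)[OF *(2,4)]] *(5) by metis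
    then have PQ: "P = Q"
      using disj(1)[OF *(1,2)] edge_path(1)[OF *(1,3)] edge_path(1)[OF *(2,4)] by (metis disjoint_iff)
    have "distinct P" using path[OF *(1)] by (simp add: is_path_def)
    with e PQ * have "t = t'" by (auto simp: doubleton_eq_iff nth_eq_iff_index_eq)
    with PQ show ?thesis by simp
  qed
  \<comment> \<open>The family is not assumed to be finite; it is finite because paths are
    duplicate-free lists over finitely many vertices.\<close>
  have "\<P> \<subseteq> {xs. set xs \<subseteq> vertices N \<and> distinct xs}"
    using path by (auto simp: is_path_def)
  then have fin: "finite \<P>"
    by (rule finite_subset) (simp add: finite_subset_distinct vertices_def)
  have inj: "inj_on key \<P>"
  proof (rule inj_onI)
    fix P Q assume "P \<in> \<P>" "Q \<in> \<P>" "key P = key Q"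
    then show "P = Q" using edge_eq[of P Q 0 0] len2[of P] len2[of Q] by (simp add: key_def)
  qed
  define K where "K = sorted_list_of_set (key ` \<P>)"
  define Q where "Q j = inv_into \<P> key (K ! j)" for j
  define p where "p = card \<P>"
  have lenK: "length K = p"
    using card_image[OF inj] fin by (simp add: K_def p_def)
  have setK: "set K = key ` \<P>" using fin by (simp add: K_def)
  have Q: "Q j \<in> \<P>" "key (Q j) = K ! j" if "j < p" for j
  proof -
    have "K ! j \<in> key ` \<P>" using that setK lenK nth_mem by blast
    then show "Q j \<in> \<P>" "key (Q j) = K ! j"
      unfolding Q_def by (simp_all add: inv_into_into f_inv_into_f)
  qed
  have K_mono: "K ! j < K ! j'" if "j < j'" "j' < p" for j j'
    using sorted_wrt_nth_less[of "(<)" K j j'] that lenK by (simp add: K_def)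
  have Q_inj: "j = j'" if "j < p" "j' < p" "Q j = Q j'" for j j'
    using that Q K_mono[of j j'] K_mono[of j' j] by (metis linorder_neqE_nat order_less_irrefl)
  have Q_surj: "\<exists>j < p. Q j = P" if "P \<in> \<P>" for P
  proof -
    from that setK lenK obtain j where "j < p" "K ! j = key P"
      by (metis image_eqI in_set_conv_nth)
    with that inj show ?thesis by (auto simp: Q_def)
  qed
  have "layout N u v p (\<lambda>j. length (Q j) - 1) (\<lambda>j t. Q j ! t) (\<lambda>j t. edge (Q j ! t) (Q j ! Suc t))"
  proof
    show "is_network N" "u \<noteq> v" by fact+
    have "\<P> \<noteq> {}" using fam by (auto simp: path_family_def)
    then show "0 < p" using fin by (simp add: p_def card_gt_0_iff)
  next
    fix j assume j: "j < p"
    show "0 < length (Q j) - 1" using len2[OF Q(1)[OF j]] by simp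
    show "Q j ! 0 = u" "Q j ! (length (Q j) - 1) = v"
      using path[OF Q(1)[OF j]] by (auto simp: is_path_def hd_conv_nth last_conv_nth)
    fix t assume t: "0 < t" "t < length (Q j) - 1"
    have "distinct (Q j)" using path[OF Q(1)[OF j]] by (simp add: is_path_def)
    moreover have "Q j \<noteq> []" using t by auto
    ultimately show "Q j ! t \<noteq> u \<and> Q j ! t \<noteq> v"
      using t \<open>Q j ! 0 = u\<close> \<open>Q j ! (length (Q j) - 1) = v\<close>
        nth_eq_iff_index_eq[of "Q j" t 0] nth_eq_iff_index_eq[of "Q j" t "length (Q j) - 1"] by auto
    fix j' t'
    assume j': "j' < p" "0 < t'" "t' < length (Q j') - 1" "Q j ! t = Q j' ! t'"
    have "j = j'"
    proof (rule ccontr)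
      assume "j \<noteq> j'"
      then have "set (Q j) \<inter> set (Q j') = {u, v}"
        using disj(2) Q(1) j j'(1) Q_inj by blast
      moreover have "Q j ! t \<in> set (Q j)" "Q j' ! t' \<in> set (Q j')"
        using t j'(3) by (auto intro!: nth_mem simp del: One_nat_def)
      ultimately show False
        using \<open>Q j ! t \<noteq> u \<and> Q j ! t \<noteq> v\<close> j'(4) by auto
    qed
    then show "j = j' \<and> t = t'"
      using t j' \<open>distinct (Q j)\<close> nth_eq_iff_index_eq[of "Q j" t t'] by auto
  next
    fix a assume "a \<in> vertices N"
    then obtain P where "P \<in> \<P>" "a \<in> set P" using fam by (auto simp: path_family_def)
    with Q_surj obtain j where "j < p" "a \<in> set (Q j)" by blast
    then obtain t where "t < length (Q j)" "a = Q j ! t" by (auto simp: in_set_conv_nth)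
    with \<open>j < p\<close> show "\<exists>j < p. \<exists>t \<le> length (Q j) - 1. a = Q j ! t"
      by (intro exI[of _ j] conjI exI[of _ t]) auto
  next
    fix j t assume "j < p" "t < length (Q j) - 1"
    then show "edge (Q j ! t) (Q j ! Suc t) < edge_count N"
      "{src N (edge (Q j ! t) (Q j ! Suc t)), tgt N (edge (Q j ! t) (Q j ! Suc t))} =
       {Q j ! t, Q j ! Suc t}"
      using edge[OF edge_path(2)] Q(1) by blast+
  next
    fix j j' t t'
    assume "j < p" "j' < p" "t < length (Q j) - 1" "t' < length (Q j') - 1"
      "edge (Q j ! t) (Q j ! Suc t) = edge (Q j' ! t') (Q j' ! Suc t')"
    then show "j = j' \<and> t = t'" using edge_eq[OF Q(1) Q(1)] Q_inj by metis
  next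
    fix i assume i: "i < edge_count N"
    then have "{src N i, tgt N i} \<in> edges N" by (auto simp: edges_def)
    then obtain P where "P \<in> \<P>" "{src N i, tgt N i} \<in> path_edges P"
      using fam by (auto simp: path_family_def)
    with Q_surj obtain j where j: "j < p" "{src N i, tgt N i} \<in> path_edges (Q j)" by blast
    then obtain t where t: "Suc t < length (Q j)" "{src N i, tgt N i} = {Q j ! t, Q j ! Suc t}"
      unfolding path_edges_def by blast
    then have "i = edge (Q j ! t) (Q j ! Suc t)"
      using edge[OF edge_path(2)[OF Q(1)[OF j(1)], of t]] i
      by (intro network_edge_eq[OF N]) auto
    with j t show "\<exists>j < p. \<exists>t < length (Q j) - 1. i = edge (Q j ! t) (Q j ! Suc t)"
      by (metis Suc_eq_plus1 less_diff_conv)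
  next
    fix j j' assume "j < j'" "j' < p"
    then show "edge (Q j ! 0) (Q j ! Suc 0) < edge (Q j' ! 0) (Q j' ! Suc 0)"
      using K_mono[of j j'] Q(2)[of j] Q(2)[of j'] by (simp add: key_def)
  qed
  then show ?thesis unfolding p_def by blast
qed

section \<open>Edges of composed and reversed paths, and the choice of terminals on a cycle\<close>

lemma path_edges_simps [simp]:
  "path_edges [] = {}" "path_edges [x] = {}"
  "path_edges (x # y # xs) = insert {x, y} (path_edges (y # xs))"
proof -
  have *: "path_edges xs = (\<lambda>i. {xs ! i, xs ! Suc i}) ` {..<length xs - 1}" for xs
    by (auto simp: path_edges_def)
  show "path_edges [] = {}" "path_edges [x] = {}" by (simp_all add: *)
  show "path_edges (x # y # xs) = insert {x, y} (path_edges (y # xs))"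
    by (simp add: * lessThan_Suc_eq_insert_0 image_image)
qed

lemma path_edges_append: "path_edges (xs @ x # ys) = path_edges (xs @ [x]) \<union> path_edges (x # ys)"
proof (induction xs)
  case (Cons z xs)
  then show ?case by (cases xs) auto
qed simp

lemma path_edges_rev [simp]: "path_edges (rev xs) = path_edges xs"
proof (induction xs)
  case (Cons z xs)
  show ?case
  proof (cases xs)
    case (Cons y ys)
    have "path_edges (rev (z # xs)) = path_edges (rev ys @ y # [z])" using Cons by simp
    also have "\<dots> = path_edges (rev xs) \<union> {{y, z}}"
      by (subst path_edges_append) (simp add: Cons)
    finally show ?thesis using Cons.IH Cons by auto
  qed simp
qed simp

lemma path_edges_subset: "e \<in> path_edges xs \<Longrightarrow> e \<subseteq> set xs"
  by (auto simp: path_edges_def)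

lemma path_family_rev: "path_family N u v \<P> \<Longrightarrow> path_family N v u (rev ` \<P>)"
  by (auto simp: path_family_def is_path_def hd_rev last_rev insert_commute)

text \<open>Any edge of a cycle is one of the two paths between its endpoints.\<close>

lemma path_family_cycle:
  assumes fam: "path_family N u v {P, Q}" and PQ: "P \<noteq> Q" and P: "P = X @ c # d # Y"
  shows "\<exists>\<P>. path_family N c d \<P>"
proof -
  have path: "is_path N u v P" "is_path N u v Q"
    and disj: "path_edges P \<inter> path_edges Q = {}" "set P \<inter> set Q = {u, v}"
    and cover: "vertices N = set P \<union> set Q" "edges N = path_edges P \<union> path_edges Q"
    and uv: "u \<noteq> v"
    using fam PQ by (auto simp: path_family_def)
  have "hd (X @ [c]) = u" using path(1) P by (cases X) (auto simp: is_path_def)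
  then obtain Z where Z: "X @ [c] = u # Z" by (cases X) auto
  have "last (d # Y) = v" using path(1) P by (auto simp: is_path_def)
  then obtain Z' where Z': "d # Y = Z' @ [v]"
    by (metis append_butlast_last_id list.distinct(1))
  from path(2) uv obtain M where M: "Q = u # M @ [v]"
    by (cases Q; cases "tl Q" rule: rev_cases) (auto simp: is_path_def)
  \<comment> \<open>The other way from \<open>c\<close> to \<open>d\<close>: backwards along
    \<open>P\<close> to \<open>u\<close>, along \<open>Q\<close> to \<open>v\<close>, and backwards
    along \<open>P\<close> to \<open>d\<close>. The lists \<open>Z\<close> and \<open>Z'\<close>
    omit \<open>u\<close> and \<open>v\<close>, which \<open>Q\<close> already contains.\<close>
  define R where "R = rev Z @ Q @ rev Z'"
  have R: "R = rev (X @ [c]) @ M @ rev (d # Y)" by (simp add: R_def M Z Z')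
  have P': "P = (u # Z) @ Z' @ [v]" using P Z Z' by (metis append.assoc append_Cons append_Nil)
  have dP: "distinct P" "distinct Q" using path by (auto simp: is_path_def)
  have eR: "path_edges R = path_edges (X @ [c]) \<union> path_edges Q \<union> path_edges (d # Y)"
  proof -
    have "path_edges R = path_edges (rev Z @ u # (M @ v # rev Z'))" by (simp add: R_def M)
    also have "\<dots> = path_edges (rev (u # Z)) \<union> path_edges ((u # M) @ v # rev Z')"
      by (subst path_edges_append) simp
    also have "path_edges ((u # M) @ v # rev Z') = path_edges Q \<union> path_edges (rev (Z' @ [v]))"
      by (subst path_edges_append) (simp add: M)
    finally show ?thesis by (simp only: Z Z' Un_assoc path_edges_rev)
  qed
  have eP: "path_edges P = path_edges (X @ [c]) \<union> insert {c, d} (path_edges (d # Y))"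
    unfolding P by (subst path_edges_append) simp
  have sets: "set P = set (X @ [c]) \<union> set (d # Y)" by (auto simp: P)
  have sR: "set R = set P \<union> set Q"   proof -
    have "set (rev Z @ Q @ rev Z') = set (u # Z) \<union> set Q \<union> set (Z' @ [v])" by (auto simp: M)
    then show ?thesis unfolding R_def sets Z Z' by blast
  qed
  have cd: "c \<noteq> d" "d \<notin> set (X @ [c])" "c \<notin> set (d # Y)" using dP by (auto simp: P)
  \<comment> \<open>The edge is not on the detour: \<open>Q\<close> shares no edge with
    \<open>P\<close>, and each of the two remaining pieces of \<open>P\<close> misses one of
    \<open>c\<close> and \<open>d\<close>.\<close>
  have new: "{c, d} \<notin> path_edges R"
  proof
    assume "{c, d} \<in> path_edges R"
    moreover have "{c, d} \<notin> path_edges Q" using disj(1) eP by auto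
    ultimately show False       using cd eR path_edges_subset[of "{c, d}" "X @ [c]"] path_edges_subset[of "{c, d}" "d # Y"]
      by auto
  qed
  have "distinct R"
  proof -
    have "set Z \<inter> set Q = {}" "set Z' \<inter> set Q = {}" "set Z \<inter> set Z' = {}"
      using disj(2) dP P' by auto
    then show ?thesis using dP P' by (auto simp: R_def)
  qed
  moreover have "hd R = c" "last R = d" by (simp_all add: R)
  ultimately have "is_path N c d R"
    using cover eR eP sR by (auto simp: is_path_def)
  moreover have "is_path N c d [c, d]"
    using cover eP sets cd by (auto simp: is_path_def)
  ultimately have "path_family N c d {[c, d], R}"
    unfolding path_family_def using cover eR eP sR sets cd new by auto
  then show ?thesis by blast
qed

text \<open>A network may admit several pairs of terminals and both orders of each pair. The
  condition selects one that a program can find by looking at degrees: the two exceptional vertices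
  in increasing order or, on a cycle, the ends of edge 0 in the order given.\<close>

lemma layout_exists:
  assumes "parallel_path_network N"
  shows "\<exists>u v p len V E. layout N u v p len V E \<and>
    (if {a \<in> vertices N. card (incident N a) \<noteq> 2} = {} then u = src N 0 \<and> v = tgt N 0
     else {a \<in> vertices N. card (incident N a) \<noteq> 2} = {u, v} \<and> u < v)"
proof -
  from assms obtain u v \<P> where N: "is_network N" and fam: "path_family N u v \<P>"
    by (auto simp: parallel_path_network_iff)
  from layout_of_path_family[OF N fam] obtain len V E where
    lay: "layout N u v (card \<P>) len V E" by blast
  then interpret layout N u v "card \<P>" len V E .
  show ?thesis
  proof (cases "card \<P> = 2")
    case False
    then have T: "{a \<in> vertices N. card (incident N a) \<noteq> 2} = {u, v}" by (simp add: degree_not_2)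
    show ?thesis
    proof (cases "u < v")
      case True
      with T lay show ?thesis
        by (intro exI[of _ u] exI[of _ v] exI[of _ "card \<P>"] exI[of _ len] exI[of _ V] exI[of _ E]) auto
    next
      case False
      with terminals have "v < u" by simp
      moreover from layout_of_path_family[OF N path_family_rev[OF fam]] obtain p len V E where
        "layout N v u p len V E" by blast
      ultimately show ?thesis using T
        by (intro exI[of _ v] exI[of _ u] exI[of _ p] exI[of _ len] exI[of _ V] exI[of _ E]) auto
    qed
  next
    case True
    then have T: "{a \<in> vertices N. card (incident N a) \<noteq> 2} = {}" by (simp add: degree_not_2)
    from True obtain P Q where PQ: "\<P> = {P, Q}" "P \<noteq> Q" by (auto simp: card_2_iff)
    \<comment> \<open>On a cycle any edge would do; edge 0 is the one that is read off
      directly.\<close>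
    have "0 < edge_count N" using E_bound[of 0 0] len_pos[of 0] p_pos by auto
    then have "{src N 0, tgt N 0} \<in> edges N" by (auto simp: edges_def)
    with fam PQ obtain R S where "\<P> = {R, S}" "R \<noteq> S" "{src N 0, tgt N 0} \<in> path_edges R"
      by (auto simp: path_family_def insert_commute)
    then obtain t where t: "Suc t < length R" "{src N 0, tgt N 0} = {R ! t, R ! Suc t}"
      unfolding path_edges_def by blast
    then have "R = take t R @ R ! t # R ! Suc t # drop (Suc (Suc t)) R"
      by (metis Cons_nth_drop_Suc Suc_lessD append_take_drop_id)
    from path_family_cycle[OF fam[unfolded \<open>\<P> = {R, S}\<close>] \<open>R \<noteq> S\<close> this] obtain \<Q>
      where "path_family N (R ! t) (R ! Suc t) \<Q>" by blast
    \<comment> \<open>The path may traverse edge 0 from its target to its source; reversing the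
      family puts the source first.\<close>
    with path_family_rev t(2) obtain \<Q> where "path_family N (src N 0) (tgt N 0) \<Q>"
      by (metis doubleton_eq_iff)
    from layout_of_path_family[OF N this] show ?thesis using T by auto
  qed
qed

section \<open>Distances in a parallel-path network\<close>

context layout begin

subsection \<open>Coordinates\<close>

definition pos :: "nat \<Rightarrow> nat \<Rightarrow> real" where
  "pos j t = (\<Sum>s<t. weight N (E j s))"

definition L :: "nat \<Rightarrow> real" where
  "L j = pos j (len j)"

lemma pos_0 [simp]: "pos j 0 = 0" and pos_Suc: "pos j (Suc t) = pos j t + weight N (E j t)"
  by (simp_all add: pos_def)

lemma pos_strict_mono:
  assumes "j < p" "t < t'" "t' \<le> len j" shows "pos j t < pos j t'"
  using assms(2,3)
proof (induction t' rule: less_induct)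
  case (less t')
  then obtain t'' where t'': "t' = Suc t''" by (cases t') auto
  have "0 < weight N (E j t'')" using E_vertices[OF assms(1), of t''] less t'' by simp
  then show ?case
    using less.prems less.IH[of t''] t'' by (cases "t = t''") (auto simp: pos_Suc)
qed

lemma pos_mono: "j < p \<Longrightarrow> t \<le> t' \<Longrightarrow> t' \<le> len j \<Longrightarrow> pos j t \<le> pos j t'"
  using pos_strict_mono[of j t t'] by (cases "t = t'") auto

lemma pos_inj: "j < p \<Longrightarrow> t \<le> len j \<Longrightarrow> t' \<le> len j \<Longrightarrow> pos j t = pos j t' \<longleftrightarrow> t = t'"
  using pos_strict_mono[of j t t'] pos_strict_mono[of j t' t] by (cases t t' rule: linorder_cases) auto

lemma pos_nonneg: "j < p \<Longrightarrow> t \<le> len j \<Longrightarrow> 0 \<le> pos j t"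
  using pos_mono[of j 0 t] by simp

lemma pos_le_L: "j < p \<Longrightarrow> t \<le> len j \<Longrightarrow> pos j t \<le> L j"
  using pos_mono[of j t "len j"] by (simp add: L_def)

lemma L_pos: "j < p \<Longrightarrow> 0 < L j"
  using pos_strict_mono[of j 0 "len j"] len_pos[of j] by (simp add: L_def)

text \<open>Closed at both ends, so that a breakpoint between two edges lies in two cells and every
  move along an edge can be stated within one cell.\<close>

definition cell :: "nat \<Rightarrow> nat \<Rightarrow> real \<Rightarrow> bool" where
  "cell j t y \<longleftrightarrow> t < len j \<and> pos j t \<le> y \<and> y \<le> pos j (Suc t)"

text \<open>The parameter of an address runs from \<open>src\<close> to \<open>tgt\<close>, the
  coordinate from \<open>u\<close> to \<open>v\<close>; hence the reflection for edges listed in the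
  opposite direction.\<close>

definition addr :: "nat \<Rightarrow> nat \<Rightarrow> real \<Rightarrow> nat \<times> real" where
  "addr j t y = (E j t, if src N (E j t) = V j t then (y - pos j t) / weight N (E j t)
     else 1 - (y - pos j t) / weight N (E j t))"

text \<open>At a breakpoint the choice picks one of two cells. By \<open>pt_cell\<close> the result
  does not depend on it, since \<open>point_at\<close> identifies the addresses of a vertex.\<close>

definition pt :: "nat \<Rightarrow> real \<Rightarrow> point" where
  "pt j y = point_at N (addr j (SOME t. cell j t y) y)"

lemma E_orient:
  assumes "j < p" "t < len j"
  shows "src N (E j t) = V j t \<and> tgt N (E j t) = V j (Suc t) \<or>
    src N (E j t) = V j (Suc t) \<and> tgt N (E j t) = V j t \<and> src N (E j t) \<noteq> V j t"
  using E_ends[OF assms] E_vertices(4)[OF assms] by (auto simp: doubleton_eq_iff)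

lemma cell_bounds: "j < p \<Longrightarrow> cell j t y \<Longrightarrow> 0 \<le> y \<and> y \<le> L j"
  using pos_nonneg[of j t] pos_le_L[of j "Suc t"] unfolding cell_def by force

lemma cell_exists:
  assumes "j < p" "0 \<le> y" "y \<le> L j" shows "\<exists>t. cell j t y"
proof -
  define t where "t = (LEAST t. y \<le> pos j (Suc t))"
  have "y \<le> pos j (Suc (len j - 1))" using assms len_pos[of j] by (simp add: L_def)
  then have t: "y \<le> pos j (Suc t)" "t \<le> len j - 1"
    unfolding t_def by (rule LeastI, rule Least_le)
  have "pos j t \<le> y"
  proof (cases t)
    case (Suc t')
    then have "\<not> y \<le> pos j (Suc t')" using not_less_Least[of t' "\<lambda>t. y \<le> pos j (Suc t)"]
      by (simp add: t_def)
    with Suc show ?thesis by simp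
  qed (use assms in simp)
  with t show ?thesis using len_pos[OF assms(1)] by (auto simp: cell_def intro!: exI[of _ t])
qed

lemma addr_in_addresses:
  assumes "j < p" "cell j t y" shows "addr j t y \<in> addresses N"
proof -
  have "t < len j" "pos j t \<le> y" "y \<le> pos j t + weight N (E j t)"
    using assms by (auto simp: cell_def pos_Suc)
  then show ?thesis
    using E_bound[of j t] E_vertices[of j t] assms(1)
    by (auto simp: addresses_def addr_def divide_le_eq_1_pos intro!: divide_nonneg_pos)
qed

lemma point_at_cell:
  assumes "j < p" "cell j t y"
  shows "point_at N (addr j t y) =
    (if y = pos j t then Vertex (V j t) else if y = pos j (Suc t) then Vertex (V j (Suc t))
     else Inner (E j t) (snd (addr j t y)))"
proof -
  have t: "t < len j" using assms by (simp add: cell_def)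
  have w: "0 < weight N (E j t)" using E_vertices[of j t] assms(1) t by simp
  show ?thesis
    using E_orient[OF assms(1) t] w by (auto simp: addr_def pos_Suc field_simps)
qed

lemma cell_boundary:
  assumes "j < p" "cell j t y" "cell j t' y" "t < t'"
  shows "t' = Suc t \<and> y = pos j t' \<and> pos j t < y"
proof -
  have c: "t < len j" "y \<le> pos j (Suc t)" "t' < len j" "pos j t' \<le> y"
    using assms(2,3) by (simp_all add: cell_def)
  have "\<not> Suc t < t'" using pos_strict_mono[OF assms(1), of "Suc t" t'] c by auto
  with assms(4) have "t' = Suc t" by simp
  with c pos_strict_mono[OF assms(1), of t t'] show ?thesis by simp
qed

lemma point_at_boundary:
  assumes "j < p" "cell j t y" "cell j t' y" "t < t'"
  shows "point_at N (addr j t y) = point_at N (addr j t' y)"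
  using cell_boundary[OF assms] point_at_cell[OF assms(1,2)] point_at_cell[OF assms(1,3)] by auto

lemma pt_cell:
  assumes "j < p" "cell j t y" shows "point_at N (addr j t y) = pt j y"
proof -
  define t' where "t' = (SOME t. cell j t y)"
  have t': "cell j t' y" unfolding t'_def using assms(2) by (rule someI)
  have "point_at N (addr j t y) = point_at N (addr j t' y)"
  proof (cases t t' rule: linorder_cases)
    case less
    then show ?thesis by (rule point_at_boundary[OF assms t'])
  next
    case greater
    then show ?thesis by (rule point_at_boundary[OF assms(1) t' assms(2), symmetric])
  qed simp
  then show ?thesis by (simp add: pt_def t'_def)
qed

lemma pt_vertex:
  assumes "j < p" "t \<le> len j" shows "pt j (pos j t) = Vertex (V j t)"
proof (cases "t < len j")
  case True
  then have c: "cell j t (pos j t)" using pos_mono[of j t "Suc t"] assms by (simp add: cell_def)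
  show ?thesis using point_at_cell[OF assms(1) c] pt_cell[OF assms(1) c] by simp
next
  case False
  with assms obtain t' where t': "t = Suc t'" "t' < len j" using len_pos[of j] by (cases t) auto
  then have c: "cell j t' (pos j t)" using pos_mono[of j t' "Suc t'"] assms by (simp add: cell_def)
  have "pos j t' \<noteq> pos j t" using pos_inj[of j t' t] t' assms by simp
  with t' show ?thesis using point_at_cell[OF assms(1) c] pt_cell[OF assms(1) c] by simp
qed

lemma pt_cases:
  assumes "j < p" "0 \<le> y" "y \<le> L j"
  obtains (vertex) t where "t \<le> len j" "y = pos j t" "pt j y = Vertex (V j t)"
  | (inner) t where "cell j t y" "pt j y = Inner (E j t) (snd (addr j t y))"
proof -
  from cell_exists[OF assms] obtain t where t: "cell j t y" by blast
  then have "t < len j" by (simp add: cell_def)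
  consider "y = pos j t" | "y = pos j (Suc t)" | "y \<noteq> pos j t" "y \<noteq> pos j (Suc t)" by blast
  then show ?thesis
  proof cases
    case 1
    with \<open>t < len j\<close> pt_vertex[of j t] assms(1) show ?thesis by (intro vertex[of t]) auto
  next
    case 2
    with \<open>t < len j\<close> pt_vertex[of j "Suc t"] assms(1) show ?thesis by (intro vertex[of "Suc t"]) auto
  next
    case 3
    with t pt_cell[OF assms(1) t] point_at_cell[OF assms(1) t] show ?thesis by (intro inner[of t]) auto
  qed
qed

text \<open>An inner point names its edge, hence its path and cell by \<open>E_inj\<close>, and a
  vertex is located by \<open>V_eq\<close>. The exceptions are the terminals, which all paths
  share.\<close>

lemma pt_eq_iff:
  assumes "j < p" "0 \<le> y" "y \<le> L j" "j' < p" "0 \<le> y'" "y' \<le> L j'"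
  shows "pt j y = pt j' y' \<longleftrightarrow> j = j' \<and> y = y' \<or> y = 0 \<and> y' = 0 \<or> y = L j \<and> y' = L j'"
proof
  assume "pt j y = pt j' y'"
  note eq = this
  from assms(1-3) show "j = j' \<and> y = y' \<or> y = 0 \<and> y' = 0 \<or> y = L j \<and> y' = L j'"
  proof (cases rule: pt_cases)
    case (vertex t)
    note v = this
    from assms(4-6) show ?thesis
    proof (cases rule: pt_cases)
      case (vertex t')
      with v eq V_eq[of j j' t t'] assms show ?thesis by (auto simp: L_def)
    qed (use v eq in simp)
  next
    case (inner t)
    note i = this
    from assms(4-6) show ?thesis
    proof (cases rule: pt_cases)
      case (inner t')
      have t: "t < len j" "t' < len j'" using inner i by (auto simp: cell_def)
      have e: "E j t = E j' t'" "snd (addr j t y) = snd (addr j' t' y')"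
        using inner i eq by auto
      then have jt: "j = j'" "t = t'" using E_inj[of j j' t t'] assms t by auto
      have "y = y'"
        using e(2) E_vertices[OF assms(1) t(1)] unfolding jt
        by (auto simp: addr_def split: if_splits)
      with jt show ?thesis by simp
    qed (use i eq in simp)
  qed
next
  assume "j = j' \<and> y = y' \<or> y = 0 \<and> y' = 0 \<or> y = L j \<and> y' = L j'"
  moreover have "pt j 0 = pt j' 0" "pt j (L j) = pt j' (L j')"
    using pt_vertex[of j 0] pt_vertex[of j' 0] pt_vertex[of j "len j"] pt_vertex[of j' "len j'"]
      assms(1,4) by (simp_all add: V_first V_last L_def)
  ultimately show "pt j y = pt j' y'" by (elim disjE conjE) simp_all
qed

lemma pt_0: "j < p \<Longrightarrow> j' < p \<Longrightarrow> pt j 0 = pt j' 0"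
  and pt_L: "j < p \<Longrightarrow> j' < p \<Longrightarrow> pt j (L j) = pt j' (L j')"
  using pt_vertex[of j 0] pt_vertex[of j' 0] pt_vertex[of j "len j"] pt_vertex[of j' "len j'"]
  by (simp_all add: V_first V_last L_def)

lemma address_cases:
  assumes "(i, l) \<in> addresses N"
  obtains j t y where "j < p" "cell j t y" "addr j t y = (i, l)"
    "y = pos j t + (if src N i = V j t then l else 1 - l) * weight N i"
proof -
  have i: "i < edge_count N" "0 \<le> l" "l \<le> 1" using assms by (auto simp: addresses_def)
  then obtain j t where jt: "j < p" "t < len j" "i = E j t" using E_cover by blast
  have w: "0 < weight N i" using jt E_vertices by simp
  define y where "y = pos j t + (if src N i = V j t then l else 1 - l) * weight N i"
  have "cell j t y"
    using i w jt unfolding y_def cell_def pos_Suc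
    by (auto intro: mult_left_le_one_le simp: mult_left_le_one_le)
  moreover have "addr j t y = (i, l)" using w jt by (simp add: addr_def y_def)
  ultimately show ?thesis using that jt(1) y_def by blast
qed

text \<open>Every point has a coordinate on some path, so from here on the network is a bundle of
  segments glued together at their ends.\<close>

lemma points_eq: "points N = {pt j y | j y. j < p \<and> 0 \<le> y \<and> y \<le> L j}"
proof (intro set_eqI iffI)
  fix q assume "q \<in> points N"
  then consider a where "a \<in> vertices N" "q = Vertex a" | i l where "(i, l) \<in> addresses N" "q = point_at N (i, l)"
    by (auto simp: points_def)
  then show "q \<in> {pt j y | j y. j < p \<and> 0 \<le> y \<and> y \<le> L j}"
  proof cases
    case 1
    with V_cover obtain j t where "j < p" "t \<le> len j" "a = V j t" by blast
    then show ?thesis using 1 pt_vertex[of j t] pos_nonneg[of j t] pos_le_L[of j t]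
      by (intro CollectI exI[of _ j] exI[of _ "pos j t"]) simp
  next
    case 2
    from address_cases[OF 2(1)] obtain j t y where *: "j < p" "cell j t y" "addr j t y = (i, l)" by metis
    then show ?thesis using 2 pt_cell[OF *(1,2)] cell_bounds[OF *(1,2)]
      by (intro CollectI exI[of _ j] exI[of _ y]) simp
  qed
next
  fix q assume "q \<in> {pt j y | j y. j < p \<and> 0 \<le> y \<and> y \<le> L j}"
  then obtain j y t where *: "j < p" "cell j t y" "q = pt j y" using cell_exists by blast
  then show "q \<in> points N"
    using addr_in_addresses[OF *(1,2)] pt_cell[OF *(1,2)] unfolding points_def
    by (metis UnCI imageI)
qed

subsection \<open>Walks along paths\<close>

lemma frac_diff:
  assumes "j < p" "t < len j"
  shows "\<bar>snd (addr j t y) - snd (addr j t y')\<bar> * weight N (E j t) = \<bar>y - y'\<bar>"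
proof -
  have w: "0 < weight N (E j t)" using E_vertices assms by simp
  have "\<bar>snd (addr j t y) - snd (addr j t y')\<bar> = \<bar>(y - y') / weight N (E j t)\<bar>"
    using w by (auto simp: addr_def diff_divide_distrib)
  with w show ?thesis by (simp add: abs_divide)
qed

lemma route_cell:
  assumes "route N q (pt j y) d" "j < p" "cell j t y" "cell j t y'"
  shows "route N q (pt j y') (d + \<bar>y - y'\<bar>)"
proof -
  have t: "t < len j" using assms by (simp add: cell_def)
  have "route N q (point_at N (E j t, snd (addr j t y))) d"
    using assms pt_cell[OF assms(2,3)] by (simp add: addr_def)
  moreover have "(E j t, snd (addr j t y)) \<in> addresses N" "(E j t, snd (addr j t y')) \<in> addresses N"
    using addr_in_addresses[OF assms(2,3)] addr_in_addresses[OF assms(2,4)] by (simp_all add: addr_def)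
  ultimately have "route N q (point_at N (E j t, snd (addr j t y')))
      (d + \<bar>snd (addr j t y) - snd (addr j t y')\<bar> * weight N (E j t))"
    by (rule route.move)
  then show ?thesis
    using pt_cell[OF assms(2,4)] frac_diff[OF assms(2) t] by (simp add: addr_def)
qed

lemma route_up:
  assumes "route N q (pt j y) d" "j < p" "0 \<le> y"
  shows "t \<le> len j \<Longrightarrow> y \<le> pos j t \<Longrightarrow> route N q (pt j (pos j t)) (d + (pos j t - y))"
proof (induction t)
  case 0
  with assms show ?case by simp
next
  case (Suc t)
  have c: "cell j t (pos j t)" "cell j t (pos j (Suc t))"
    using Suc.prems assms(2) pos_mono[of j t "Suc t"] by (auto simp: cell_def)
  show ?case
  proof (cases "y \<le> pos j t")
    case True
    with Suc have "route N q (pt j (pos j t)) (d + (pos j t - y))" by simp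
    from route_cell[OF this assms(2) c] show ?thesis
      using pos_mono[of j t "Suc t"] assms(2) Suc.prems by (simp add: algebra_simps)
  next
    case False
    then have "cell j t y" using Suc.prems by (simp add: cell_def)
    from route_cell[OF assms(1,2) this c(2)] show ?thesis using Suc.prems by simp
  qed
qed

lemma route_down:
  assumes "route N q (pt j y) d" "j < p" "y \<le> L j"
  shows "t \<le> len j \<Longrightarrow> pos j t \<le> y \<Longrightarrow> route N q (pt j (pos j t)) (d + (y - pos j t))"
proof (induction "len j - t" arbitrary: t)
  case 0
  with assms show ?case by (simp add: L_def)
next
  case (Suc k)
  then have t: "t < len j" by simp
  have c: "cell j t (pos j t)" "cell j t (pos j (Suc t))"
    using t assms(2) pos_mono[of j t "Suc t"] by (auto simp: cell_def)
  show ?case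
  proof (cases "pos j (Suc t) \<le> y")
    case True
    with Suc.hyps t have "route N q (pt j (pos j (Suc t))) (d + (y - pos j (Suc t)))" by simp
    from route_cell[OF this assms(2) c(2,1)] show ?thesis
      using pos_mono[of j t "Suc t"] assms(2) t by (simp add: algebra_simps)
  next
    case False
    then have "cell j t y" using Suc.prems t by (simp add: cell_def)
    from route_cell[OF assms(1,2) this c(1)] show ?thesis using Suc.prems by simp
  qed
qed

text \<open>A single move cannot pass a vertex. The walk therefore goes to the breakpoint of the
  target cell that faces the start, and then within that cell.\<close>

lemma route_along:
  assumes "route N q (pt j y) d" "j < p" "0 \<le> y" "y \<le> L j" "0 \<le> y'" "y' \<le> L j"
  shows "route N q (pt j y') (d + \<bar>y - y'\<bar>)"
proof -
  from cell_exists[OF assms(2,5,6)] obtain t where t: "cell j t y'" by blast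
  then have tl: "t < len j" by (simp add: cell_def)
  have c: "cell j t (pos j t)" "cell j t (pos j (Suc t))"
    using tl assms(2) pos_mono[of j t "Suc t"] by (auto simp: cell_def)
  consider "cell j t y" | "y < pos j t" | "pos j (Suc t) < y" using tl
    unfolding cell_def by linarith
  then show ?thesis
  proof cases
    case 1
    from route_cell[OF assms(1,2) this t] show ?thesis .
  next
    case 2
    with route_up[OF assms(1,2,3), of t] tl
    have "route N q (pt j (pos j t)) (d + (pos j t - y))" by simp
    from route_cell[OF this assms(2) c(1) t] show ?thesis using t 2 by (simp add: cell_def)
  next
    case 3
    with route_down[OF assms(1,2,4), of "Suc t"] tl
    have "route N q (pt j (pos j (Suc t))) (d + (y - pos j (Suc t)))" by simp
    from route_cell[OF this assms(2) c(2) t] show ?thesis using t 3 by (simp add: cell_def)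
  qed
qed

text \<open>A potential argument: \<open>f\<close> vanishes at the start, changes by at most the
  length moved, and has one value at each terminal on all paths; so no walk to a point is shorter
  than \<open>f\<close> there. Walks that turn around or repeat a path are covered without being
  analysed.\<close>

lemma route_ge:
  assumes "route N (pt i x) q d"
    and i: "i < p" "0 \<le> x" "x \<le> L i" and start: "f i x = 0"
    and lip: "\<And>j y y'. j < p \<Longrightarrow> 0 \<le> y \<Longrightarrow> y \<le> L j \<Longrightarrow> 0 \<le> y' \<Longrightarrow> y' \<le> L j \<Longrightarrow> f j y' \<le> f j y + \<bar>y - y'\<bar>"
    and zero: "\<And>j. j < p \<Longrightarrow> f j 0 = f i 0" and full: "\<And>j. j < p \<Longrightarrow> f j (L j) = f i (L i)"
    and "q = pt j y" "j < p" "0 \<le> y" "y \<le> L j"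
  shows "f j y \<le> d"
  using assms(1,9-)
proof (induction arbitrary: j y rule: route.induct)
  case start
  then have "i = j \<and> x = y \<or> x = 0 \<and> y = 0 \<or> x = L i \<and> y = L j" using pt_eq_iff i by blast
  then show ?case using assms(5) zero full start by auto
next
  case (move a l d l')
  from address_cases[OF move.hyps(2)] obtain j0 t0 y0 where
    0: "j0 < p" "cell j0 t0 y0" "addr j0 t0 y0 = (a, l)" by metis
  from address_cases[OF move.hyps(3)] obtain j1 t1 y1 where
    1: "j1 < p" "cell j1 t1 y1" "addr j1 t1 y1 = (a, l')" by metis
  have jt: "j1 = j0" "t1 = t0"
    using 0 1 E_inj[of j1 j0 t1 t0] by (auto simp: addr_def cell_def)
  have q0: "point_at N (a, l) = pt j0 y0" "point_at N (a, l') = pt j0 y1"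
    using pt_cell 0 1 jt by metis+
  have b: "0 \<le> y0" "y0 \<le> L j0" "0 \<le> y1" "y1 \<le> L j0" using cell_bounds 0 1 jt by auto
  have "f j0 y0 \<le> d" using move.IH[OF q0(1)] 0 b by simp
  moreover have "\<bar>y0 - y1\<bar> = \<bar>l - l'\<bar> * weight N a"
    using frac_diff[of j0 t0 y0 y1] 0 1 jt by (auto simp: cell_def addr_def)
  moreover have "f j0 y1 \<le> f j0 y0 + \<bar>y0 - y1\<bar>" using lip 0 b by blast
  moreover have "f j y = f j0 y1"
  proof -
    have "j = j0 \<and> y = y1 \<or> y = 0 \<and> y1 = 0 \<or> y = L j \<and> y1 = L j0"
      using pt_eq_iff[of j y j0 y1] move.prems q0(2) 0 b by simp
    then show ?thesis using zero full 0(1) move.prems(2) by auto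
  qed
  ultimately show ?case by simp
qed

subsection \<open>The distance function\<close>

definition D :: real where "D = Min (L ` {..<p})"

lemma D_le: "j < p \<Longrightarrow> D \<le> L j"
  by (simp add: D_def)

lemma D_attained: "\<exists>j < p. L j = D"
proof -
  have "D \<in> L ` {..<p}" unfolding D_def by (rule Min_in) (use p_pos in auto)
  then show ?thesis by auto
qed

lemma D_eqI: "j < p \<Longrightarrow> (\<And>i. i < p \<Longrightarrow> L j \<le> L i) \<Longrightarrow> D = L j"
  using D_attained D_le by (metis order_antisym)

lemma D_pos: "0 < D"
  using D_attained L_pos by metis

text \<open>Distances from the query point to the terminals \<open>u\<close> and \<open>v\<close>:
  directly, or through the other terminal and along a shortest path. If path \<open>i\<close> is
  itself the only shortest path, then the detour formally uses it twice, but it has length at least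
  \<open>D = L i\<close> and so never beats the direct way.\<close>

definition du :: "nat \<Rightarrow> real \<Rightarrow> real" where "du i x = min x (L i - x + D)"
definition dv :: "nat \<Rightarrow> real \<Rightarrow> real" where "dv i x = min (L i - x) (x + D)"

definition path_dist :: "nat \<Rightarrow> real \<Rightarrow> nat \<Rightarrow> real \<Rightarrow> real" where
  "path_dist i x j y =
     (if j = i then min \<bar>x - y\<bar> (L i - \<bar>x - y\<bar> + D) else min (du i x + y) (dv i x + L j - y))"

lemma route_path_dist:
  assumes i: "i < p" "0 \<le> x" "x \<le> L i" and j: "j < p" "0 \<le> y" "y \<le> L j"
  shows "route N (pt i x) (pt j y) (path_dist i x j y)"
proof -
  obtain m where m: "m < p" "L m = D" using D_attained by blast
  let ?R = "route N (pt i x)"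
  have start: "?R (pt i x) 0" by (rule route.start) (use i points_eq in auto)
  have u1: "?R (pt i 0) x" using route_along[OF start i, of 0] i by simp
  have v1: "?R (pt i (L i)) (L i - x)" using route_along[OF start i, of "L i"] i by simp
  have uv: "?R (pt k (L k)) (d + D)" if "?R (pt k 0) d" "k < p" for k d
    using that route_along[of "pt i x" m 0 d D] m pt_0[of k m] pt_L[of k m] D_pos by simp
  have vu: "?R (pt k 0) (d + D)" if "?R (pt k (L k)) d" "k < p" for k d
    using that route_along[of "pt i x" m D d 0] m pt_0[of k m] pt_L[of k m] D_pos by simp
  have u: "?R (pt k 0) (du i x)" if "k < p" for k
    using u1 vu[OF v1 i(1)] pt_0[OF that i(1)] by (simp add: du_def min_def)
  have v: "?R (pt k (L k)) (dv i x)" if "k < p" for k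
    using v1 uv[OF u1 i(1)] pt_L[OF that i(1)] by (simp add: dv_def min_def)
  show ?thesis
  proof (cases "j = i")
    case False
    have "?R (pt j y) (du i x + y)" using route_along[OF u[OF j(1)] j(1) _ _ j(2,3)] j by simp
    moreover have "?R (pt j y) (dv i x + (L j - y))"
      using route_along[OF v[OF j(1)] j(1) _ _ j(2,3)] j by simp
    ultimately show ?thesis using False by (simp add: path_dist_def min_def add_diff_eq)
  next
    case True
    have "?R (pt i y) \<bar>x - y\<bar>" using route_along[OF start i] j True by simp
    moreover have "?R (pt i y) (L i - \<bar>x - y\<bar> + D)"
    proof (cases "x \<le> y")
      case xy: True
      have "?R (pt i y) (x + D + (L i - y))"
        using route_along[OF uv[OF u1 i(1)] i(1), of y] j True by simp
      with xy show ?thesis by (simp add: algebra_simps)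
    next
      case False
      have "?R (pt i y) (L i - x + D + y)"
        using route_along[OF vu[OF v1 i(1)] i(1), of y] j True by simp
      with False show ?thesis by (simp add: algebra_simps)
    qed
    ultimately show ?thesis using True by (simp add: path_dist_def min_def)
  qed
qed

text \<open>\<open>path_dist\<close> is realised by a walk, and as a function of the end point it is
  a potential in the sense of \<open>route_ge\<close>; the two bounds meet.\<close>

lemma network_dist_eq:
  assumes i: "i < p" "0 \<le> x" "x \<le> L i" and j: "j < p" "0 \<le> y" "y \<le> L j"
  shows "network_dist N (pt i x) (pt j y) = path_dist i x j y"
  unfolding network_dist_def
proof (rule cInf_eq_minimum)
  show "path_dist i x j y \<in> {d. route N (pt i x) (pt j y) d}"
    using route_path_dist[OF assms] by simp
next
  fix d assume "d \<in> {d. route N (pt i x) (pt j y) d}"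
  then have r: "route N (pt i x) (pt j y) d" by simp
  \<comment> \<open>At a terminal all branches of the potential have to agree. Together with
    \<open>D \<le> L j\<close> these inequalities say that reaching one terminal through the other
    along path \<open>j\<close> is no shortcut.\<close>
  have Du: "du i x \<le> dv i x + D" and Dv: "dv i x \<le> du i x + D"
    using i D_pos by (auto simp: du_def dv_def min_def)
  show "path_dist i x j y \<le> d"
  proof (rule route_ge[OF r i _ _ _ _ refl j])
    show "path_dist i x i x = 0" using i D_pos by (simp add: path_dist_def)
  next
    fix j y y' show "path_dist i x j y' \<le> path_dist i x j y + \<bar>y - y'\<bar>"
    proof (cases "j = i")
      case True
      then show ?thesis unfolding path_dist_def by simp
    next
      case False
      then show ?thesis unfolding path_dist_def by simp
    qed
  next
    fix j assume "j < p"
    then show "path_dist i x j 0 = path_dist i x i 0"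
      using Du D_le[of j] i by (cases "j = i") (simp_all add: path_dist_def du_def[symmetric])
  next
    fix j assume "j < p"
    then show "path_dist i x j (L j) = path_dist i x i (L i)"
      using Dv D_le[of j] i by (cases "j = i") (simp_all add: path_dist_def dv_def[symmetric])
  qed
qed

subsection \<open>Farthest points\<close>

lemma farthest_points_eq:
  assumes i: "i < p" "0 \<le> x" "x \<le> L i"
    and le: "\<And>j y. j < p \<Longrightarrow> 0 \<le> y \<Longrightarrow> y \<le> L j \<Longrightarrow> path_dist i x j y \<le> M"
    and att: "j0 < p" "0 \<le> y0" "y0 \<le> L j0" "path_dist i x j0 y0 = M"
  shows "farthest_points N (pt i x) =
    {pt j y | j y. j < p \<and> 0 \<le> y \<and> y \<le> L j \<and> path_dist i x j y = M}"
proof (intro set_eqI iffI)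
  fix q assume "q \<in> farthest_points N (pt i x)"
  then have q: "q \<in> points N" "\<forall>r \<in> points N. network_dist N (pt i x) r \<le> network_dist N (pt i x) q"
    by (auto simp: farthest_points_def)
  from q(1) obtain j y where jy: "j < p" "0 \<le> y" "y \<le> L j" "q = pt j y" by (auto simp: points_eq)
  have "pt j0 y0 \<in> points N" using att by (auto simp: points_eq)
  with q(2) have "M \<le> path_dist i x j y"
    using network_dist_eq[OF i att(1-3)] network_dist_eq[OF i jy(1-3)] att(4) jy(4) by auto
  with le[OF jy(1-3)] jy
  show "q \<in> {pt j y | j y. j < p \<and> 0 \<le> y \<and> y \<le> L j \<and> path_dist i x j y = M}" by force
next
  fix q assume "q \<in> {pt j y | j y. j < p \<and> 0 \<le> y \<and> y \<le> L j \<and> path_dist i x j y = M}"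
  then obtain j y where jy: "j < p" "0 \<le> y" "y \<le> L j" "q = pt j y" "path_dist i x j y = M" by auto
  then show "q \<in> farthest_points N (pt i x)"
    unfolding farthest_points_def using network_dist_eq[OF i] le by (auto simp: points_eq)
qed

text \<open>With one path \<open>D\<close> is its own length, the detour in \<open>path_dist\<close>
  never wins, and distances are those of a segment. Both ends are farthest exactly from the
  midpoint.\<close>

lemma farthest_single:
  assumes "p = 1" "0 \<le> x" "x \<le> L 0"
  shows "farthest_points N (pt 0 x) =
    (if L 0 \<le> 2 * x then {pt 0 0} else {}) \<union> (if 2 * x \<le> L 0 then {pt 0 (L 0)} else {})"
proof -
  have D: "D = L 0" using D_eqI[of 0] p_pos assms(1) by auto
  have dist: "path_dist 0 x 0 y = \<bar>x - y\<bar>" if "0 \<le> y" "y \<le> L 0" for y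
    using that assms(2,3) D by (auto simp: path_dist_def min_def)
  let ?y = "if L 0 \<le> 2 * x then 0 else L 0"
  have "farthest_points N (pt 0 x) =
    {pt j y | j y. j < p \<and> 0 \<le> y \<and> y \<le> L j \<and> path_dist 0 x j y = max x (L 0 - x)}"
  proof (rule farthest_points_eq)
    show "path_dist 0 x 0 ?y = max x (L 0 - x)" using assms dist[of 0] dist[of "L 0"] by auto
  qed (use assms dist in auto)
  also have "\<dots> = {pt 0 y | y. 0 \<le> y \<and> y \<le> L 0 \<and> \<bar>x - y\<bar> = max x (L 0 - x)}"
    using assms(1) dist by auto
  also have "\<dots> = (if L 0 \<le> 2 * x then {pt 0 0} else {}) \<union> (if 2 * x \<le> L 0 then {pt 0 (L 0)} else {})"
  proof -
    have "0 \<le> y \<and> y \<le> L 0 \<and> \<bar>x - y\<bar> = max x (L 0 - x) \<longleftrightarrow>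
        y = 0 \<and> L 0 \<le> 2 * x \<or> y = L 0 \<and> 2 * x \<le> L 0" for y
      using assms by (auto simp: max_def abs_if)
    then show ?thesis by auto
  qed
  finally show ?thesis .
qed

text \<open>The cycle of path \<open>i\<close> and a shortest path has half-length
  \<open>c = (L i + D) / 2\<close>. The antipode is an inner point of path \<open>i\<close> if
  \<open>x + c < L i\<close> or \<open>0 < x - c\<close>; these are the two inequalities, cleared of
  the fraction. For a shortest path they are never satisfied.\<close>

definition own :: "nat \<Rightarrow> real \<Rightarrow> bool" where
  "own i x \<longleftrightarrow> 2 * x < L i - D \<or> L i + D < 2 * x"

definition antipode :: "nat \<Rightarrow> real \<Rightarrow> real" where
  "antipode i x = (if 2 * x < L i - D then x + (L i + D) / 2 else x - (L i + D) / 2)"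

lemma own_dist:
  assumes i: "i < p" "0 \<le> x" "x \<le> L i" and "own i x"
  shows "0 < antipode i x" "antipode i x < L i"
    and "0 \<le> y \<Longrightarrow> y \<le> L i \<Longrightarrow> path_dist i x i y \<le> (L i + D) / 2"
    and "0 \<le> y \<Longrightarrow> y \<le> L i \<Longrightarrow> path_dist i x i y = (L i + D) / 2 \<longleftrightarrow> y = antipode i x"
  using assms D_pos by (auto simp: own_def antipode_def path_dist_def min_def abs_if field_simps split: if_splits)

text \<open>On its own path no distance exceeds \<open>(L i + D) / 2\<close>, and
  \<open>D \<le> M\<close>. Equality forces \<open>y\<close> to be the antipode of \<open>x\<close>,
  which in this case can lie on path \<open>i\<close> only at an end.\<close>

lemma not_own_dist:
  assumes i: "i < p" "0 \<le> x" "x \<le> L i" and "\<not> own i x" and "D \<le> M" and y: "0 \<le> y" "y \<le> L i"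
  shows "path_dist i x i y \<le> (du i x + dv i x + M) / 2"
    and "path_dist i x i y = (du i x + dv i x + M) / 2 \<Longrightarrow> y = 0 \<or> y = L i"
proof -
  have "du i x = x" "dv i x = L i - x" using assms by (auto simp: own_def du_def dv_def min_def)
  then show "path_dist i x i y \<le> (du i x + dv i x + M) / 2"
    "path_dist i x i y = (du i x + dv i x + M) / 2 \<Longrightarrow> y = 0 \<or> y = L i"
    using assms by (auto simp: path_dist_def own_def min_def abs_if split: if_splits)
qed

text \<open>A minimum of two numbers is at most their mean, with equality only if they agree, and
  the sum of \<open>du i x + y\<close> and \<open>dv i x + L j - y\<close> does not depend on
  \<open>y\<close>. The mean grows with \<open>L j\<close>, so only the longest paths attain the
  bound.\<close>

lemma other_dist:
  assumes i: "i < p" "0 \<le> x" "x \<le> L i" and "L j \<le> M" "j \<noteq> i"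
  shows "path_dist i x j y \<le> (du i x + dv i x + M) / 2"
    and "path_dist i x j y = (du i x + dv i x + M) / 2 \<longleftrightarrow> L j = M \<and> y = (dv i x - du i x + M) / 2"
  using assms by (auto simp: path_dist_def min_def field_simps)

lemma other_position:
  assumes i: "i < p" "0 \<le> x" "x \<le> L i" and "D \<le> M"
  shows "0 \<le> (dv i x - du i x + M) / 2" "(dv i x - du i x + M) / 2 \<le> M"
  using assms D_pos by (auto simp: du_def dv_def min_def)

text \<open>Path \<open>i\<close> offers at most one point that no other path has, its antipode at
  distance \<open>(L i + D) / 2\<close>; the other paths offer the distance \<open>W\<close>.
  Comparing these two numbers decides which kind is reported, and a tie yields both.\<close>

lemma farthest_parallel:
  assumes i: "i < p" "0 \<le> x" "x \<le> L i"
    and M: "\<And>j. j < p \<Longrightarrow> j \<noteq> i \<Longrightarrow> L j \<le> M" and m: "m < p" "m \<noteq> i" "L m = M"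
  defines "z \<equiv> (dv i x - du i x + M) / 2" and "W \<equiv> (du i x + dv i x + M) / 2"
  shows "farthest_points N (pt i x) =
    (if own i x \<and> W \<le> (L i + D) / 2 then {pt i (antipode i x)} else {}) \<union>
    (if own i x \<and> W < (L i + D) / 2 then {} else {pt j z | j. j < p \<and> j \<noteq> i \<and> L j = M})"
proof -
  have DM: "D \<le> M" using D_le m by auto
  have z: "0 \<le> z" "z \<le> M" using other_position[OF i DM] by (simp_all add: z_def)
  have other: "path_dist i x j y \<le> W" "path_dist i x j y = W \<longleftrightarrow> L j = M \<and> y = z"
    if "j < p" "j \<noteq> i" for j y
    using other_dist[OF i M[OF that] that(2)] by (simp_all add: W_def z_def)
  show ?thesis
  proof (cases "own i x")
    case True
    note o = own_dist[OF i True]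
    define U where "U = max W ((L i + D) / 2)"
    have le: "path_dist i x j y \<le> U" if "j < p" "0 \<le> y" "y \<le> L j" for j y
      using o(3)[of y] other(1)[of j y] that by (cases "j = i") (auto simp: U_def le_max_iff_disj)
    have at: "path_dist i x i (antipode i x) = (L i + D) / 2" using o by simp
    have "farthest_points N (pt i x) =
        {pt j y | j y. j < p \<and> 0 \<le> y \<and> y \<le> L j \<and> path_dist i x j y = U}"
    proof (cases "W \<le> (L i + D) / 2")
      case True
      show ?thesis
        by (rule farthest_points_eq[OF i, of _ i "antipode i x"])
          (use le o(1,2) at True i in \<open>auto simp: U_def max_def\<close>)
    next
      case False
      show ?thesis
        by (rule farthest_points_eq[OF i, of _ m z])
          (use le other(2)[OF m(1,2)] m z False in \<open>auto simp: U_def max_def\<close>)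
    qed
    also have "\<dots> = {pt i y | y. 0 \<le> y \<and> y \<le> L i \<and> path_dist i x i y = U} \<union>
        {pt j y | j y. j < p \<and> j \<noteq> i \<and> 0 \<le> y \<and> y \<le> L j \<and> path_dist i x j y = U}"
      using i(1) by blast
    also have "{pt i y | y. 0 \<le> y \<and> y \<le> L i \<and> path_dist i x i y = U} =
        (if own i x \<and> W \<le> (L i + D) / 2 then {pt i (antipode i x)} else {})"
    proof (cases "W \<le> (L i + D) / 2")
      case W: True
      then have "0 \<le> y \<and> y \<le> L i \<and> path_dist i x i y = U \<longleftrightarrow> y = antipode i x" for y
        using o by (auto simp: U_def max_def)
      with W True show ?thesis by simp
    next
      case False
      then have "\<not> (0 \<le> y \<and> y \<le> L i \<and> path_dist i x i y = U)" for y
        using o(3)[of y] by (auto simp: U_def max_def)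
      with False show ?thesis by simp
    qed
    also have "{pt j y | j y. j < p \<and> j \<noteq> i \<and> 0 \<le> y \<and> y \<le> L j \<and> path_dist i x j y = U} =
        (if own i x \<and> W < (L i + D) / 2 then {} else {pt j z | j. j < p \<and> j \<noteq> i \<and> L j = M})"
    proof (cases "W < (L i + D) / 2")
      case W: True
      then have "\<not> (j < p \<and> j \<noteq> i \<and> path_dist i x j y = U)" for j y
        using other(1)[of j y] by (auto simp: U_def max_def)
      with W True show ?thesis by auto
    next
      case False
      then have "j < p \<and> j \<noteq> i \<and> 0 \<le> y \<and> y \<le> L j \<and> path_dist i x j y = U \<longleftrightarrow>
          j < p \<and> j \<noteq> i \<and> L j = M \<and> y = z" for j y
        using other(2)[of j y] z by (auto simp: U_def max_def)
      with False show ?thesis by auto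
    qed
    finally show ?thesis .
  next
    case False
    note o = not_own_dist[OF i False DM, folded W_def]
    have "farthest_points N (pt i x) =
        {pt j y | j y. j < p \<and> 0 \<le> y \<and> y \<le> L j \<and> path_dist i x j y = W}"
    proof (rule farthest_points_eq[OF i, of _ m z])
      fix j y assume "j < p" "0 \<le> y" "y \<le> L j"
      then show "path_dist i x j y \<le> W" using o other by (cases "j = i") auto
    qed (use m z other in auto)
    also have "\<dots> = {pt j z | j. j < p \<and> j \<noteq> i \<and> L j = M}"
    proof (intro set_eqI iffI)
      fix q assume "q \<in> {pt j y | j y. j < p \<and> 0 \<le> y \<and> y \<le> L j \<and> path_dist i x j y = W}"
      then obtain j y where jy: "j < p" "0 \<le> y" "y \<le> L j" "path_dist i x j y = W" "q = pt j y" by blast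
      show "q \<in> {pt j z | j. j < p \<and> j \<noteq> i \<and> L j = M}"
      proof (cases "j = i")
        case True
        \<comment> \<open>A farthest point of path \<open>i\<close> is now a terminal, hence also a
          point of path \<open>m\<close>; there it must have position \<open>z\<close> by the
          uniqueness in \<open>other\<close>.\<close>
        with o(2) jy have "y = 0 \<or> y = L i" by simp
        moreover have "pt m 0 = pt i 0" "pt m (L m) = pt i (L i)"
          using i m pt_0 pt_L by blast+
        ultimately have "0 \<le> (if y = 0 then 0 else L m) \<and> (if y = 0 then 0 else L m) \<le> L m \<and>
            pt m (if y = 0 then 0 else L m) = q"
          using jy(5) L_pos[OF m(1)] True by auto
        then obtain y' where y': "0 \<le> y'" "y' \<le> L m" "pt m y' = q" by blast
        have "path_dist i x m y' = path_dist i x i y"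
          using network_dist_eq[OF i m(1) y'(1,2)] network_dist_eq[OF i jy(1-3)] y'(3) jy(5) True
          by simp
        with other[OF m(1,2)] jy True have "y' = z" by simp
        with y' m show ?thesis by auto
      qed (use jy other in auto)
    qed (use other z in blast)
    finally show ?thesis using False by simp
  qed
qed

end

section \<open>The construction algorithm\<close>

subsection \<open>Degrees and terminals\<close>

text \<open>The arrays \<open>key\<close>, \<open>ap\<close> and \<open>bp\<close> hold all levels
  of the cascade, at most \<open>2 * m\<close> entries in total. Level \<open>r\<close> refers to
  the offsets up to \<open>off ! (r + 2)\<close>, and there are at most \<open>m\<close> levels;
  hence the two extra cells of \<open>off\<close>, which stay zero behind the last level.\<close>

definition alloc_prog :: prog where
  "alloc_prog = block [
     NNew ''deg'' (NReg ''n''), NNew ''sum'' (NReg ''n''),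
     NNew ''ord'' (NReg ''m''), NNew ''idx'' (NReg ''m''), NNew ''vin'' (NReg ''m''),
     NNew ''pid'' (NReg ''m''), NNew ''st'' (NReg ''m''), NNew ''en'' (NReg ''m''),
     RNew ''pos'' (NReg ''m''), RNew ''len'' (NReg ''m''),
     NNew ''gp'' (NAdd (NReg ''m'') (NConst 1)), NNew ''off'' (NAdd (NReg ''m'') (NConst 2)),
     RNew ''key'' (NMul (NConst 2) (NReg ''m'')),
     NNew ''ap'' (NMul (NConst 2) (NReg ''m'')), NNew ''bp'' (NMul (NConst 2) (NReg ''m'')),
     NAssign ''e'' (NConst 0)]"

text \<open>
  Cell \<open>a\<close> of \<open>sum\<close> is the sum of the first two edges found at vertex \<open>a\<close>.  A walk that enters
  an inner vertex of a path by one of its two edges gets the other one by subtraction.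
\<close>

definition count_end :: "string \<Rightarrow> prog" where
  "count_end a = block [
     NAssign ''x'' (NGet a (NReg ''e'')),
     Cond (NLess (NGet ''deg'' (NReg ''x'')) (NConst 2))
       (NPut ''sum'' (NReg ''x'') (NAdd (NGet ''sum'' (NReg ''x'')) (NReg ''e''))) Skip,
     NPut ''deg'' (NReg ''x'') (NAdd (NGet ''deg'' (NReg ''x'')) (NConst 1))]"

definition degree_body :: prog where
  "degree_body = block [count_end ''src'', count_end ''tgt'',
     NAssign ''e'' (NAdd (NReg ''e'') (NConst 1))]"

definition degree_loop :: prog where
  "degree_loop = While (NLess (NReg ''e'') (NReg ''m'')) degree_body"

definition terminal_init :: prog where
  "terminal_init = block [
     NAssign ''u'' (NGet ''src'' (NConst 0)), NAssign ''v'' (NGet ''tgt'' (NConst 0)),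
     NAssign ''x'' (NConst 0)]"

text \<open>Every vertex of degree different from 2 is shifted into the pair of registers. After two
  of them the initial values, the ends of edge 0, have dropped out; if there are none, the initial
  values remain.\<close>

definition terminal_body :: prog where
  "terminal_body = block [
     Cond (NEq (NGet ''deg'' (NReg ''x'')) (NConst 2)) Skip
       (block [NAssign ''u'' (NReg ''v''), NAssign ''v'' (NReg ''x'')]),
     NAssign ''x'' (NAdd (NReg ''x'') (NConst 1))]"

definition terminal_loop :: prog where
  "terminal_loop = While (NLess (NReg ''x'') (NReg ''n'')) terminal_body"

definition traverse_init :: prog where
  "traverse_init = block [
     NAssign ''e'' (NConst 0), NAssign ''x'' (NReg ''v''), NAssign ''p'' (NConst 0),
     NAssign ''k'' (NConst 0)]"

text \<open>Appends edge \<open>f\<close>, entered at vertex \<open>y\<close>, to the current path.\<close>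

definition record_edge :: prog where
  "record_edge = block [
     NPut ''ord'' (NReg ''k'') (NReg ''f''),
     NPut ''idx'' (NReg ''f'') (NReg ''k''),
     NPut ''vin'' (NReg ''k'') (NReg ''y''),
     NPut ''pid'' (NReg ''f'') (NSub (NReg ''p'') (NConst 1)),
     RAssign ''c'' (RAdd (RReg ''c'') (RGet ''weight'' (NReg ''f''))),
     RPut ''pos'' (NReg ''k'') (RReg ''c''),
     NAssign ''k'' (NAdd (NReg ''k'') (NConst 1)),
     RPut ''len'' (NSub (NReg ''p'') (NConst 1)) (RReg ''c''),
     NPut ''en'' (NSub (NReg ''p'') (NConst 1)) (NReg ''k''),
     NAssign ''x'' (NSub (NAdd (NGet ''src'' (NReg ''f'')) (NGet ''tgt'' (NReg ''f''))) (NReg ''y''))]"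

text \<open>\<open>x = v\<close> means that no path is being walked, which also holds at the start.
  Every iteration moves \<open>e\<close> past a candidate for a first edge or records an edge and
  increases \<open>k\<close>, so there are at most \<open>2 * m\<close> iterations.\<close>

definition traverse_body :: prog where
  "traverse_body =
     Cond (NEq (NReg ''x'') (NReg ''v''))
       (Cond (BAnd (BNot (NEq (NGet ''src'' (NReg ''e'')) (NReg ''u'')))
                (BNot (NEq (NGet ''tgt'' (NReg ''e'')) (NReg ''u''))))
         (NAssign ''e'' (NAdd (NReg ''e'') (NConst 1)))
         (block [
            NPut ''st'' (NReg ''p'') (NReg ''k''),
            NAssign ''p'' (NAdd (NReg ''p'') (NConst 1)),
            RAssign ''c'' (RConst 0),
            NAssign ''y'' (NReg ''u''),
            NAssign ''f'' (NReg ''e''),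
            NAssign ''e'' (NAdd (NReg ''e'') (NConst 1)),
            record_edge]))
       (block [
          NAssign ''y'' (NReg ''x''),
          NAssign ''f'' (NSub (NGet ''sum'' (NReg ''x'')) (NReg ''f'')),
          record_edge])"

definition traverse_loop :: prog where
  "traverse_loop =
     While (BNot (BAnd (BNot (NLess (NReg ''e'') (NReg ''m''))) (NEq (NReg ''x'') (NReg ''v''))))
       traverse_body"

definition has_input :: "network \<Rightarrow> state \<Rightarrow> bool" where
  "has_input N s \<longleftrightarrow> nreg s ''n'' = vertex_count N \<and> nreg s ''m'' = edge_count N \<and>
     narr s ''src'' = map (src N) [0..<edge_count N] \<and>
     narr s ''tgt'' = map (tgt N) [0..<edge_count N] \<and>
     rarr s ''weight'' = map (weight N) [0..<edge_count N]"

lemma has_inputD: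
  assumes "has_input N s"
  shows "nreg s ''n'' = vertex_count N" "nreg s ''m'' = edge_count N"
    "length (narr s ''src'') = edge_count N" "length (narr s ''tgt'') = edge_count N"
    "length (rarr s ''weight'') = edge_count N"
    "i < edge_count N \<Longrightarrow> narr s ''src'' ! i = src N i"
    "i < edge_count N \<Longrightarrow> narr s ''tgt'' ! i = tgt N i"
    "i < edge_count N \<Longrightarrow> rarr s ''weight'' ! i = weight N i"
  using assms by (auto simp: has_input_def)

lemma has_input_frame:
  "has_input N s \<Longrightarrow> frame c s s' \<Longrightarrow> ''n'' \<notin> nreg_writes c \<Longrightarrow> ''m'' \<notin> nreg_writes c \<Longrightarrow>
    ''src'' \<notin> narr_writes c \<Longrightarrow> ''tgt'' \<notin> narr_writes c \<Longrightarrow> ''weight'' \<notin> rarr_writes c \<Longrightarrow>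
    has_input N s'"
  by (simp add: has_input_def frame_def)

text \<open>Sums are specified for at most two edges only. At a terminal the sum of all edge indices
  may be quadratic in \<open>n\<close> and would not fit into a word.\<close>

definition counted :: "nat \<Rightarrow> (nat \<Rightarrow> nat set) \<Rightarrow> state \<Rightarrow> bool" where
  "counted n A s \<longleftrightarrow> length (narr s ''deg'') = n \<and> length (narr s ''sum'') = n \<and>
     (\<forall>a < n. narr s ''deg'' ! a = card (A a) \<and> (card (A a) \<le> 2 \<longrightarrow> narr s ''sum'' ! a = \<Sum>(A a)))"

lemma count_end_exec:
  assumes cnt: "counted n A s" and e: "nreg s ''e'' = e" "e < m" "e \<le> W" "m + m \<le> W" "Suc m \<le> W" "2 \<le> W"
    and a: "narr s a ! e = x" "e < length (narr s a)" "x < n" "x \<le> W" "a \<noteq> ''deg''" "a \<noteq> ''sum''"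
    and A: "A x \<subseteq> {..<m}" "e \<notin> A x"
  shows "safe W (count_end a) s" "counted n (A(x := insert e (A x))) (exec (count_end a) s)"
    "nreg (exec (count_end a) s) ''e'' = e"
proof -
  have fin: "finite (A x)" using A(1) finite_subset by blast
  have card: "card (A x) \<le> m" using card_mono[OF _ A(1)] by simp
  have d: "narr s ''deg'' ! x = card (A x)" "length (narr s ''deg'') = n" "length (narr s ''sum'') = n"
    "card (A x) \<le> 2 \<Longrightarrow> narr s ''sum'' ! x = \<Sum>(A x)"
    using cnt a(3) by (auto simp: counted_def)
  have sum: "narr s ''sum'' ! x \<le> m" if "card (A x) < 2"
  proof -
    from that consider "card (A x) = 0" | "card (A x) = 1" by linarith
    then have "\<Sum>(A x) \<le> m"
    proof cases
      case 1
      with fin show ?thesis by simp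
    next
      case 2
      then obtain b where "A x = {b}" by (auto simp: card_1_singleton_iff)
      with A(1) show ?thesis by simp
    qed
    with d(4) that show ?thesis by simp
  qed
  show "safe W (count_end a) s"
    using e a d card sum by (auto simp: count_end_def)
  show "nreg (exec (count_end a) s) ''e'' = e"
    using e by (simp add: count_end_def)
  show "counted n (A(x := insert e (A x))) (exec (count_end a) s)"
    using cnt e a d fin A(2)
    by (auto simp: count_end_def counted_def nth_list_update)
qed

context layout begin

abbreviation n :: nat where "n \<equiv> vertex_count N"
abbreviation m :: nat where "m \<equiv> edge_count N"

lemma m_pos: "0 < m"
  using p_pos p_le_m by simp

definition incident_upto :: "nat \<Rightarrow> nat \<Rightarrow> nat set" where
  "incident_upto e a = {i. i < e \<and> (src N i = a \<or> tgt N i = a)}"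

lemma src_tgt_lt: "i < m \<Longrightarrow> src N i < n" "i < m \<Longrightarrow> tgt N i < n" "i < m \<Longrightarrow> src N i \<noteq> tgt N i"
  using network by (auto simp: is_network_def vertices_def)

lemma degree_loop_runs:
  assumes W: "10 * n \<le> W" and inp: "has_input N s" and "nreg s ''e'' = 0"
    and init: "narr s ''deg'' = replicate n 0" "narr s ''sum'' = replicate n 0"
  shows "runs W degree_loop s (loop_time (NLess (NReg ''e'') (NReg ''m'')) degree_body m)
    (counted n (incident N))"
  unfolding degree_loop_def
proof (rule runs_While[where k = m and I = "\<lambda>k s. nreg s ''e'' \<le> m \<and> k = m - nreg s ''e'' \<and>
      counted n (incident_upto (nreg s ''e'')) s", OF _ _ _ _ order_refl])
  show "\<not> allocates degree_body" by (simp add: degree_body_def count_end_def)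
  show "nreg s ''e'' \<le> m \<and> m = m - nreg s ''e'' \<and> counted n (incident_upto (nreg s ''e'')) s"
    using assms by (simp add: counted_def incident_upto_def)
next
  fix k s'
  assume fr: "frame degree_body s s'"
    and I: "nreg s' ''e'' \<le> m \<and> k = m - nreg s' ''e'' \<and> counted n (incident_upto (nreg s' ''e'')) s'"
  have inp': "has_input N s'"
    by (rule has_input_frame[OF inp fr]) (simp_all add: degree_body_def count_end_def)
  note inp'' = has_inputD[OF inp']
  show "bok W s' (NLess (NReg ''e'') (NReg ''m''))"
    using I W m_le_2n inp'' by simp
  show "counted n (incident N) s'" if "\<not> bval s' (NLess (NReg ''e'') (NReg ''m''))"
  proof -
    have "incident_upto (nreg s' ''e'') = incident N"
      using that I inp'' by (auto simp: incident_upto_def incident_def fun_eq_iff)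
    then show ?thesis using I by simp
  qed
  assume "bval s' (NLess (NReg ''e'') (NReg ''m''))"
  then have e: "nreg s' ''e'' < m" using inp'' by simp
  define e where "e = nreg s' ''e''"
  have em: "e < m" and e': "nreg s' ''e'' = e" using e by (simp_all add: e_def)
  note b = m_le_2n n_ge_2 W src_tgt_lt[OF em]
  let ?A = "incident_upto e"
  have sub: "?A a \<subseteq> {..<m}" for a using em by (auto simp: incident_upto_def)
  have "counted n ?A s'" using I e' by simp
  note 1 = count_end_exec[OF this e' em, of W "''src''" "src N e"]
  have 1: "safe W (count_end ''src'') s'"
    "counted n (?A(src N e := insert e (?A (src N e)))) (exec (count_end ''src'') s')"
    "nreg (exec (count_end ''src'') s') ''e'' = e"
    using b em inp'' sub by (intro 1; force simp: incident_upto_def)+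
  let ?s = "exec (count_end ''src'') s'"
  let ?B = "?A(src N e := insert e (?A (src N e)))"
  have subB: "?B a \<subseteq> {..<m}" for a using em sub by auto
  have tgt: "narr ?s ''tgt'' = narr s' ''tgt''" by (simp add: count_end_def)
  \<comment> \<open>The two ends of an edge differ, so the set of edges counted at the target does
    not contain \<open>e\<close> yet.\<close>
  note 2 = count_end_exec[OF 1(2,3) em, of W "''tgt''" "tgt N e"]
  have 2: "safe W (count_end ''tgt'') ?s"
    "counted n (?B(tgt N e := insert e (?B (tgt N e)))) (exec (count_end ''tgt'') ?s)"
    "nreg (exec (count_end ''tgt'') ?s) ''e'' = e"
    using b em inp'' subB tgt by (intro 2; force simp: incident_upto_def)+
  have "?B(tgt N e := insert e (?B (tgt N e))) = incident_upto (Suc e)"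
    using b by (auto simp: incident_upto_def fun_eq_iff less_Suc_eq)
  with 2 have cnt: "counted n (incident_upto (Suc e)) (exec (count_end ''tgt'') ?s)" by simp
  have "counted n (incident_upto (Suc e)) (exec degree_body s')"
    "nreg (exec degree_body s') ''e'' = Suc e"
    using cnt 2(3) by (simp_all add: degree_body_def counted_def)
  moreover have "safe W degree_body s'"
    using 1(1) 2(1,3) em b by (simp add: degree_body_def)
  ultimately show "safe W degree_body s' \<and> (\<exists>k'<k. nreg (exec degree_body s') ''e'' \<le> m \<and>
      k' = m - nreg (exec degree_body s') ''e'' \<and>
      counted n (incident_upto (nreg (exec degree_body s') ''e'')) (exec degree_body s'))"
    using em I e' by auto
qed

lemma terminal_loop_runs:
  assumes W: "10 * n \<le> W" and inp: "has_input N s" and x: "nreg s ''x'' = 0"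
    and reg: "nreg s ''u'' = src N 0" "nreg s ''v'' = tgt N 0"
    and deg: "length (narr s ''deg'') = n" "\<And>a. a < n \<Longrightarrow> narr s ''deg'' ! a = card (incident N a)"
    and uv: "if {a \<in> vertices N. card (incident N a) \<noteq> 2} = {} then u = src N 0 \<and> v = tgt N 0
     else {a \<in> vertices N. card (incident N a) \<noteq> 2} = {u, v} \<and> u < v"
  shows "runs W terminal_loop s (loop_time (NLess (NReg ''x'') (NReg ''n'')) terminal_body n)
    (\<lambda>s'. nreg s' ''u'' = u \<and> nreg s' ''v'' = v)"
proof -
  define T where "T = {a \<in> vertices N. card (incident N a) \<noteq> 2}"
  have T: "a \<in> T \<longleftrightarrow> card (incident N a) \<noteq> 2" if "a < n" for a
    using that by (simp add: T_def vertices_def)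
  have uvT: "T = {} \<and> u = src N 0 \<and> v = tgt N 0 \<or> T = {u, v} \<and> u < v"
    using uv unfolding T_def[symmetric] by (simp split: if_splits)
  \<comment> \<open>The pair is correct only once \<open>v\<close> has been passed. Between the two
    terminals, register \<open>v\<close> holds the first of them, from where the next shift moves it
    to register \<open>u\<close>.\<close>
  define I where "I k s \<longleftrightarrow> nreg s ''x'' \<le> n \<and> k = n - nreg s ''x'' \<and>
      nreg s ''u'' < n \<and> nreg s ''v'' < n \<and>
      (T = {} \<longrightarrow> nreg s ''u'' = u \<and> nreg s ''v'' = v) \<and>
      (T \<noteq> {} \<and> u < nreg s ''x'' \<and> nreg s ''x'' \<le> v \<longrightarrow> nreg s ''v'' = u) \<and>
      (T \<noteq> {} \<and> v < nreg s ''x'' \<longrightarrow> nreg s ''u'' = u \<and> nreg s ''v'' = v)" for k and s :: state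
  have uvn: "u < n" "v < n"
    using V_vertex[of 0 0] V_vertex[of 0 "len 0"] V_first[of 0] V_last[of 0] p_pos by auto
  show ?thesis
    unfolding terminal_loop_def
  proof (rule runs_While[where k = n and I = I, OF _ _ _ _ order_refl])
    show "\<not> allocates terminal_body" by (simp add: terminal_body_def)
    show "I n s" using x reg src_tgt_lt[of 0] m_pos uvT by (auto simp: I_def)
  next
    fix k s'
    assume fr: "frame terminal_body s s'" and I: "I k s'"
    have inp': "has_input N s'"
      by (rule has_input_frame[OF inp fr]) (simp_all add: terminal_body_def)
    have arr: "narr s' ''deg'' = narr s ''deg''"
      using frame_narr[OF fr] by (simp add: terminal_body_def)
    show "bok W s' (NLess (NReg ''x'') (NReg ''n''))"
      using I W has_inputD(1)[OF inp'] by (simp add: I_def)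
    show "nreg s' ''u'' = u \<and> nreg s' ''v'' = v" if "\<not> bval s' (NLess (NReg ''x'') (NReg ''n''))"
    proof -
      have "nreg s' ''x'' = n" using that I has_inputD(1)[OF inp'] by (simp add: I_def)
      then show ?thesis using I uvn by (cases "T = {}") (simp_all add: I_def)
    qed
    assume "bval s' (NLess (NReg ''x'') (NReg ''n''))"
    then have xn: "nreg s' ''x'' < n" using has_inputD(1)[OF inp'] by simp
    define x where "x = nreg s' ''x''"
    have x: "nreg s' ''x'' = x" "x < n" using xn by (simp_all add: x_def)
    have d: "narr s ''deg'' ! x = card (incident N x)" using deg x by simp
    have dm: "card (incident N x) \<le> m"
      using card_mono[of "{..<m}" "incident N x"] by (auto simp: incident_def)
    then have dW: "card (incident N x) \<le> W" using W m_le_2n by simp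
    have uv': "nreg s' ''u'' < n" "nreg s' ''v'' < n" using I by (simp_all add: I_def)
    have "safe W terminal_body s'"
      using x arr deg(1) d dW W n_ge_2 uv' by (simp add: terminal_body_def)
    moreover have "I (k - 1) (exec terminal_body s')"
    proof (cases "x \<in> T")
      case True
      have uvx: "T \<noteq> {}" "u < v" "x = u \<or> x = v" using uvT True by auto
      have "narr s' ''deg'' ! x \<noteq> 2" using T True d arr x(2) by simp
      then have "exec terminal_body s' =
          s'\<lparr>nreg := (nreg s')(''u'' := nreg s' ''v'', ''v'' := x, ''x'' := Suc x)\<rparr>"
        using x by (simp add: terminal_body_def)
      then show ?thesis using I uvx x by (auto simp: I_def)
    next
      case False
      have "narr s' ''deg'' ! x = 2" using T False d arr x(2) by simp
      then have ex: "exec terminal_body s' = s'\<lparr>nreg := (nreg s')(''x'' := Suc x)\<rparr>"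
        using x by (simp add: terminal_body_def)
      show ?thesis
      proof (cases "T = {}")
        case True
        then show ?thesis using I x unfolding ex I_def by simp
      next
        case T: False
        then have "x \<noteq> u" "x \<noteq> v" using uvT False by auto
        then show ?thesis using I x T unfolding ex I_def by (auto simp: less_Suc_eq)
      qed
    qed
    moreover have "k - 1 < k" using xn I by (simp add: I_def)
    ultimately show "safe W terminal_body s' \<and> (\<exists>k'<k. I k' (exec terminal_body s'))" by blast
  qed
qed

end

context layout begin

subsection \<open>Traversal\<close>

definition sizes :: "state \<Rightarrow> bool" where
  "sizes s \<longleftrightarrow> length (narr s ''ord'') = m \<and> length (narr s ''idx'') = m \<and>
     length (narr s ''vin'') = m \<and> length (narr s ''pid'') = m \<and>
     length (narr s ''st'') = m \<and> length (narr s ''en'') = m \<and>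
     length (rarr s ''pos'') = m \<and> length (rarr s ''len'') = m"

text \<open>\<open>pos\<close> holds the coordinate of the far end of each edge. The first entry of
  a path that is at least \<open>z\<close> then belongs to an edge containing \<open>z\<close>, and
  coordinate 0 gets no entry of its own.\<close>

definition recorded :: "nat \<Rightarrow> state \<Rightarrow> bool" where
  "recorded K s \<longleftrightarrow> (\<forall>j t. j < p \<longrightarrow> t < len j \<longrightarrow> st j + t < K \<longrightarrow>
     narr s ''ord'' ! (st j + t) = E j t \<and> narr s ''idx'' ! E j t = st j + t \<and>
     narr s ''vin'' ! (st j + t) = V j t \<and> narr s ''pid'' ! E j t = j \<and>
     rarr s ''pos'' ! (st j + t) = pos j (Suc t))"

definition paths_done :: "nat \<Rightarrow> state \<Rightarrow> bool" where
  "paths_done q s \<longleftrightarrow> (\<forall>j < q. narr s ''st'' ! j = st j \<and> narr s ''en'' ! j = st j + len j \<and>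
     rarr s ''len'' ! j = L j)"

lemma flat_less: "j < p \<Longrightarrow> t < len j \<Longrightarrow> st j + t < m"
  using st_bound[of j "Suc t"] st_p by simp

lemma record_edge_exec:
  assumes W: "10 * n \<le> W" and inp: "has_input N s" and siz: "sizes s" and rec: "recorded (st j + t) s"
    and j: "j < p" "t < len j"
    and reg: "nreg s ''k'' = st j + t" "nreg s ''f'' = E j t" "nreg s ''y'' = V j t"
      "nreg s ''p'' = Suc j" "rreg s ''c'' = pos j t"
  defines "s' \<equiv> exec record_edge s"
  shows "safe W record_edge s" "sizes s'" "recorded (st j + Suc t) s'"
    "nreg s' ''k'' = st j + Suc t" "nreg s' ''x'' = V j (Suc t)" "rreg s' ''c'' = pos j (Suc t)"
    "nreg s' ''f'' = E j t" "nreg s' ''p'' = Suc j" "nreg s' ''e'' = nreg s ''e''"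
    "narr s' ''st'' = narr s ''st''" "narr s' ''en'' ! j = st j + Suc t"
    "rarr s' ''len'' ! j = pos j (Suc t)"
    "\<And>i. i \<noteq> j \<Longrightarrow> narr s' ''en'' ! i = narr s ''en'' ! i \<and> rarr s' ''len'' ! i = rarr s ''len'' ! i"
proof -
  note inp = has_inputD[OF inp]
  note siz' = siz[unfolded sizes_def]
  have b: "st j + t < m" "E j t < m" "V j t < n" "j < m"
    using flat_less[OF j] E_bound[OF j] V_vertex[of j t] j p_le_m by auto
  note b' = b m_le_2n W n_ge_2
  have st: "src N (E j t) < n" "tgt N (E j t) < n" using src_tgt_lt b by auto
  \<comment> \<open>The end at which the edge is left is the sum of both ends minus the end at which
    it was entered; this spares a test of the direction in which the edge is listed.\<close>
  have other: "src N (E j t) + tgt N (E j t) - V j t = V j (Suc t)"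
    using E_orient[OF j] by auto
  have bW: "st j + t \<le> W" "Suc (st j + t) \<le> W" "E j t \<le> W" "V j t \<le> W" "j \<le> W" "Suc j \<le> W" "Suc 0 \<le> W"
    "src N (E j t) \<le> W" "tgt N (E j t) \<le> W" "src N (E j t) + tgt N (E j t) \<le> W"
    using b' st by linarith+
  show "safe W record_edge s"
    by (simp add: record_edge_def reg siz' inp b bW)
  show "sizes s'" using siz by (simp add: s'_def record_edge_def sizes_def)
  show "nreg s' ''k'' = st j + Suc t" "nreg s' ''x'' = V j (Suc t)" "rreg s' ''c'' = pos j (Suc t)"
    "nreg s' ''f'' = E j t" "nreg s' ''p'' = Suc j" "nreg s' ''e'' = nreg s ''e''"
    "narr s' ''st'' = narr s ''st''" "narr s' ''en'' ! j = st j + Suc t"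
    "rarr s' ''len'' ! j = pos j (Suc t)"
    by (simp_all add: s'_def record_edge_def pos_Suc reg siz' b other inp)
  show "narr s' ''en'' ! i = narr s ''en'' ! i \<and> rarr s' ''len'' ! i = rarr s ''len'' ! i"
    if "i \<noteq> j" for i
    using that reg by (simp add: s'_def record_edge_def)
  show "recorded (st j + Suc t) s'"
    unfolding recorded_def
  proof (intro allI impI)
    fix j' t' assume j': "j' < p" "t' < len j'" "st j' + t' < st j + Suc t"
    show "narr s' ''ord'' ! (st j' + t') = E j' t' \<and> narr s' ''idx'' ! E j' t' = st j' + t' \<and>
     narr s' ''vin'' ! (st j' + t') = V j' t' \<and> narr s' ''pid'' ! E j' t' = j' \<and>
     rarr s' ''pos'' ! (st j' + t') = pos j' (Suc t')"
    proof (cases "st j' + t' = st j + t")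
      case True
      then have "j' = j" "t' = t" using st_inj j j' by blast+
      then show ?thesis
        using reg siz' b inp by (simp add: s'_def record_edge_def pos_Suc)
    next
      case False
      then have "E j' t' \<noteq> E j t" "st j' + t' < st j + t" using E_inj j j' by auto
      with False j' rec show ?thesis
        using reg by (simp add: s'_def record_edge_def recorded_def)
    qed
  qed
qed

text \<open>The value \<open>t = len j\<close> is included: path \<open>j\<close> is then complete,
  \<open>x\<close> is \<open>v\<close>, and the next path may begin. Length and end of the current
  path are kept up to date at every edge, so completing a path takes no action.\<close>

definition walking :: "state \<Rightarrow> nat \<Rightarrow> nat \<Rightarrow> bool" where
  "walking s j t \<longleftrightarrow> j < p \<and> 0 < t \<and> t \<le> len j \<and> nreg s ''p'' = Suc j \<and>
     nreg s ''k'' = st j + t \<and> nreg s ''x'' = V j t \<and> nreg s ''f'' = E j (t - 1) \<and>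
     rreg s ''c'' = pos j t \<and> paths_done j s \<and> narr s ''st'' ! j = st j \<and>
     narr s ''en'' ! j = st j + t \<and> rarr s ''len'' ! j = pos j t"

text \<open>The fuel counts edges not yet scanned at \<open>u\<close> plus edges not yet recorded.
  The equivalence for \<open>E j 0\<close> expresses that exactly the paths whose first edges have
  been scanned have been opened.\<close>

definition traverse_inv :: "nat \<Rightarrow> state \<Rightarrow> bool" where
  "traverse_inv k s \<longleftrightarrow> sizes s \<and> recorded (nreg s ''k'') s \<and> nreg s ''e'' \<le> m \<and>
     nreg s ''k'' \<le> m \<and> k = (m - nreg s ''e'') + (m - nreg s ''k'') \<and>
     (\<forall>j < p. E j 0 < nreg s ''e'' \<longleftrightarrow> j < nreg s ''p'') \<and>
     (nreg s ''p'' = 0 \<and> nreg s ''k'' = 0 \<and> nreg s ''x'' = v \<or> (\<exists>j t. walking s j t))"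

lemma walking_record_edge:
  assumes "10 * n \<le> W" "has_input N s" "sizes s" "recorded (st j + t) s" "j < p" "t < len j"
    "nreg s ''k'' = st j + t" "nreg s ''f'' = E j t" "nreg s ''y'' = V j t"
    "nreg s ''p'' = Suc j" "rreg s ''c'' = pos j t" "paths_done j s" "narr s ''st'' ! j = st j"
    and e: "\<forall>j' < p. E j' 0 < nreg s ''e'' \<longleftrightarrow> j' < nreg s ''p''" "nreg s ''e'' \<le> m"
  shows "safe W record_edge s"
    "traverse_inv ((m - nreg s ''e'') + (m - (st j + Suc t))) (exec record_edge s)"
proof -
  note r = record_edge_exec[OF assms(1-11)]
  show "safe W record_edge s" by (rule r(1))
  have "paths_done j (exec record_edge s)"
    using assms(12) r(10,13) by (simp add: paths_done_def)
  then have "walking (exec record_edge s) j (Suc t)"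
    using assms(5,6,13) r by (simp add: walking_def)
  then show "traverse_inv ((m - nreg s ''e'') + (m - (st j + Suc t))) (exec record_edge s)"
    unfolding traverse_inv_def using r e assms(10) flat_less[OF assms(5,6)] by auto
qed

lemma traverse_loop_runs:
  assumes W: "10 * n \<le> W" and inp: "has_input N s"
    and cnt: "counted n (incident N) s" and uv: "nreg s ''u'' = u" "nreg s ''v'' = v"
    and init: "nreg s ''e'' = 0" "nreg s ''x'' = v" "nreg s ''p'' = 0" "nreg s ''k'' = 0"
    and siz: "sizes s"
  shows "runs W traverse_loop s (loop_time (BNot (BAnd (BNot (NLess (NReg ''e'') (NReg ''m'')))
      (NEq (NReg ''x'') (NReg ''v'')))) traverse_body (m + m))
    (\<lambda>s'. sizes s' \<and> recorded m s' \<and> paths_done p s' \<and> nreg s' ''p'' = p)"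
  unfolding traverse_loop_def
proof (rule runs_While[where k = "m + m" and I = traverse_inv, OF _ _ _ _ order_refl])
  show "\<not> allocates traverse_body" by (simp add: traverse_body_def record_edge_def)
  show "traverse_inv (m + m) s"
    using init siz by (simp add: traverse_inv_def recorded_def)
next
  let ?b = "BNot (BAnd (BNot (NLess (NReg ''e'') (NReg ''m''))) (NEq (NReg ''x'') (NReg ''v'')))"
  fix k s'
  assume fr: "frame traverse_body s s'" and I: "traverse_inv k s'"
  have inp': "has_input N s'"
    by (rule has_input_frame[OF inp fr]) (simp_all add: traverse_body_def record_edge_def)
  note inp'' = has_inputD[OF inp']
  have same: "nreg s' ''u'' = u" "nreg s' ''v'' = v" "narr s' ''sum'' = narr s ''sum''"
    using frame_nreg[OF fr] frame_narr[OF fr] uv by (simp_all add: traverse_body_def record_edge_def)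
  have uvn: "u < n" "v < n"
    using V_vertex[of 0 0] V_vertex[of 0 "len 0"] V_first[of 0] V_last[of 0] p_pos by auto
  note b = m_le_2n n_ge_2 W uvn p_le_m
  have xn: "nreg s' ''x'' < n"
    using I V_vertex uvn by (auto simp: traverse_inv_def walking_def)
  have em: "nreg s' ''e'' \<le> m" "nreg s' ''k'' \<le> m" using I by (auto simp: traverse_inv_def)
  show "bok W s' ?b" using inp'' same em xn b by simp
  \<comment> \<open>A walk that stands at \<open>v\<close> has reached the end of its path, so all
    opened paths are complete and \<open>k\<close> is the start of the next one.\<close>
  have idle: "nreg s' ''k'' = st (nreg s' ''p'') \<and> paths_done (nreg s' ''p'') s' \<and> nreg s' ''p'' \<le> p"
    if x: "nreg s' ''x'' = v"
  proof -
    from I consider "nreg s' ''p'' = 0" "nreg s' ''k'' = 0" | j t where "walking s' j t"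
      by (auto simp: traverse_inv_def)
    then show ?thesis
    proof cases
      case 1
      then show ?thesis by (simp add: paths_done_def)
    next
      case 2
      then have "t = len j" using x V_eq_v[of j t] by (auto simp: walking_def)
      then show ?thesis
        using 2 by (auto simp: walking_def paths_done_def st_Suc L_def less_Suc_eq)
    qed
  qed
  {
    assume "\<not> bval s' ?b"
    then have x: "nreg s' ''x'' = v" and e: "nreg s' ''e'' = m"
      using inp'' same em by auto
    have "nreg s' ''p'' = p"
    proof (rule ccontr)
      assume "nreg s' ''p'' \<noteq> p"
      with idle[OF x] have "nreg s' ''p'' < p" by simp
      moreover have "E (nreg s' ''p'') 0 < m" using E_bound len_pos calculation by simp
      ultimately show False using I e by (auto simp: traverse_inv_def)
    qed
    with idle[OF x] st_p I
    show "sizes s' \<and> recorded m s' \<and> paths_done p s' \<and> nreg s' ''p'' = p"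
      by (simp add: traverse_inv_def)
  next
    assume bv: "bval s' ?b"
    have I': "sizes s'" "recorded (nreg s' ''k'') s'"
      "\<forall>j < p. E j 0 < nreg s' ''e'' \<longleftrightarrow> j < nreg s' ''p''"
      "k = (m - nreg s' ''e'') + (m - nreg s' ''k'')"
      using I by (auto simp: traverse_inv_def)
    show "safe W traverse_body s' \<and> (\<exists>k'<k. traverse_inv k' (exec traverse_body s'))"
    proof (cases "nreg s' ''x'' = v")
      case x: True
      with bv inp'' same have e: "nreg s' ''e'' < m" by simp
      define e where "e = nreg s' ''e''"
      define q where "q = nreg s' ''p''"
      note st = src_tgt_lt[OF e]
      note idle = idle[OF x]
      show ?thesis
      proof (cases "e \<in> incident N u")
        case False
        then have inc: "src N e \<noteq> u" "tgt N e \<noteq> u" using e by (auto simp: incident_def e_def)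
        have first: "E j 0 \<noteq> e" if "j < p" for j
          using False that by (auto simp: incident_first)
        have "safe W traverse_body s'"
          using x e inc same inp'' b st by (simp add: traverse_body_def e_def)
        moreover have "exec traverse_body s' = s'\<lparr>nreg := (nreg s')(''e'' := Suc e)\<rparr>"
          using x e inc same inp'' by (simp add: traverse_body_def e_def)
        moreover have "traverse_inv (k - 1) (s'\<lparr>nreg := (nreg s')(''e'' := Suc e)\<rparr>)"
          using I e first
          by (auto simp: traverse_inv_def sizes_def recorded_def walking_def paths_done_def e_def
              less_Suc_eq)
        ultimately show ?thesis using I'(4) e by (intro conjI exI[of _ "k - 1"]) auto
      next
        case True
        then obtain j where j: "j < p" "e = E j 0" by (auto simp: incident_first)
        \<comment> \<open>The scan meets first edges in increasing order and
          \<open>E_first_mono\<close> numbers the paths in the same order, so the path found is the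
          next one.\<close>
        have "\<not> j < q" using I'(3) j by (auto simp: e_def q_def)
        moreover have "\<not> q < j"
        proof
          assume "q < j"
          then have "E q 0 < e" using E_first_mono j by simp
          then show False using I'(3) \<open>q < j\<close> j by (auto simp: e_def q_def)
        qed
        ultimately have q: "q = j" "q < p" using j by auto
        have inc: "src N e = u \<or> tgt N e = u" using True by (simp add: incident_def)
        define s1 where "s1 = s'\<lparr>narr := (narr s')(''st'' := (narr s' ''st'')[q := nreg s' ''k'']),
          rreg := (rreg s')(''c'' := 0),
          nreg := (nreg s')(''p'' := Suc q, ''y'' := u, ''f'' := e, ''e'' := Suc e)\<rparr>"
        have ex: "exec traverse_body s' = exec record_edge s1"
          using x e inc same inp'' by (auto simp: traverse_body_def e_def q_def s1_def)
        have sf: "safe W traverse_body s' \<longleftrightarrow> safe W record_edge s1"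
        proof -
          have "length (narr s' ''st'') = m" using I'(1) by (simp add: sizes_def)
          then show ?thesis
            using x e inc same inp'' b st q em
            by (auto simp: traverse_body_def e_def q_def s1_def)
        qed
        have siz1: "sizes s1" using I'(1) by (simp add: s1_def sizes_def)
        have len0: "0 < len q" using len_pos q by simp
        have rec1: "recorded (st q + 0) s1" using I'(2) idle by (simp add: s1_def recorded_def q_def)
        have done1: "paths_done q s1" using idle by (simp add: s1_def paths_done_def q_def)
        have st1: "narr s1 ''st'' ! q = st q"
          using idle q I'(1) p_le_m by (simp add: s1_def sizes_def q_def)
        have first1: "\<forall>j' < p. E j' 0 < nreg s1 ''e'' \<longleftrightarrow> j' < nreg s1 ''p''"
        proof (intro allI impI)
          fix j' assume "j' < p"
          then have "E j' 0 = e \<longleftrightarrow> j' = q" using E_inj[of j' q 0 0] j q len_pos by auto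
          then show "E j' 0 < nreg s1 ''e'' \<longleftrightarrow> j' < nreg s1 ''p''"
            using I'(3) \<open>j' < p\<close> by (auto simp: s1_def less_Suc_eq e_def q_def)
        qed
        have inp1: "has_input N s1" using inp' by (simp add: s1_def has_input_def)
        have "traverse_inv ((m - nreg s1 ''e'') + (m - (st q + Suc 0))) (exec record_edge s1)"
          "safe W record_edge s1"
          by (rule walking_record_edge[OF W inp1 siz1 rec1 q(2) len0];
              use first1 done1 st1 idle j q V_first e in \<open>simp add: s1_def e_def q_def\<close>)+
        moreover have "(m - nreg s1 ''e'') + (m - (st q + Suc 0)) < k"
          using e I'(4) idle by (simp add: s1_def e_def q_def)
        ultimately show ?thesis using ex sf by auto
      qed
    next
      case False
      with I obtain j t where w: "walking s' j t" by (auto simp: traverse_inv_def)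
      then have jt: "j < p" "0 < t" "t < len j"
        using False V_last[of j] by (auto simp: walking_def le_less)
      then obtain t' where t': "t = Suc t'" by (cases t) auto
      have inc: "incident N (V j t) = {E j t', E j t}"
        using incident_inner[of j t'] jt t' by simp
      have ne: "E j t' \<noteq> E j t" using E_inj[of j j t' t] jt t' by auto
      have "V j t < n" using V_vertex jt by simp
      then have sum: "narr s' ''sum'' ! V j t = E j t' + E j t" "length (narr s' ''sum'') = n"
        using cnt same inc ne by (auto simp: counted_def)
      define s1 where "s1 = s'\<lparr>nreg := (nreg s')(''y'' := V j t, ''f'' := E j t)\<rparr>"
      have x: "nreg s' ''x'' = V j t" "nreg s' ''f'' = E j t'" using w t' by (auto simp: walking_def)
      have ex: "exec traverse_body s' = exec record_edge s1"
        using False same x sum by (simp add: traverse_body_def s1_def)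
      have "E j t < m" "E j t' < m" using E_bound jt t' by auto
      then have sf: "safe W traverse_body s' \<longleftrightarrow> safe W record_edge s1"
        using False same x sum b \<open>V j t < n\<close> by (simp add: traverse_body_def s1_def)
      have siz1: "sizes s1" using I'(1) by (simp add: s1_def sizes_def)
      have rec1: "recorded (st j + t) s1" using I'(2) w by (simp add: s1_def recorded_def walking_def)
      have done1: "paths_done j s1" using w by (simp add: s1_def paths_done_def walking_def)
      have inp1: "has_input N s1" using inp' by (simp add: s1_def has_input_def)
      have "traverse_inv ((m - nreg s1 ''e'') + (m - (st j + Suc t))) (exec record_edge s1)"
        "safe W record_edge s1"
        by (rule walking_record_edge[OF W inp1 siz1 rec1 jt(1,3)];
            use done1 w I'(3) em in \<open>simp add: s1_def walking_def\<close>)+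
      moreover have "(m - nreg s1 ''e'') + (m - (st j + Suc t)) < k"
        using I'(4) w flat_less[OF jt(1,3)] by (simp add: s1_def walking_def)
      ultimately show ?thesis using ex sf by auto
    qed
  }
qed

end

subsection \<open>Fractional cascading\<close>

definition asc :: "real list \<Rightarrow> nat \<Rightarrow> nat \<Rightarrow> bool" where
  "asc key lo hi \<longleftrightarrow> (\<forall>t t'. lo \<le> t \<longrightarrow> t \<le> t' \<longrightarrow> t' < hi \<longrightarrow> key ! t \<le> key ! t')"

text \<open>
  A level occupies the cells from \<open>lo\<close> on; it is the merge of the breakpoints
  \<open>P ! a0, \<dots>, P ! (a1 - 1)\<close> of one path and of every second entry of the next level, which
  occupies the cells \<open>lo', \<dots>, lo - 1\<close>.  Entry \<open>t\<close> records how far both lists had been consumed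
  before it was written.
\<close>

definition cut ::
  "real list \<Rightarrow> nat list \<Rightarrow> nat list \<Rightarrow> real list \<Rightarrow> nat \<Rightarrow> nat \<Rightarrow> nat \<Rightarrow> nat \<Rightarrow> nat \<Rightarrow> bool" where
  "cut key ap bp P lo' lo a0 a1 t \<longleftrightarrow>
     a0 \<le> ap ! t \<and> ap ! t \<le> a1 \<and>
     (a0 < ap ! t \<longrightarrow> lo < t \<and> P ! (ap ! t - 1) \<le> key ! (t - 1)) \<and>
     (ap ! t < a1 \<longrightarrow> key ! t \<le> P ! (ap ! t)) \<and>
     lo' < bp ! t \<and> bp ! t \<le> Suc lo \<and>
     (Suc lo' < bp ! t \<longrightarrow> lo < t \<and> key ! (bp ! t - 2) \<le> key ! (t - 1)) \<and>
     (bp ! t < lo \<longrightarrow> key ! t \<le> key ! (bp ! t))"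

definition level ::
  "real list \<Rightarrow> nat list \<Rightarrow> nat list \<Rightarrow> real list \<Rightarrow> nat \<Rightarrow> nat \<Rightarrow> nat \<Rightarrow> nat \<Rightarrow> nat \<Rightarrow> bool" where
  "level key ap bp P lo' lo a0 a1 hi \<longleftrightarrow> lo < hi \<and> asc key lo hi \<and> P ! (a1 - 1) \<le> key ! (hi - 1) \<and>
     lo' \<le> lo \<and> (\<forall>t. lo \<le> t \<longrightarrow> t < hi \<longrightarrow> cut key ap bp P lo' lo a0 a1 t)"

text \<open>A merge in progress: \<open>ia\<close> and \<open>ib\<close> are the next unread
  breakpoint and the next unread sample. Samples start at \<open>Suc lo'\<close> and advance by two,
  so \<open>ib\<close> may end at \<open>lo\<close> or at \<open>Suc lo\<close>. The equation counts
  entries: a breakpoint moves \<open>ia\<close> by one and a sample moves \<open>ib\<close> by two,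
  each for one new entry.\<close>

definition partial_level ::
  "real list \<Rightarrow> nat list \<Rightarrow> nat list \<Rightarrow> real list \<Rightarrow> nat \<Rightarrow> nat \<Rightarrow> nat \<Rightarrow> nat \<Rightarrow> nat \<Rightarrow> nat \<Rightarrow> nat \<Rightarrow> bool"
where
  "partial_level key ap bp P lo' lo a0 a1 ia ib hi \<longleftrightarrow>
     lo' \<le> lo \<and> lo \<le> hi \<and> a0 \<le> ia \<and> ia \<le> a1 \<and> lo' < ib \<and> ib \<le> Suc lo \<and>
     2 * (hi - lo) = 2 * (ia - a0) + (ib - Suc lo') \<and>
     (a0 < ia \<longrightarrow> lo < hi \<and> P ! (ia - 1) \<le> key ! (hi - 1)) \<and>
     (lo < hi \<longrightarrow> ia < a1 \<longrightarrow> key ! (hi - 1) \<le> P ! ia) \<and>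
     (Suc lo' < ib \<longrightarrow> lo < hi \<and> key ! (ib - 2) \<le> key ! (hi - 1)) \<and>
     (lo < hi \<longrightarrow> ib < lo \<longrightarrow> key ! (hi - 1) \<le> key ! ib) \<and>
     asc key lo' lo \<and> asc key lo hi \<and>
     (\<forall>t. lo \<le> t \<longrightarrow> t < hi \<longrightarrow> cut key ap bp P lo' lo a0 a1 t)"

lemma asc_cong: "asc key lo hi \<Longrightarrow> (\<And>t. t < hi \<Longrightarrow> key' ! t = key ! t) \<Longrightarrow> asc key' lo hi"
  by (simp add: asc_def)

lemma asc_snoc:
  assumes "asc key lo hi" "hi < length key" "lo < hi \<longrightarrow> key ! (hi - 1) \<le> x"
  shows "asc (key[hi := x]) lo (Suc hi)"
  unfolding asc_def
proof (intro allI impI)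
  fix t t' assume t: "lo \<le> t" "t \<le> t'" "t' < Suc hi"
  show "key[hi := x] ! t \<le> key[hi := x] ! t'"
  proof (cases "t' = hi")
    case True
    show ?thesis
    proof (cases "t = hi")
      case False
      with t True have "key ! t \<le> key ! (hi - 1)" "lo < hi"
        using assms(1) unfolding asc_def by auto
      with assms t True False show ?thesis by auto
    qed (use True in simp)
  next
    case False
    with t assms(1) show ?thesis by (simp add: asc_def)
  qed
qed

lemma cut_cong:
  assumes "cut key ap bp P lo' lo a0 a1 t" "lo \<le> t"
    and "\<And>i. i \<le> t \<Longrightarrow> key' ! i = key ! i" "ap' ! t = ap ! t" "bp' ! t = bp ! t"
  shows "cut key' ap' bp' P lo' lo a0 a1 t"
proof -
  have "key' ! (bp ! t - 2) = key ! (bp ! t - 2)" if "bp ! t \<le> Suc lo"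
    using that assms(2) by (intro assms(3)) simp
  moreover have "key' ! (bp ! t) = key ! (bp ! t)" if "bp ! t < lo"
    using that assms(2) by (intro assms(3)) simp
  ultimately show ?thesis
    using assms(1,3,4,5) by (simp add: cut_def)
qed

lemma level_cong:
  assumes "level key ap bp P lo' lo a0 a1 hi"
    and "\<And>i. i < hi \<Longrightarrow> key' ! i = key ! i \<and> ap' ! i = ap ! i \<and> bp' ! i = bp ! i"
  shows "level key' ap' bp' P lo' lo a0 a1 hi"
proof -
  have "cut key' ap' bp' P lo' lo a0 a1 t" if "lo \<le> t" "t < hi" for t
    by (rule cut_cong[of key ap bp]) (use assms that in \<open>auto simp: level_def\<close>)
  moreover have "asc key' lo hi"
    by (rule asc_cong[of key]) (use assms in \<open>auto simp: level_def\<close>)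
  ultimately show ?thesis using assms by (simp add: level_def)
qed

lemma partial_levelD:
  assumes "partial_level key ap bp P lo' lo a0 a1 ia ib hi"
  shows "lo' \<le> lo" "lo \<le> hi" "a0 \<le> ia" "ia \<le> a1" "lo' < ib" "ib \<le> Suc lo"
    "2 * (hi - lo) = 2 * (ia - a0) + (ib - Suc lo')"
    "a0 < ia \<Longrightarrow> lo < hi" "a0 < ia \<Longrightarrow> P ! (ia - 1) \<le> key ! (hi - 1)"
    "lo < hi \<Longrightarrow> ia < a1 \<Longrightarrow> key ! (hi - 1) \<le> P ! ia"
    "Suc lo' < ib \<Longrightarrow> lo < hi" "Suc lo' < ib \<Longrightarrow> key ! (ib - 2) \<le> key ! (hi - 1)"
    "lo < hi \<Longrightarrow> ib < lo \<Longrightarrow> key ! (hi - 1) \<le> key ! ib"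
    "asc key lo' lo" "asc key lo hi"
    "lo \<le> t \<Longrightarrow> t < hi \<Longrightarrow> cut key ap bp P lo' lo a0 a1 t"
  using assms by (simp_all add: partial_level_def)

lemma partial_level_own:
  assumes pl: "partial_level key ap bp P lo' lo a0 a1 ia ib hi"
    and hi: "hi < length key" "hi < length ap" "hi < length bp"
    and ia: "ia < a1" "ib < lo \<Longrightarrow> P ! ia \<le> key ! ib" "Suc ia < a1 \<Longrightarrow> P ! ia \<le> P ! Suc ia"
  shows "partial_level (key[hi := P ! ia]) (ap[hi := ia]) (bp[hi := ib]) P lo' lo a0 a1 (Suc ia) ib (Suc hi)"
proof -
  let ?key = "key[hi := P ! ia]" and ?ap = "ap[hi := ia]" and ?bp = "bp[hi := ib]"
  note d = partial_levelD[OF pl]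
  have old: "?key ! i = key ! i" if "i < hi" for i using that by simp
  have new: "?key ! hi = P ! ia" "?ap ! hi = ia" "?bp ! hi = ib" using hi by simp_all
  \<comment> \<open>The write at \<open>hi\<close> leaves alone what the invariant reads: consumed
    samples lie below \<open>lo\<close>, and the last entry of the current level is at
    \<open>hi - 1\<close>.\<close>
  have ibk: "?key ! (ib - 2) = key ! (ib - 2)" if "lo < hi"
    by (rule old) (use that d(6) in linarith)
  have ibk': "?key ! ib = key ! ib" if "ib < lo"
    by (rule old) (use that d(2) in linarith)
  have hik: "?key ! (hi - 1) = key ! (hi - 1)" if "lo < hi"
    by (rule old) (use that in linarith)
  have smp: "key ! (ib - 2) \<le> P ! ia" if "Suc lo' < ib"
    using d(10)[OF d(11)[OF that] ia(1)] d(12)[OF that] by (rule order_trans[rotated])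
  have own': "P ! (ia - 1) \<le> ?key ! (hi - 1)" if "a0 < ia"
    unfolding hik[OF d(8)[OF that]] by (rule d(9)[OF that])
  have smp': "?key ! (ib - 2) \<le> ?key ! (hi - 1)" if "Suc lo' < ib"
    unfolding hik[OF d(11)[OF that]] using d(11,12)[OF that] ibk by simp
  have "cut ?key ?ap ?bp P lo' lo a0 a1 hi"
    unfolding cut_def new using d(3-6,8,11) ia(1,2) ibk' own' smp' by simp
  moreover have "cut ?key ?ap ?bp P lo' lo a0 a1 t" if "lo \<le> t" "t < hi" for t
    by (rule cut_cong[OF d(16)[OF that] that(1)]) (use that in simp_all)
  ultimately have cuts: "\<forall>t. lo \<le> t \<longrightarrow> t < Suc hi \<longrightarrow> cut ?key ?ap ?bp P lo' lo a0 a1 t"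
    by (metis less_antisym)
  have asc: "asc ?key lo (Suc hi)" by (rule asc_snoc[OF d(15) hi(1)]) (use d(10) ia(1) in blast)
  have asc': "asc ?key lo' lo" by (rule asc_cong[OF d(14)]) (use d(2) in simp)
  have cnt: "2 * (Suc hi - lo) = 2 * (Suc ia - a0) + (ib - Suc lo')" using d(2,3,7) by linarith
  show ?thesis
    unfolding partial_level_def
    using d(1-6) ia ibk ibk' smp new cuts asc asc' cnt d(11) by simp
qed

lemma partial_level_sample:
  assumes pl: "partial_level key ap bp P lo' lo a0 a1 ia ib hi"
    and hi: "hi < length key" "hi < length ap" "hi < length bp"
    and ib: "ib < lo" "ia < a1 \<Longrightarrow> key ! ib \<le> P ! ia"
  shows "partial_level (key[hi := key ! ib]) (ap[hi := ia]) (bp[hi := ib]) P lo' lo a0 a1 ia (ib + 2) (Suc hi)"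
proof -
  let ?key = "key[hi := key ! ib]" and ?ap = "ap[hi := ia]" and ?bp = "bp[hi := ib]"
  note d = partial_levelD[OF pl]
  have old: "?key ! i = key ! i" if "i < hi" for i using that by simp
  have new: "?key ! hi = key ! ib" "?ap ! hi = ia" "?bp ! hi = ib" using hi by simp_all
  have ibk: "?key ! (ib - 2) = key ! (ib - 2)"
    by (rule old) (use ib(1) d(2) in linarith)
  have ibk': "?key ! ib = key ! ib"
    by (rule old) (use ib(1) d(2) in linarith)
  have hik: "?key ! (hi - 1) = key ! (hi - 1)" if "lo < hi"
    by (rule old) (use that in linarith)
  have ibk'': "?key ! (ib + 2) = key ! (ib + 2)" "key ! ib \<le> key ! (ib + 2)" if "ib + 2 < lo"
  proof -
    show "?key ! (ib + 2) = key ! (ib + 2)" by (rule old) (use that d(2) in linarith)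
    show "key ! ib \<le> key ! (ib + 2)" using d(14) d(5) that by (simp add: asc_def)
  qed
  have own: "P ! (ia - 1) \<le> key ! ib" if "a0 < ia"
    using d(13)[OF d(8)[OF that] ib(1)] d(9)[OF that] by (rule order_trans[rotated])
  have own': "P ! (ia - 1) \<le> ?key ! (hi - 1)" if "a0 < ia"
    unfolding hik[OF d(8)[OF that]] by (rule d(9)[OF that])
  have smp': "?key ! (ib - 2) \<le> ?key ! (hi - 1)" if "Suc lo' < ib"
    unfolding hik[OF d(11)[OF that]] using d(11,12)[OF that] ibk by simp
  have "cut ?key ?ap ?bp P lo' lo a0 a1 hi"
    unfolding cut_def new using d(3-6,8,11) ib ibk' own' smp' by simp
  moreover have "cut ?key ?ap ?bp P lo' lo a0 a1 t" if "lo \<le> t" "t < hi" for t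
    by (rule cut_cong[OF d(16)[OF that] that(1)]) (use that in simp_all)
  ultimately have cuts: "\<forall>t. lo \<le> t \<longrightarrow> t < Suc hi \<longrightarrow> cut ?key ?ap ?bp P lo' lo a0 a1 t"
    by (metis less_antisym)
  have asc: "asc ?key lo (Suc hi)" by (rule asc_snoc[OF d(15) hi(1)]) (use d(13) ib(1) in blast)
  have asc': "asc ?key lo' lo" by (rule asc_cong[OF d(14)]) (use d(2) in simp)
  have cnt: "2 * (Suc hi - lo) = 2 * (ia - a0) + (ib + 2 - Suc lo')" using d(2,5,7) by linarith
  show ?thesis
    unfolding partial_level_def
    using d(1-6) ib own ibk' ibk'' new cuts asc asc' cnt by simp
qed

lemma level_complete:
  "partial_level key ap bp P lo' lo a0 a1 ia ib hi \<Longrightarrow> a0 < a1 \<Longrightarrow> \<not> ia < a1 \<Longrightarrow>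
    level key ap bp P lo' lo a0 a1 hi"
  unfolding partial_level_def level_def by auto

text \<open>Breakpoints consumed before entry \<open>t\<close> are at most
  \<open>key ! (t - 1) < y\<close>, and the remaining ones are at least \<open>key ! t\<close>,
  hence at least \<open>y\<close>. So the recorded counter is the first breakpoint of the path that
  is at least \<open>y\<close>.\<close>

lemma level_locate:
  assumes lev: "level key ap bp P lo' lo a0 a1 hi"
    and t: "lo \<le> t" "t < hi" "y \<le> key ! t" "lo < t \<longrightarrow> key ! (t - 1) < y"
    and y: "y \<le> P ! (a1 - 1)" and P: "asc P a0 a1" "a0 < a1"
  shows "a0 \<le> ap ! t" "ap ! t < a1" "y \<le> P ! (ap ! t)" "a0 < ap ! t \<longrightarrow> P ! (ap ! t - 1) < y"
proof -
  have c: "cut key ap bp P lo' lo a0 a1 t" using lev t by (simp add: level_def)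
  show "a0 \<le> ap ! t" using c by (simp add: cut_def)
  show *: "a0 < ap ! t \<longrightarrow> P ! (ap ! t - 1) < y" using c t by (auto simp: cut_def)
  show lt: "ap ! t < a1"
  proof (rule ccontr)
    assume "\<not> ap ! t < a1"
    with c have "ap ! t = a1" by (simp add: cut_def)
    with * y P show False by simp
  qed
  with c t show "y \<le> P ! (ap ! t)" by (auto simp: cut_def)
qed

text \<open>The samples at \<open>bp ! t - 2\<close> and \<open>bp ! t\<close> enclose
  \<open>y\<close>, and between them lies a single unsampled entry. One comparison with that entry
  finds the position in the next level, which is what makes a level cost constant time.\<close>

lemma level_next:
  assumes lev: "level key ap bp P lo' lo a0 a1 hi"
    and next_lev: "level key ap bp P lo'' lo' b0 b1 lo"
    and t: "lo \<le> t" "t < hi" "y \<le> key ! t" "lo < t \<longrightarrow> key ! (t - 1) < y"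
    and y: "y \<le> P ! (b1 - 1)"
  defines "t' \<equiv> (if key ! (bp ! t - 1) < y then bp ! t else bp ! t - 1)"
  shows "0 < bp ! t" "bp ! t - 1 < lo" "lo' \<le> t'" "t' < lo" "y \<le> key ! t'" "lo' < t' \<longrightarrow> key ! (t' - 1) < y"
proof -
  have c: "cut key ap bp P lo' lo a0 a1 t" using lev t by (simp add: level_def)
  have top: "y \<le> key ! (lo - 1)" "lo' < lo" "asc key lo' lo" using next_lev y by (auto simp: level_def)
  have b: "lo' < bp ! t" "bp ! t \<le> Suc lo" using c by (auto simp: cut_def)
  show "0 < bp ! t" using b by simp
  have prev: "key ! (bp ! t - 2) < y" if "Suc lo' < bp ! t" using c t that by (auto simp: cut_def)
  have at: "y \<le> key ! (bp ! t)" if "bp ! t < lo" using c t that by (auto simp: cut_def)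
  \<comment> \<open>Otherwise the last entry of the next level was consumed as a sample and is below
    \<open>y\<close>; but that entry is at least the length of the path of that level.\<close>
  have ne: "bp ! t \<noteq> Suc lo"
  proof
    assume "bp ! t = Suc lo"
    with prev top(2) have "key ! (lo - 1) < y" by (simp add: numeral_2_eq_2)
    with top(1) show False by simp
  qed
  then show lt: "bp ! t - 1 < lo" using b by simp
  show "lo' \<le> t'" using b by (auto simp: t'_def)
  show tlt: "t' < lo"
  proof (cases "key ! (bp ! t - 1) < y")
    case True
    have "bp ! t \<noteq> lo" using True top(1) by auto
    with True ne b show ?thesis by (simp add: t'_def)
  qed (use lt in \<open>simp add: t'_def\<close>)
  then show "y \<le> key ! t'" using at by (auto simp: t'_def)
  show "lo' < t' \<longrightarrow> key ! (t' - 1) < y"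
    using prev b by (auto simp: t'_def numeral_2_eq_2 diff_diff_eq)
qed

subsection \<open>Extreme path lengths\<close>

definition extremes_init :: prog where
  "extremes_init = block [NAssign ''a'' (NConst 0), NAssign ''j'' (NConst 0),
     RAssign ''D'' (RGet ''len'' (NConst 0))]"

definition extremes_body :: prog where
  "extremes_body = block [
     Cond (RLess (RGet ''len'' (NReg ''a'')) (RGet ''len'' (NReg ''j''))) (NAssign ''a'' (NReg ''j'')) Skip,
     Cond (RLess (RGet ''len'' (NReg ''j'')) (RReg ''D'')) (RAssign ''D'' (RGet ''len'' (NReg ''j''))) Skip,
     NAssign ''j'' (NAdd (NReg ''j'') (NConst 1))]"

definition extremes_loop :: prog where
  "extremes_loop = While (NLess (NReg ''j'') (NReg ''p'')) extremes_body"

text \<open>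
  \<open>gp\<close> lists first a longest path and then the longest among the other paths, so that the paths
  that matter to a query form a segment of \<open>gp\<close>.
\<close>

definition group_init :: prog where
  "group_init = block [NPut ''gp'' (NConst 0) (NReg ''a''), NAssign ''q'' (NConst 1),
     NAssign ''j'' (NConst 0), RAssign ''l'' (RConst 0)]"

text \<open>A path longer than all earlier candidates resets \<open>q\<close> to 1, which discards
  them without erasing; an equally long one is appended. The initial \<open>l = 0\<close> is below
  every path length, so the first candidate always resets.\<close>

definition group_body :: prog where
  "group_body = block [
     Cond (NEq (NReg ''j'') (NReg ''a'')) Skip (block [
       Cond (RLess (RReg ''l'') (RGet ''len'' (NReg ''j'')))
         (block [RAssign ''l'' (RGet ''len'' (NReg ''j'')), NAssign ''q'' (NConst 1)]) Skip,
       Cond (RLess (RGet ''len'' (NReg ''j'')) (RReg ''l'')) Skip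
         (block [NPut ''gp'' (NReg ''q'') (NReg ''j''), NAssign ''q'' (NAdd (NReg ''q'') (NConst 1))])]),
     NAssign ''j'' (NAdd (NReg ''j'') (NConst 1))]"

definition group_loop :: prog where
  "group_loop = While (NLess (NReg ''j'') (NReg ''p'')) group_body"

definition cascade_init :: prog where
  "cascade_init = block [NAssign ''jj'' (NReg ''q''), NAssign ''o'' (NConst 0),
     NAssign ''base'' (NConst 0), NAssign ''ia'' (NConst 0), NAssign ''ea'' (NConst 0),
     NAssign ''ib'' (NConst 0), NAssign ''eb'' (NConst 0)]"

text \<open>Levels are written from the last to the first, as each one samples its successor; level
  \<open>r\<close> occupies the cells from \<open>off ! (r + 1)\<close> up to but excluding
  \<open>off ! r\<close>. With all registers zero, the first level written sees an empty
  successor.\<close>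

definition next_level :: prog where
  "next_level = block [
     NAssign ''jj'' (NSub (NReg ''jj'') (NConst 1)),
     NAssign ''ia'' (NGet ''st'' (NGet ''gp'' (NReg ''jj''))),
     NAssign ''ea'' (NGet ''en'' (NGet ''gp'' (NReg ''jj''))),
     NAssign ''eb'' (NReg ''o''),
     NAssign ''ib'' (NAdd (NReg ''base'') (NConst 1)),
     NAssign ''base'' (NReg ''o''),
     NPut ''off'' (NAdd (NReg ''jj'') (NConst 1)) (NReg ''o'')]"

definition merge_step :: prog where
  "merge_step = block [
     NPut ''ap'' (NReg ''o'') (NReg ''ia''),
     NPut ''bp'' (NReg ''o'') (NReg ''ib''),
     Cond (BAnd (NLess (NReg ''ia'') (NReg ''ea''))
            (BNot (BAnd (NLess (NReg ''ib'') (NReg ''eb''))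
               (RLess (RGet ''key'' (NReg ''ib'')) (RGet ''pos'' (NReg ''ia''))))))
       (block [RPut ''key'' (NReg ''o'') (RGet ''pos'' (NReg ''ia'')),
          NAssign ''ia'' (NAdd (NReg ''ia'') (NConst 1))])
       (block [RPut ''key'' (NReg ''o'') (RGet ''key'' (NReg ''ib'')),
          NAssign ''ib'' (NAdd (NReg ''ib'') (NConst 2))]),
     NAssign ''o'' (NAdd (NReg ''o'') (NConst 1))]"

definition level_finished :: bexp where
  "level_finished = BAnd (BNot (NLess (NReg ''ia'') (NReg ''ea''))) (BNot (NLess (NReg ''ib'') (NReg ''eb'')))"

definition cascade_body :: prog where
  "cascade_body = Cond level_finished next_level merge_step"

definition cascade_guard :: bexp where
  "cascade_guard = BNot (BAnd (BNot (NLess (NConst 0) (NReg ''jj''))) level_finished)"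

definition cascade_loop :: prog where
  "cascade_loop = While cascade_guard cascade_body"

context layout begin

definition laid :: "state \<Rightarrow> bool" where
  "laid s \<longleftrightarrow> sizes s \<and> recorded m s \<and> paths_done p s \<and> nreg s ''p'' = p"

lemma laid_frame:
  assumes "laid s" "frame c s s'" "''p'' \<notin> nreg_writes c"
    "narr_writes c \<inter> {''ord'', ''idx'', ''vin'', ''pid'', ''st'', ''en''} = {}"
    "rarr_writes c \<inter> {''pos'', ''len''} = {}"
  shows "laid s'"
proof -
  have "nreg s' ''p'' = nreg s ''p''" using frame_nreg assms by blast
  moreover have "narr s' a = narr s a" if "a \<in> {''ord'', ''idx'', ''vin'', ''pid'', ''st'', ''en''}" for a
    using that frame_narr[OF assms(2)] assms(4) by blast
  moreover have "rarr s' a = rarr s a" if "a \<in> {''pos'', ''len''}" for a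
    using that frame_rarr[OF assms(2)] assms(5) by blast
  ultimately show ?thesis
    using assms(1) by (simp add: laid_def sizes_def recorded_def paths_done_def)
qed

lemma laidD:
  assumes "laid s"
  shows "nreg s ''p'' = p" "length (narr s ''ord'') = m" "length (narr s ''idx'') = m"
    "length (narr s ''vin'') = m" "length (narr s ''pid'') = m" "length (narr s ''st'') = m"
    "length (narr s ''en'') = m" "length (rarr s ''pos'') = m" "length (rarr s ''len'') = m"
    "j < p \<Longrightarrow> narr s ''st'' ! j = st j" "j < p \<Longrightarrow> narr s ''en'' ! j = st j + len j"
    "j < p \<Longrightarrow> rarr s ''len'' ! j = L j"
    "j < p \<Longrightarrow> t < len j \<Longrightarrow> narr s ''ord'' ! (st j + t) = E j t"
    "j < p \<Longrightarrow> t < len j \<Longrightarrow> narr s ''idx'' ! E j t = st j + t"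
    "j < p \<Longrightarrow> t < len j \<Longrightarrow> narr s ''vin'' ! (st j + t) = V j t"
    "j < p \<Longrightarrow> t < len j \<Longrightarrow> narr s ''pid'' ! E j t = j"
    "j < p \<Longrightarrow> t < len j \<Longrightarrow> rarr s ''pos'' ! (st j + t) = pos j (Suc t)"
  using assms flat_less by (simp_all add: laid_def sizes_def recorded_def paths_done_def)

lemma pos_asc:
  assumes "laid s" "j < p" shows "asc (rarr s ''pos'') (st j) (st j + len j)"
  unfolding asc_def
proof (intro allI impI)
  fix k k' assume k: "st j \<le> k" "k \<le> k'" "k' < st j + len j"
  then obtain t t' where t: "k = st j + t" "k' = st j + t'" by (metis le_add_diff_inverse le_trans)
  then show "rarr s ''pos'' ! k \<le> rarr s ''pos'' ! k'"
    using k laidD(17)[OF assms] pos_mono[OF assms(2), of "Suc t" "Suc t'"] by simp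
qed

lemma pos_last:
  assumes "laid s" "j < p" shows "rarr s ''pos'' ! (st j + len j - 1) = L j"
  using laidD(17)[OF assms, of "len j - 1"] len_pos[OF assms(2)] by (simp add: L_def)

lemma extremes_loop_runs:
  assumes W: "10 * n \<le> W" and laid: "laid s"
    and init: "nreg s ''a'' = 0" "nreg s ''j'' = 0" "rreg s ''D'' = L 0"
  shows "runs W extremes_loop s (loop_time (NLess (NReg ''j'') (NReg ''p'')) extremes_body p)
    (\<lambda>s'. nreg s' ''a'' < p \<and> (\<forall>j < p. L j \<le> L (nreg s' ''a'')) \<and> rreg s' ''D'' = D)"
proof -
  define I where "I k s \<longleftrightarrow> nreg s ''j'' \<le> p \<and> k = p - nreg s ''j'' \<and> nreg s ''a'' < p \<and>
      (\<forall>i < nreg s ''j''. L i \<le> L (nreg s ''a'') \<and> rreg s ''D'' \<le> L i) \<and>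
      (\<exists>i < p. rreg s ''D'' = L i)" for k and s :: state
  show ?thesis
    unfolding extremes_loop_def
  proof (rule runs_While[where k = p and I = I, OF _ _ _ _ order_refl])
    show "\<not> allocates extremes_body" by (simp add: extremes_body_def)
    show "I p s" using init p_pos by (auto simp: I_def)
  next
    fix k s'
    assume fr: "frame extremes_body s s'" and I: "I k s'"
    have laid': "laid s'" by (rule laid_frame[OF laid fr]) (simp_all add: extremes_body_def)
    note l = laidD[OF laid']
    have pW: "p \<le> W" "Suc 0 \<le> W" using W p_le_n n_ge_2 by auto
    show "bok W s' (NLess (NReg ''j'') (NReg ''p''))" using I pW l by (simp add: I_def)
    show "nreg s' ''a'' < p \<and> (\<forall>j < p. L j \<le> L (nreg s' ''a'')) \<and> rreg s' ''D'' = D"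
      if "\<not> bval s' (NLess (NReg ''j'') (NReg ''p''))"
    proof -
      have "nreg s' ''j'' = p" using that I l by (simp add: I_def)
      then show ?thesis using I D_eqI unfolding I_def by metis
    qed
    assume "bval s' (NLess (NReg ''j'') (NReg ''p''))"
    then have j: "nreg s' ''j'' < p" using l by simp
    define j where "j = nreg s' ''j''"
    define a where "a = nreg s' ''a''"
    have ja: "nreg s' ''j'' = j" "j < p" "nreg s' ''a'' = a" "a < p" "a < m" "j < m" "a \<le> W" "j \<le> W"
      "Suc j \<le> W"
      using j I p_le_m pW by (auto simp: j_def a_def I_def)
    have I': "\<forall>i < j. L i \<le> L a \<and> rreg s' ''D'' \<le> L i" "\<exists>i < p. rreg s' ''D'' = L i"
      "k = p - j" using I by (auto simp: I_def j_def a_def)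
    have "safe W extremes_body s'"
      using ja l pW by (simp add: extremes_body_def)
    moreover have "nreg (exec extremes_body s') ''j'' = Suc j"
      "nreg (exec extremes_body s') ''a'' = (if L a < L j then j else a)"
      "rreg (exec extremes_body s') ''D'' = (if L j < rreg s' ''D'' then L j else rreg s' ''D'')"
      using ja l(9,12) by (simp_all add: extremes_body_def)
    then have "I (k - 1) (exec extremes_body s')"
      using I' ja unfolding I_def by (force simp: less_Suc_eq)
    moreover have "k - 1 < k" using I' ja by simp
    ultimately show "safe W extremes_body s' \<and> (\<exists>k'<k. I k' (exec extremes_body s'))" by blast
  qed
qed

text \<open>The second rank is described by comparison with all paths other than \<open>G 0\<close>
  instead of by a maximum, so that \<open>p = 1\<close>, where there is no second rank, fits
  in.\<close>

definition grouped :: "nat \<Rightarrow> (nat \<Rightarrow> nat) \<Rightarrow> bool" where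
  "grouped q G \<longleftrightarrow> 1 \<le> q \<and> (\<forall>r < q. G r < p) \<and> inj_on G {..<q} \<and> (\<forall>j < p. L j \<le> L (G 0)) \<and>
     (\<forall>r. 1 \<le> r \<longrightarrow> r < q \<longrightarrow> (\<forall>j < p. j \<noteq> G 0 \<longrightarrow> L j \<le> L (G r))) \<and>
     (\<forall>j < p. j \<noteq> G 0 \<longrightarrow> (\<forall>i < p. i \<noteq> G 0 \<longrightarrow> L i \<le> L j) \<longrightarrow> (\<exists>r. 1 \<le> r \<and> r < q \<and> G r = j))"

text \<open>The tail of the array lists path numbers in increasing order, which later yields
  injectivity. The disjunction ties \<open>l = 0\<close> to the time before the first
  candidate.\<close>

definition group_inv :: "nat \<Rightarrow> nat \<Rightarrow> nat \<Rightarrow> nat list \<Rightarrow> real \<Rightarrow> bool" where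
  "group_inv a j q g l \<longleftrightarrow> 1 \<le> q \<and> q \<le> Suc j \<and> length g = Suc m \<and> g ! 0 = a \<and>
     (\<forall>i < j. i \<noteq> a \<longrightarrow> L i \<le> l) \<and> ((\<forall>i < j. i = a) \<and> l = 0 \<or> 2 \<le> q) \<and>
     (\<forall>r. 1 \<le> r \<longrightarrow> r < q \<longrightarrow> g ! r < j \<and> g ! r \<noteq> a \<and> L (g ! r) = l) \<and>
     (\<forall>i < j. i \<noteq> a \<longrightarrow> L i = l \<longrightarrow> (\<exists>r. 1 \<le> r \<and> r < q \<and> g ! r = i)) \<and>
     (\<forall>r r'. 1 \<le> r \<longrightarrow> r < r' \<longrightarrow> r' < q \<longrightarrow> g ! r < g ! r')"

lemma group_invD:
  assumes "group_inv a j q g l"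
  shows "1 \<le> q" "q \<le> Suc j" "length g = Suc m" "g ! 0 = a"
    "\<And>i. i < j \<Longrightarrow> i \<noteq> a \<Longrightarrow> L i \<le> l" "(\<forall>i < j. i = a) \<and> l = 0 \<or> 2 \<le> q"
    "\<And>r. 1 \<le> r \<Longrightarrow> r < q \<Longrightarrow> g ! r < j \<and> g ! r \<noteq> a \<and> L (g ! r) = l"
    "\<And>i. i < j \<Longrightarrow> i \<noteq> a \<Longrightarrow> L i = l \<Longrightarrow> \<exists>r. 1 \<le> r \<and> r < q \<and> g ! r = i"
    "\<And>r r'. 1 \<le> r \<Longrightarrow> r < r' \<Longrightarrow> r' < q \<Longrightarrow> g ! r < g ! r'"
  using assms unfolding group_inv_def by blast+

lemma group_inv_skip:
  assumes "group_inv a j q g l" "j < p" "j = a \<or> L j < l"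
  shows "group_inv a (Suc j) q g l"
proof -
  note d = group_invD[OF assms(1)]
  have "(\<forall>i < Suc j. i = a) \<and> l = 0 \<or> 2 \<le> q"
    using d(6) assms(3) L_pos[OF assms(2)] by (auto simp: less_Suc_eq)
  moreover have "L i \<le> l" if "i < Suc j" "i \<noteq> a" for i
    using d(5)[of i] that assms(3) by (auto simp: less_Suc_eq)
  moreover have "\<exists>r. 1 \<le> r \<and> r < q \<and> g ! r = i" if "i < Suc j" "i \<noteq> a" "L i = l" for i
    using d(8)[of i] that assms(3) by (auto simp: less_Suc_eq)
  ultimately show ?thesis
    unfolding group_inv_def using d(1-4,7,9) by (simp add: less_Suc_eq)
qed

lemma group_inv_tie:
  assumes "group_inv a j q g l" "j < p" "j \<noteq> a" "L j = l"
  shows "group_inv a (Suc j) (Suc q) (g[q := j]) l"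
proof -
  note d = group_invD[OF assms(1)]
  have q: "q < length g" using d(2,3) assms(2) p_le_m by simp
  have "L i \<le> l" if "i < Suc j" "i \<noteq> a" for i
    using d(5)[of i] that assms(4) by (auto simp: less_Suc_eq)
  moreover have "\<exists>r. 1 \<le> r \<and> r < Suc q \<and> g[q := j] ! r = i" if i: "i < Suc j" "i \<noteq> a" "L i = l" for i
  proof (cases "i = j")
    case True
    then show ?thesis using q d(1) by (intro exI[of _ q]) simp
  next
    case False
    with i d(8)[of i] obtain r where "1 \<le> r" "r < q" "g ! r = i" by auto
    then show ?thesis by (intro exI[of _ r]) simp
  qed
  moreover have "g[q := j] ! r < Suc j \<and> g[q := j] ! r \<noteq> a \<and> L (g[q := j] ! r) = l"
    if "1 \<le> r" "r < Suc q" for r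
    using d(7)[of r] q that assms(3,4) by (cases "r = q") auto
  moreover have "g[q := j] ! r < g[q := j] ! r'" if "1 \<le> r" "r < r'" "r' < Suc q" for r r'
    using d(7)[of r] d(9)[of r r'] q that by (cases "r' = q") auto
  ultimately show ?thesis
    unfolding group_inv_def using d(1-4) by simp
qed

lemma group_inv_new:
  assumes "group_inv a j q g l" "j < p" "j \<noteq> a" "l < L j"
  shows "group_inv a (Suc j) 2 (g[1 := j]) (L j)"
proof -
  note d = group_invD[OF assms(1)]
  have q: "1 < length g" using d(3) m_pos by simp
  have "L i \<le> L j" if "i < Suc j" "i \<noteq> a" for i
    using d(5)[of i] that assms(4) by (cases "i = j") auto
  moreover have "i = j" if "i < Suc j" "i \<noteq> a" "L i = L j" for i
    using d(5)[of i] that assms(4) by (cases "i = j") auto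
  ultimately show ?thesis
    unfolding group_inv_def using d(3,4) q assms(2,3)
    by (auto simp: less_Suc_eq numeral_2_eq_2 intro: exI[of _ 1])
qed

lemma group_inv_grouped:
  assumes inv: "group_inv a p q g l" and a: "a < p" "\<forall>j < p. L j \<le> L a"
  shows "grouped q ((!) g)"
proof -
  note d = group_invD[OF inv]
  have "inj_on ((!) g) {..<q}"
  proof (rule linorder_inj_onI)
    fix r r' assume r: "r < r'" "r \<in> {..<q}" "r' \<in> {..<q}"
    show "g ! r \<noteq> g ! r'"
    proof (cases "r = 0")
      case True
      then show ?thesis using d(4) d(7)[of r'] r by auto
    next
      case False
      then show ?thesis using d(9)[of r r'] r by auto
    qed
  qed auto
  moreover have "g ! r < p" if "r < q" for r
    using d(4) d(7)[of r] that a(1) by (cases "r = 0") auto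
  moreover have "L i \<le> L (g ! r)" if "1 \<le> r" "r < q" "i < p" "i \<noteq> g ! 0" for i r
    using that d(4) d(5)[of i] d(7)[of r] by simp
  moreover have "\<exists>r. 1 \<le> r \<and> r < q \<and> g ! r = i"
    if i: "i < p" "i \<noteq> g ! 0" and max: "\<forall>i' < p. i' \<noteq> g ! 0 \<longrightarrow> L i' \<le> L i" for i
  proof -
    have "2 \<le> q" using d(4,6) i by auto
    then have "g ! 1 < p" "g ! 1 \<noteq> a" "L (g ! 1) = l" using d(7)[of 1] by auto
    then have "l \<le> L i" using max d(4) by blast
    moreover have "L i \<le> l" using d(5)[of i] i d(4) by simp
    ultimately show ?thesis using d(8)[of i] i d(4) by simp
  qed
  ultimately show ?thesis
    unfolding grouped_def using d(1,4) a(2) by blast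
qed

lemma group_loop_runs:
  assumes W: "10 * n \<le> W" and laid: "laid s"
    and a: "nreg s ''a'' = a" "a < p" "\<forall>j < p. L j \<le> L a"
    and init: "nreg s ''q'' = 1" "nreg s ''j'' = 0" "rreg s ''l'' = 0"
      "length (narr s ''gp'') = Suc m" "narr s ''gp'' ! 0 = a"
  shows "runs W group_loop s (loop_time (NLess (NReg ''j'') (NReg ''p'')) group_body p)
    (\<lambda>s'. length (narr s' ''gp'') = Suc m \<and> nreg s' ''q'' \<le> Suc p \<and>
      grouped (nreg s' ''q'') ((!) (narr s' ''gp'')))"
proof -
  define I where "I k s \<longleftrightarrow> nreg s ''j'' \<le> p \<and> k = p - nreg s ''j'' \<and>
      group_inv a (nreg s ''j'') (nreg s ''q'') (narr s ''gp'') (rreg s ''l'')" for k and s :: state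
  show ?thesis
    unfolding group_loop_def
  proof (rule runs_While[where k = p and I = I, OF _ _ _ _ order_refl])
    show "\<not> allocates group_body" by (simp add: group_body_def)
    show "I p s" using init by (simp add: I_def group_inv_def)
  next
    fix k s'
    assume fr: "frame group_body s s'" and I: "I k s'"
    have laid': "laid s'" by (rule laid_frame[OF laid fr]) (simp_all add: group_body_def)
    note l = laidD[OF laid']
    have ra: "nreg s' ''a'' = a" using frame_nreg[OF fr] a(1) by (simp add: group_body_def)
    have pW: "Suc p \<le> W" "Suc 0 \<le> W" using W p_le_n n_ge_2 by auto
    show "bok W s' (NLess (NReg ''j'') (NReg ''p''))" using I pW l by (simp add: I_def)
    define j where "j = nreg s' ''j''"
    define q where "q = nreg s' ''q''"
    define g where "g = narr s' ''gp''"
    define l2 where "l2 = rreg s' ''l''"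
    have regs: "nreg s' ''j'' = j" "nreg s' ''q'' = q" "narr s' ''gp'' = g" "rreg s' ''l'' = l2"
      by (simp_all add: j_def q_def g_def l2_def)
    have inv: "group_inv a j q g l2" "j \<le> p" "k = p - j"
      using I unfolding I_def regs by blast+
    note d = group_invD[OF inv(1)]
    {
      assume "\<not> bval s' (NLess (NReg ''j'') (NReg ''p''))"
      then have "j = p" using inv(2) l regs by simp
      then show "length (narr s' ''gp'') = Suc m \<and> nreg s' ''q'' \<le> Suc p \<and>
          grouped (nreg s' ''q'') ((!) (narr s' ''gp''))"
        using group_inv_grouped[of a q g l2] a(2,3) inv(1) d(2,3) regs by simp
    next
      assume "bval s' (NLess (NReg ''j'') (NReg ''p''))"
      then have j: "j < p" using l regs by simp
      have jb: "j < m" "j \<le> W" "Suc j \<le> W" "q \<le> W" "Suc q \<le> W" "a \<le> W" "q < Suc m" "Suc (Suc 0) \<le> W" "0 < m"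
        using j d(2) pW a(2) p_le_m W n_ge_2 m_pos by auto
      have lj: "rarr s' ''len'' ! j = L j" using l(12) j by blast
      consider "j = a" | "j \<noteq> a" "L j < l2" | "j \<noteq> a" "L j = l2" | "j \<noteq> a" "l2 < L j" by linarith
      then have "safe W group_body s' \<and> group_inv a (nreg (exec group_body s') ''j'')
          (nreg (exec group_body s') ''q'') (narr (exec group_body s') ''gp'') (rreg (exec group_body s') ''l'') \<and>
          nreg (exec group_body s') ''j'' = Suc j"
      proof cases
        case 1
        then show ?thesis using group_inv_skip[OF inv(1) j] jb(3)
          by (simp add: group_body_def regs ra jb pW)
      next
        case 2
        then show ?thesis using group_inv_skip[OF inv(1) j]
          by (simp add: group_body_def regs ra jb pW l(9) lj)
      next
        case 3
        then show ?thesis using group_inv_tie[OF inv(1) j 3]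
          by (simp add: group_body_def regs ra jb pW l(9) lj d(3))
      next
        case 4
        then show ?thesis using group_inv_new[OF inv(1) j 4]
          by (simp add: group_body_def regs ra jb pW l(9) lj d(3) numeral_2_eq_2)
      qed
      then have "safe W group_body s' \<and> I (k - 1) (exec group_body s')"
        using inv j by (elim conjE) (simp add: I_def)
      moreover have "k - 1 < k" using inv j by simp
      ultimately show "safe W group_body s' \<and> (\<exists>k'<k. I k' (exec group_body s'))" by blast
    }
  qed
qed

subsection \<open>Building the cascade\<close>

text \<open>The number of edges on the paths whose levels are complete while level \<open>jj\<close>
  is being written.\<close>

definition beyond :: "nat \<Rightarrow> (nat \<Rightarrow> nat) \<Rightarrow> nat \<Rightarrow> nat" where
  "beyond q G jj = (\<Sum>r\<in>{Suc jj..<q}. len (G r))"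

lemma beyond_Suc: "Suc jj < q \<Longrightarrow> beyond q G jj = beyond q G (Suc jj) + len (G (Suc jj))"
  by (simp add: beyond_def sum.atLeast_Suc_lessThan)

lemma beyond_le:
  assumes "grouped q G" "jj < q" shows "beyond q G jj + len (G jj) \<le> m"
proof -
  have "beyond q G jj + len (G jj) = (\<Sum>r\<in>{jj..<q}. len (G r))"
    using assms(2) by (simp add: beyond_def sum.atLeast_Suc_lessThan)
  also have "\<dots> \<le> (\<Sum>r<q. len (G r))" by (rule sum_mono2) auto
  also have "\<dots> = (\<Sum>j\<in>G ` {..<q}. len j)"
    using assms(1) by (simp add: grouped_def sum.reindex)
  also have "\<dots> \<le> (\<Sum>j<p. len j)" by (rule sum_mono2) (use assms(1) in \<open>auto simp: grouped_def\<close>)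
  finally show ?thesis using st_p by (simp add: st_def)
qed

lemma grouped_le: "grouped q G \<Longrightarrow> q \<le> p"
  using card_inj_on_le[of G "{..<q}" "{..<p}"] by (auto simp: grouped_def)

text \<open>Space is controlled by the total size plus the size of the latest level. Let
  \<open>U\<close> be the total before a level, \<open>s'\<close> the size of its successor,
  \<open>s\<close> its own size and \<open>l\<close> the length of its path in edges. Then
  \<open>2 * s \<le> 2 * l + s'\<close>, and completing the level turns \<open>U + s'\<close> into
  \<open>U + 2 * s \<le> U + s' + 2 * l\<close>. So the quantity grows by at most twice the edges of
  the path.\<close>

definition cascade_inv ::
  "real list \<Rightarrow> (nat \<Rightarrow> nat) \<Rightarrow> nat \<Rightarrow> nat \<Rightarrow> nat \<Rightarrow> nat \<Rightarrow> nat \<Rightarrow> nat \<Rightarrow> nat \<Rightarrow> nat \<Rightarrow>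
   real list \<Rightarrow> nat list \<Rightarrow> nat list \<Rightarrow> nat list \<Rightarrow> bool" where
  "cascade_inv P G q jj used base ia ea ib eb key ap bp off \<longleftrightarrow>
     length key = 2 * m \<and> length ap = 2 * m \<and> length bp = 2 * m \<and> length off = m + 2 \<and>
     used \<le> 2 * m \<and> off ! Suc q = 0 \<and>
     (\<forall>r. jj < r \<longrightarrow> r < q \<longrightarrow>
        level key ap bp P (off ! (r + 2)) (off ! Suc r) (st (G r)) (st (G r) + len (G r)) (off ! r)) \<and>
     (\<forall>r. jj < r \<longrightarrow> r < q \<longrightarrow> off ! r \<le> used) \<and>
     (jj = q \<and> used = 0 \<and> base = 0 \<and> ia = 0 \<and> ea = 0 \<and> ib = 0 \<and> eb = 0 \<or>
      jj < q \<and> base = off ! Suc jj \<and> eb = base \<and> ea = st (G jj) + len (G jj) \<and>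
      base + (base - off ! (jj + 2)) \<le> 2 * beyond q G jj \<and>
      partial_level key ap bp P (off ! (jj + 2)) base (st (G jj)) (st (G jj) + len (G jj)) ia ib used)"

lemma cascade_invD:
  assumes "cascade_inv P G q jj used base ia ea ib eb key ap bp off"
  shows "length key = 2 * m" "length ap = 2 * m" "length bp = 2 * m" "length off = m + 2"
    "used \<le> 2 * m" "off ! Suc q = 0"
    "\<And>r. jj < r \<Longrightarrow> r < q \<Longrightarrow>
        level key ap bp P (off ! (r + 2)) (off ! Suc r) (st (G r)) (st (G r) + len (G r)) (off ! r)"
    "\<And>r. jj < r \<Longrightarrow> r < q \<Longrightarrow> off ! r \<le> used"
    "jj = q \<and> used = 0 \<and> base = 0 \<and> ia = 0 \<and> ea = 0 \<and> ib = 0 \<and> eb = 0 \<or>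
      jj < q \<and> base = off ! Suc jj \<and> eb = base \<and> ea = st (G jj) + len (G jj) \<and>
      base + (base - off ! (jj + 2)) \<le> 2 * beyond q G jj \<and>
      partial_level key ap bp P (off ! (jj + 2)) base (st (G jj)) (st (G jj) + len (G jj)) ia ib used"
  using assms unfolding cascade_inv_def by blast+

lemma cascade_inv_active:
  assumes "cascade_inv P G q jj used base ia ea ib eb key ap bp off" "ia < ea \<or> ib < eb \<or> jj < q"
  shows "jj < q" "base = off ! Suc jj" "eb = base" "ea = st (G jj) + len (G jj)"
    "base + (base - off ! (jj + 2)) \<le> 2 * beyond q G jj"
    "partial_level key ap bp P (off ! (jj + 2)) base (st (G jj)) (st (G jj) + len (G jj)) ia ib used"
  using cascade_invD(9)[OF assms(1)] assms(2) by auto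

text \<open>
  A level is at most as long as its path plus half the next level; hence all levels together are
  at most twice as long as the paths.
\<close>

lemma cascade_space:
  assumes "cascade_inv P G q jj used base ia ea ib eb key ap bp off" "ia < ea \<or> ib < eb \<or> jj < q"
  shows "used + (used - base) + (Suc base - ib) \<le> 2 * beyond q G jj + 2 * (ia - st (G jj))"
proof -
  note a = cascade_inv_active[OF assms]
  note d = partial_levelD[OF a(6)]
  show ?thesis using a(5) d(1,2,5,6,7) by linarith
qed

text \<open>While the merge is unfinished, a breakpoint or a sample is unread, and its share of the
  bound in \<open>cascade_space\<close> has not been used up.\<close>

lemma cascade_room:
  assumes inv: "cascade_inv P G q jj used base ia ea ib eb key ap bp off"
    and act: "ia < ea \<or> ib < eb" and G: "grouped q G"
  shows "used < 2 * m"
proof -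
  have act': "ia < ea \<or> ib < eb \<or> jj < q" using act by blast
  note a = cascade_inv_active[OF inv act']
  note d = partial_levelD[OF a(6)]
  have "used + (used - base) + (Suc base - ib) \<le> 2 * beyond q G jj + 2 * (ia - st (G jj))"
    by (rule cascade_space[OF inv act'])
  moreover have "ia - st (G jj) < len (G jj) \<or> 0 < Suc base - ib" using act a(3,4) d(3) by linarith
  moreover have "ia - st (G jj) \<le> len (G jj)" using d(3,4) by linarith
  ultimately show ?thesis using beyond_le[OF G a(1)] by linarith
qed

lemma cascade_inv_finished:
  assumes inv: "cascade_inv P G q jj used base ia ea ib eb key ap bp off"
    and fin: "\<not> ia < ea" "\<not> ib < eb" and jj: "jj < q" and G: "grouped q G"
  shows "level key ap bp P (off ! (jj + 2)) (off ! Suc jj) (st (G jj)) (st (G jj) + len (G jj)) used"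
proof -
  have act: "ia < ea \<or> ib < eb \<or> jj < q" using jj by blast
  note a = cascade_inv_active[OF inv act]
  have "0 < len (G jj)" using G jj len_pos by (simp add: grouped_def)
  then show ?thesis using level_complete[OF a(6)] a(2,4) fin(1) by simp
qed

lemma cascade_inv_next:
  assumes inv: "cascade_inv P G q jj used base ia ea ib eb key ap bp off"
    and fin: "\<not> ia < ea" "\<not> ib < eb" and jj: "0 < jj" and G: "grouped q G" and jjq: "jj \<le> q"
  shows "cascade_inv P G q (jj - 1) used used (st (G (jj - 1))) (st (G (jj - 1)) + len (G (jj - 1)))
    (Suc base) used key ap bp (off[jj := used])"
proof -
  note d = cascade_invD[OF inv]
  have qm: "q \<le> m" using grouped_le[OF G] p_le_m by simp
  show ?thesis
  proof (cases "jj = q")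
    case True
    then have z: "used = 0" "base = 0" using d(9) by auto
    have off: "off[jj := used] ! Suc (jj - 1) = 0" "off[jj := used] ! (jj - 1 + 2) = 0"
      using True z d(4,6) qm jj by auto
    have "partial_level key ap bp P 0 0 (st (G (jj - 1))) (st (G (jj - 1)) + len (G (jj - 1)))
        (st (G (jj - 1))) (Suc 0) 0"
      by (simp add: partial_level_def asc_def)
    moreover have "\<not> r < q" if "jj - 1 < r" for r using that True by linarith
    ultimately show ?thesis
      unfolding cascade_inv_def off z(2) using d(1-6) z True jj by simp
  next
    case False
    with jjq have jq: "jj < q" by simp
    then have act: "ia < ea \<or> ib < eb \<or> jj < q" by blast
    note a = cascade_inv_active[OF inv act]
    note pd = partial_levelD[OF a(6)]
    have off: "off[jj := used] ! jj = used" "i \<noteq> jj \<Longrightarrow> off[jj := used] ! i = off ! i" for i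
      using d(4) jq qm by auto
    have lev: "level key ap bp P (off ! (jj + 2)) (off ! Suc jj) (st (G jj)) (st (G jj) + len (G jj)) used"
      by (rule cascade_inv_finished[OF inv fin jq G])
    have levels: "level key ap bp P (off[jj := used] ! (r + 2)) (off[jj := used] ! Suc r)
        (st (G r)) (st (G r) + len (G r)) (off[jj := used] ! r)"
      "off[jj := used] ! r \<le> used" if "jj - 1 < r" "r < q" for r
      using that lev d(7,8)[of r] off by (cases "r = jj"; simp)+
    have "beyond q G (jj - 1) = beyond q G jj + len (G jj)"
      using beyond_Suc[of "jj - 1" q G] jj jq by simp
    moreover have "ia - st (G jj) \<le> len (G jj)" using pd(3,4) by linarith
    ultimately have sp: "used + (used - base) \<le> 2 * beyond q G (jj - 1)"
      using cascade_space[OF inv act] by linarith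
    have pl: "partial_level key ap bp P base used (st (G (jj - 1)))
        (st (G (jj - 1)) + len (G (jj - 1))) (st (G (jj - 1))) (Suc base) used"
      using pd(2,15) by (simp add: partial_level_def) (simp add: asc_def)
    have o': "off[jj := used] ! Suc (jj - 1) = used" "off[jj := used] ! (jj - 1 + 2) = base"
      "off[jj := used] ! Suc q = 0"
      using off jj a(2) d(6) jq by auto
    show ?thesis
      unfolding cascade_inv_def o' using d(1-5) levels sp pl jq by simp
  qed
qed

lemma cascade_inv_own:
  assumes inv: "cascade_inv P G q jj used base ia ea ib eb key ap bp off"
    and act: "ia < ea" "\<not> (ib < eb \<and> key ! ib < P ! ia)" and G: "grouped q G"
    and P: "asc P (st (G jj)) (st (G jj) + len (G jj))"
  shows "cascade_inv P G q jj (Suc used) base (Suc ia) ea ib eb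
    (key[used := P ! ia]) (ap[used := ia]) (bp[used := ib]) off"
proof -
  have act': "ia < ea \<or> ib < eb" "ia < ea \<or> ib < eb \<or> jj < q" using act by blast+
  note d = cascade_invD[OF inv]
  note a = cascade_inv_active[OF inv act'(2)]
  note room = cascade_room[OF inv act'(1) G]
  have lev: "level (key[used := P ! ia]) (ap[used := ia]) (bp[used := ib]) P (off ! (r + 2)) (off ! Suc r)
      (st (G r)) (st (G r) + len (G r)) (off ! r)" if "jj < r" "r < q" for r
    by (rule level_cong[OF d(7)[OF that]]) (use d(8)[OF that] in auto)
  have "partial_level (key[used := P ! ia]) (ap[used := ia]) (bp[used := ib]) P (off ! (jj + 2)) base
      (st (G jj)) (st (G jj) + len (G jj)) (Suc ia) ib (Suc used)"
  proof (rule partial_level_own[OF a(6)])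
    show "used < length key" "used < length ap" "used < length bp" using room d(1-3) by simp_all
    show "ia < st (G jj) + len (G jj)" using act(1) a(4) by simp
    show "P ! ia \<le> key ! ib" if "ib < base" using act(2) that a(3) by simp
    show "P ! ia \<le> P ! Suc ia" if "Suc ia < st (G jj) + len (G jj)"
      using P that partial_levelD(3)[OF a(6)] by (simp add: asc_def)
  qed
  then show ?thesis
    unfolding cascade_inv_def using d(1-6) a(1-5) lev d(8) room by (simp add: le_SucI)
qed

lemma cascade_inv_sample:
  assumes inv: "cascade_inv P G q jj used base ia ea ib eb key ap bp off"
    and act: "ib < eb" "ia < ea \<Longrightarrow> key ! ib < P ! ia" and G: "grouped q G"
  shows "cascade_inv P G q jj (Suc used) base ia ea (ib + 2) eb
    (key[used := key ! ib]) (ap[used := ia]) (bp[used := ib]) off"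
proof -
  have act': "ia < ea \<or> ib < eb" "ia < ea \<or> ib < eb \<or> jj < q" using act by blast+
  note d = cascade_invD[OF inv]
  note a = cascade_inv_active[OF inv act'(2)]
  note room = cascade_room[OF inv act'(1) G]
  have lev: "level (key[used := key ! ib]) (ap[used := ia]) (bp[used := ib]) P (off ! (r + 2)) (off ! Suc r)
      (st (G r)) (st (G r) + len (G r)) (off ! r)" if "jj < r" "r < q" for r
    by (rule level_cong[OF d(7)[OF that]]) (use d(8)[OF that] in auto)
  have "partial_level (key[used := key ! ib]) (ap[used := ia]) (bp[used := ib]) P (off ! (jj + 2)) base
      (st (G jj)) (st (G jj) + len (G jj)) ia (ib + 2) (Suc used)"
  proof (rule partial_level_sample[OF a(6)])
    show "used < length key" "used < length ap" "used < length bp" using room d(1-3) by simp_all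
    show "ib < base" using act(1) a(3) by simp
    show "key ! ib \<le> P ! ia" if "ia < st (G jj) + len (G jj)"
      using act(2) that a(4) by simp
  qed
  then show ?thesis
    unfolding cascade_inv_def using d(1-6) a(1-5) lev d(8) room by (simp add: le_SucI)
qed

text \<open>Each iteration opens one of the \<open>q\<close> levels or writes one of at most
  \<open>2 * m\<close> entries. The end of level 0 is still in register \<open>o\<close> afterwards,
  because the end of a level is stored only when another level is opened.\<close>

lemma cascade_loop_runs:
  assumes W: "10 * n \<le> W" and laid: "laid s"
    and gp: "length (narr s ''gp'') = Suc m" "narr s ''gp'' = gp" and G: "grouped q ((!) gp)"
    and init: "nreg s ''jj'' = q" "nreg s ''o'' = 0" "nreg s ''base'' = 0" "nreg s ''ia'' = 0"
      "nreg s ''ea'' = 0" "nreg s ''ib'' = 0" "nreg s ''eb'' = 0"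
      "length (rarr s ''key'') = 2 * m" "length (narr s ''ap'') = 2 * m"
      "length (narr s ''bp'') = 2 * m" "narr s ''off'' = replicate (m + 2) 0"
  defines "lev \<equiv> \<lambda>s' r. level (rarr s' ''key'') (narr s' ''ap'') (narr s' ''bp'') (rarr s' ''pos'')
      (narr s' ''off'' ! (r + 2)) (narr s' ''off'' ! Suc r) (st (gp ! r)) (st (gp ! r) + len (gp ! r))"
  shows "runs W cascade_loop s (loop_time cascade_guard cascade_body (q + 2 * m))
    (\<lambda>s'. (\<forall>r. 0 < r \<longrightarrow> r < q \<longrightarrow> lev s' r (narr s' ''off'' ! r)) \<and> lev s' 0 (nreg s' ''o'') \<and>
       (\<forall>r < q. 0 < r \<longrightarrow> narr s' ''off'' ! r \<le> 2 * m) \<and> nreg s' ''o'' \<le> 2 * m \<and>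
       length (rarr s' ''key'') = 2 * m \<and> length (narr s' ''ap'') = 2 * m \<and>
       length (narr s' ''bp'') = 2 * m \<and> length (narr s' ''off'') = m + 2)"
proof -
  define inv where "inv s \<longleftrightarrow> cascade_inv (rarr s ''pos'') ((!) gp) q (nreg s ''jj'') (nreg s ''o'')
      (nreg s ''base'') (nreg s ''ia'') (nreg s ''ea'') (nreg s ''ib'') (nreg s ''eb'')
      (rarr s ''key'') (narr s ''ap'') (narr s ''bp'') (narr s ''off'')" for s :: state
  define I where "I k s \<longleftrightarrow> nreg s ''jj'' \<le> q \<and> k = nreg s ''jj'' + (2 * m - nreg s ''o'') \<and> inv s"
    for k and s :: state
  have q: "q \<le> p" "1 \<le> q" "q \<le> m" using grouped_le[OF G] G p_le_m by (auto simp: grouped_def)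
  show ?thesis
    unfolding cascade_loop_def
  proof (rule runs_While[where k = "q + 2 * m" and I = I, OF _ _ _ _ order_refl])
    show "\<not> allocates cascade_body"
      by (simp add: cascade_body_def next_level_def merge_step_def)
    show "I (q + 2 * m) s"
      using init q by (simp add: I_def inv_def cascade_inv_def del: replicate.simps)
  next
    fix k s'
    assume fr: "frame cascade_body s s'" and I: "I k s'"
    have laid': "laid s'"
      by (rule laid_frame[OF laid fr]) (simp_all add: cascade_body_def next_level_def merge_step_def)
    note l = laidD[OF laid']
    have rgp: "narr s' ''gp'' = gp" "length gp = Suc m"
      using frame_narr[OF fr] gp by (simp_all add: cascade_body_def next_level_def merge_step_def)
    define jj where "jj = nreg s' ''jj''"
    define used where "used = nreg s' ''o''"
    define base where "base = nreg s' ''base''"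
    define ia where "ia = nreg s' ''ia''"
    define ea where "ea = nreg s' ''ea''"
    define ib where "ib = nreg s' ''ib''"
    define eb where "eb = nreg s' ''eb''"
    define key where "key = rarr s' ''key''"
    define ap where "ap = narr s' ''ap''"
    define bp where "bp = narr s' ''bp''"
    define off where "off = narr s' ''off''"
    define P where "P = rarr s' ''pos''"
    have regs: "nreg s' ''jj'' = jj" "nreg s' ''o'' = used" "nreg s' ''base'' = base" "nreg s' ''ia'' = ia"
      "nreg s' ''ea'' = ea" "nreg s' ''ib'' = ib" "nreg s' ''eb'' = eb" "rarr s' ''key'' = key"
      "narr s' ''ap'' = ap" "narr s' ''bp'' = bp" "narr s' ''off'' = off" "rarr s' ''pos'' = P"
      by (simp_all add: jj_def used_def base_def ia_def ea_def ib_def eb_def key_def ap_def bp_def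
          off_def P_def)
    have inv: "cascade_inv P ((!) gp) q jj used base ia ea ib eb key ap bp off"
      and jjq: "jj \<le> q" and k: "k = jj + (2 * m - used)"
      using I unfolding I_def inv_def regs by blast+
    note d = cascade_invD[OF inv]
    have Gp: "gp ! r < p" if "r < q" for r using G that by (simp add: grouped_def)
    have ea_le: "st (gp ! r) + len (gp ! r) \<le> m" if "r < q" for r
      using st_bound[OF Gp[OF that], of "len (gp ! r)"] st_p by simp
    have mW: "2 * m + 3 \<le> W" using W m_le_2n n_ge_2 by simp
    \<comment> \<open>Since \<open>ib\<close> advances by two, it may overshoot the end of the
      sampled level by one cell.\<close>
    have "ia \<le> m \<and> ea \<le> m \<and> ib \<le> 2 * m + 1 \<and> eb \<le> 2 * m \<and> base \<le> 2 * m \<and> (ib < eb \<longrightarrow> ib < 2 * m)"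
    proof (cases "jj = q")
      case True
      with d(9) show ?thesis by auto
    next
      case False
      then have jq: "jj < q" using jjq by simp
      then have act: "ia < ea \<or> ib < eb \<or> jj < q" by blast
      note a = cascade_inv_active[OF inv act]
      note pd = partial_levelD[OF a(6)]
      show ?thesis using ea_le[OF jq] a(3,4) pd(2,4,6) d(5) by linarith
    qed
    then have bounds: "ia \<le> m" "ea \<le> m" "ib \<le> 2 * m + 1" "eb \<le> 2 * m" "base \<le> 2 * m"
      by blast+
    have W': "jj \<le> W" "used \<le> W" "Suc used \<le> W" "base \<le> W" "ia \<le> W" "Suc ia \<le> W" "ea \<le> W" "ib \<le> W"
      "Suc (Suc ib) \<le> W" "eb \<le> W" "Suc base \<le> W" "Suc 0 \<le> W" "2 \<le> W" "jj + 1 \<le> W"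
      using bounds mW d(5) jjq q by linarith+
    have fin_ok: "bok W s' level_finished"
      by (simp add: level_finished_def regs W')
    have fin: "bval s' level_finished \<longleftrightarrow> \<not> ia < ea \<and> \<not> ib < eb"
      by (simp add: level_finished_def regs)
    show "bok W s' cascade_guard"
      using fin_ok by (simp add: cascade_guard_def regs W')
    have guard: "bval s' cascade_guard \<longleftrightarrow> 0 < jj \<or> ia < ea \<or> ib < eb"
      by (auto simp: cascade_guard_def fin regs)
    {
      assume "\<not> bval s' cascade_guard"
      then have stop: "jj = 0" "\<not> ia < ea" "\<not> ib < eb" using guard by auto
      have "level key ap bp P (off ! (0 + 2)) (off ! Suc 0) (st (gp ! 0)) (st (gp ! 0) + len (gp ! 0)) used"
        using cascade_inv_finished[OF inv stop(2,3) _ G] stop(1) q by simp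
      moreover have "off ! r \<le> 2 * m" if "0 < r" "r < q" for r
        using d(5) d(8)[of r] that stop(1) by simp
      ultimately show "(\<forall>r. 0 < r \<longrightarrow> r < q \<longrightarrow> lev s' r (narr s' ''off'' ! r)) \<and> lev s' 0 (nreg s' ''o'') \<and>
         (\<forall>r < q. 0 < r \<longrightarrow> narr s' ''off'' ! r \<le> 2 * m) \<and> nreg s' ''o'' \<le> 2 * m \<and>
         length (rarr s' ''key'') = 2 * m \<and> length (narr s' ''ap'') = 2 * m \<and>
         length (narr s' ''bp'') = 2 * m \<and> length (narr s' ''off'') = m + 2"
        unfolding lev_def regs using d(1-5) d(7) stop(1) by blast
    next
      assume "bval s' cascade_guard"
      then consider (nxt) "\<not> ia < ea" "\<not> ib < eb" "0 < jj" | (own) "ia < ea" "\<not> (ib < eb \<and> key ! ib < P ! ia)"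
        | (sample) "ib < eb" "ia < ea \<Longrightarrow> key ! ib < P ! ia"
        using guard by blast
      then show "safe W cascade_body s' \<and> (\<exists>k'<k. I k' (exec cascade_body s'))"
      proof cases
        case nxt
        then obtain i where i: "jj = Suc i" by (cases jj) auto
        have iq: "i < q" using i jjq by simp
        have gb: "i < Suc m" "gp ! i < p" "gp ! i < m" "gp ! i \<le> W" "i \<le> W" "Suc i \<le> W"
          using iq q Gp[OF iq] p_le_m mW by linarith+
        have stW: "st (gp ! i) \<le> W" "st (gp ! i) + len (gp ! i) \<le> W"
          using ea_le[OF iq] mW by linarith+
        have b: "exec cascade_body s' = exec next_level s'" "safe W cascade_body s' = safe W next_level s'"
          using nxt fin fin_ok by (simp_all add: cascade_body_def)
        have "safe W next_level s'"
          by (simp add: next_level_def regs W' rgp l(6,7) l(10,11)[OF gb(2)] gb stW d(4) i)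
        moreover have "I (k - 1) (exec next_level s')"
          using cascade_inv_next[OF inv nxt G jjq] jjq k
          by (simp add: I_def inv_def next_level_def regs rgp l(10,11)[OF gb(2)] i)
        ultimately show ?thesis using b nxt(3) k by (intro conjI exI[of _ "k - 1"]) simp_all
      next
        case own
        have room: "used < 2 * m" using cascade_room[OF inv _ G] own by blast
        have jq: "jj < q" using cascade_inv_active(1)[OF inv] own by blast
        have ib2: "ib < 2 * m" if "ib < eb" using that bounds(4) by linarith
        have iam: "ia < m" using own bounds by linarith
        have b: "exec cascade_body s' = exec merge_step s'" "safe W cascade_body s' = safe W merge_step s'"
          using own fin fin_ok by (simp_all add: cascade_body_def)
        have "safe W merge_step s'"
          using own(2) ib2 by (simp add: merge_step_def regs W' l(8)[unfolded regs] d(1-3) room own(1) iam)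
        moreover have "asc P (st (gp ! jj)) (st (gp ! jj) + len (gp ! jj))"
          using pos_asc[OF laid' Gp[OF jq]] regs by simp
        then have "I (k - 1) (exec merge_step s')"
          using cascade_inv_own[OF inv own G] own jjq k room
          by (auto simp: I_def inv_def merge_step_def regs)
        ultimately show ?thesis using b room k by (intro conjI exI[of _ "k - 1"]) simp_all
      next
        case sample
        have room: "used < 2 * m" using cascade_room[OF inv _ G] sample by blast
        have ib2: "ib < 2 * m" using sample bounds(4) by linarith
        have iam: "ia < m" if "ia < ea" using that bounds by linarith
        have b: "exec cascade_body s' = exec merge_step s'" "safe W cascade_body s' = safe W merge_step s'"
          using sample fin fin_ok by (simp_all add: cascade_body_def)
        have "safe W merge_step s'"
          using sample ib2 iam by (simp add: merge_step_def regs W' l(8)[unfolded regs] d(1-3) room)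
        moreover have "I (k - 1) (exec merge_step s')"
          using cascade_inv_sample[OF inv sample G] sample jjq k room
          by (auto simp: I_def inv_def merge_step_def regs)
        ultimately show ?thesis using b room k by (intro conjI exI[of _ "k - 1"]) simp_all
      qed
    }
  qed
qed

end

section \<open>The query algorithm\<close>

definition search_body :: "string \<Rightarrow> prog" where
  "search_body a = block [
     NAssign ''mid'' (NDiv (NAdd (NReg ''lo'') (NReg ''hi'')) (NConst 2)),
     Cond (RLess (RGet a (NReg ''mid'')) (RReg ''z''))
       (NAssign ''lo'' (NAdd (NReg ''mid'') (NConst 1)))
       (NAssign ''hi'' (NReg ''mid''))]"

definition search :: "string \<Rightarrow> prog" where
  "search a = While (NLess (NReg ''lo'') (NReg ''hi'')) (search_body a)"

text \<open>The exponent serves as fuel, since every iteration halves the interval. The assumption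
  \<open>z \<le> arr ! h\<close> guarantees an answer inside the interval, which allows a closed
  interval without a sentinel.\<close>

lemma search_runs:
  assumes arr: "rarr s a = arr" "asc arr l (Suc h)" "h < length arr" "l \<le> h" "rreg s ''z'' = z" "z \<le> arr ! h"
    and regs: "nreg s ''lo'' = l" "nreg s ''hi'' = h" and W: "2 * h + 2 \<le> W" and k: "h - l < 2 ^ k"
  shows "runs W (search a) s (loop_time (NLess (NReg ''lo'') (NReg ''hi'')) (search_body a) k)
    (\<lambda>s'. l \<le> nreg s' ''lo'' \<and> nreg s' ''lo'' \<le> h \<and> z \<le> arr ! nreg s' ''lo'' \<and>
      (l < nreg s' ''lo'' \<longrightarrow> arr ! (nreg s' ''lo'' - 1) < z))"
proof -
  define I where "I k s \<longleftrightarrow> l \<le> nreg s ''lo'' \<and> nreg s ''lo'' \<le> nreg s ''hi'' \<and> nreg s ''hi'' \<le> h \<and>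
      nreg s ''hi'' - nreg s ''lo'' < 2 ^ k \<and> z \<le> arr ! nreg s ''hi'' \<and>
      (l < nreg s ''lo'' \<longrightarrow> arr ! (nreg s ''lo'' - 1) < z)" for k :: nat and s :: state
  show ?thesis
    unfolding search_def
  proof (rule runs_While[where k = k and I = I, OF _ _ _ _ order_refl])
    show "\<not> allocates (search_body a)" by (simp add: search_body_def)
    show "I k s" using assms by (simp add: I_def)
  next
    fix k s'
    assume fr: "frame (search_body a) s s'" and I: "I k s'"
    have same: "rarr s' a = arr" "rreg s' ''z'' = z"
      using frame_rarr[OF fr] frame_rreg[OF fr] arr by (simp_all add: search_body_def)
    define lo where "lo = nreg s' ''lo''"
    define hi where "hi = nreg s' ''hi''"
    have regs: "nreg s' ''lo'' = lo" "nreg s' ''hi'' = hi" by (simp_all add: lo_def hi_def)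
    have I': "l \<le> lo" "lo \<le> hi" "hi \<le> h" "hi - lo < 2 ^ k" "z \<le> arr ! hi" "l < lo \<Longrightarrow> arr ! (lo - 1) < z"
      using I unfolding I_def regs by blast+
    have W': "lo \<le> W" "hi \<le> W" "lo + hi \<le> W" "Suc ((lo + hi) div 2) \<le> W" "2 \<le> W" "Suc 0 \<le> W" "(lo + hi) div 2 \<le> W"
      using I' W by linarith+
    show "bok W s' (NLess (NReg ''lo'') (NReg ''hi''))" by (simp add: regs W')
    {
      assume "\<not> bval s' (NLess (NReg ''lo'') (NReg ''hi''))"
      then have "lo = hi" using I'(2) regs by simp
      then show "l \<le> nreg s' ''lo'' \<and> nreg s' ''lo'' \<le> h \<and> z \<le> arr ! nreg s' ''lo'' \<and>
          (l < nreg s' ''lo'' \<longrightarrow> arr ! (nreg s' ''lo'' - 1) < z)"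
        unfolding regs using I' by simp
    next
      assume "bval s' (NLess (NReg ''lo'') (NReg ''hi''))"
      then have lh: "lo < hi" using regs by simp
      then obtain k' where k': "k = Suc k'" using I'(4) by (cases k) auto
      define mid where "mid = (lo + hi) div 2"
      have mid: "lo \<le> mid" "mid < hi" "hi - Suc mid < 2 ^ k'" "mid - lo < 2 ^ k'" "mid < length arr"
        using lh I'(3,4) arr(3) k' unfolding mid_def by auto
      note W'' = W'[folded mid_def]
      have "safe W (search_body a) s'"
        using mid(5) W'' by (simp add: search_body_def regs same mid_def[symmetric])
      moreover have "I k' (exec (search_body a) s')"
      proof (cases "arr ! mid < z")
        case True
        then show ?thesis
          using I' mid lh by (simp add: I_def search_body_def regs same mid_def[symmetric])
      next
        case False
        then show ?thesis
          using I' mid lh by (simp add: I_def search_body_def regs same mid_def[symmetric])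
      qed
      ultimately show "safe W (search_body a) s' \<and> (\<exists>k'<k. I k' (exec (search_body a) s'))"
        using k' by blast
    }
  qed
qed

definition emit_point :: prog where
  "emit_point = block [
     NAssign ''f'' (NGet ''ord'' (NReg ''k'')),
     RAssign ''w'' (RGet ''weight'' (NReg ''f'')),
     RAssign ''r'' (RDiv (RSub (RReg ''z'') (RSub (RGet ''pos'' (NReg ''k'')) (RReg ''w''))) (RReg ''w'')),
     Cond (NEq (NGet ''src'' (NReg ''f'')) (NGet ''vin'' (NReg ''k'')))
       (Emit (NReg ''f'') (RReg ''r''))
       (Emit (NReg ''f'') (RSub (RConst 1) (RReg ''r'')))]"

text \<open>The first conditional is the comparison of \<open>level_next\<close>, postponed from the
  preceding iteration so that it happens only if the next level is really visited. At a terminal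
  position \<open>j\<close> is set to \<open>q\<close>, which ends the loop after one
  report.\<close>

definition report_body :: prog where
  "report_body = block [
     Cond (RLess (RGet ''key'' (NReg ''t'')) (RReg ''z''))
       (NAssign ''t'' (NAdd (NReg ''t'') (NConst 1))) Skip,
     Cond (NEq (NGet ''gp'' (NReg ''j'')) (NReg ''i'')) Skip (block [
       NAssign ''k'' (NGet ''ap'' (NReg ''t'')),
       emit_point,
       Cond (BAnd (RLess (RConst 0) (RReg ''z'')) (RLess (RReg ''z'') (RReg ''M''))) Skip
         (NAssign ''j'' (NReg ''q''))]),
     NAssign ''t'' (NSub (NGet ''bp'' (NReg ''t'')) (NConst 1)),
     NAssign ''j'' (NAdd (NReg ''j'') (NConst 1))]"

text \<open>The end of the segment of longest paths is not stored; it is recognised by a shorter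
  path or by the end of the array.\<close>

definition report_guard :: bexp where
  "report_guard = BAnd (NLess (NReg ''j'') (NReg ''q''))
     (BNot (RLess (RGet ''len'' (NGet ''gp'' (NReg ''j''))) (RReg ''M'')))"

definition report_loop :: prog where
  "report_loop = While report_guard report_body"

context layout begin

definition ready :: "nat \<Rightarrow> (nat \<Rightarrow> nat) \<Rightarrow> state \<Rightarrow> bool" where
  "ready q G s \<longleftrightarrow> has_input N s \<and> laid s \<and> rreg s ''D'' = D \<and> nreg s ''q'' = q \<and>
     length (narr s ''gp'') = Suc m \<and> (\<forall>r < q. narr s ''gp'' ! r = G r) \<and> grouped q G \<and>
     length (rarr s ''key'') = 2 * m \<and> length (narr s ''ap'') = 2 * m \<and>
     length (narr s ''bp'') = 2 * m \<and> length (narr s ''off'') = m + 2 \<and>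
     (\<forall>r < q. narr s ''off'' ! r \<le> 2 * m \<and>
        level (rarr s ''key'') (narr s ''ap'') (narr s ''bp'') (rarr s ''pos'')
          (narr s ''off'' ! (r + 2)) (narr s ''off'' ! Suc r) (st (G r)) (st (G r) + len (G r))
          (narr s ''off'' ! r))"

lemma readyD:
  assumes "ready q G s"
  shows "has_input N s" "laid s" "rreg s ''D'' = D" "nreg s ''q'' = q" "length (narr s ''gp'') = Suc m"
    "r < q \<Longrightarrow> narr s ''gp'' ! r = G r" "grouped q G" "length (rarr s ''key'') = 2 * m"
    "length (narr s ''ap'') = 2 * m" "length (narr s ''bp'') = 2 * m" "length (narr s ''off'') = m + 2"
    "r < q \<Longrightarrow> narr s ''off'' ! r \<le> 2 * m"
    "r < q \<Longrightarrow> level (rarr s ''key'') (narr s ''ap'') (narr s ''bp'') (rarr s ''pos'')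
          (narr s ''off'' ! (r + 2)) (narr s ''off'' ! Suc r) (st (G r)) (st (G r) + len (G r))
          (narr s ''off'' ! r)"
  using assms unfolding ready_def by blast+

text \<open>The listed registers are those that \<open>ready\<close> reads. Any run of such a
  program keeps the structure, whatever it computes, and this settles arbitrary sequences of
  queries.\<close>

definition keeps_structure :: "prog \<Rightarrow> bool" where
  "keeps_structure c \<longleftrightarrow> narr_writes c = {} \<and> rarr_writes c = {} \<and>
     nreg_writes c \<inter> {''n'', ''m'', ''p'', ''q''} = {} \<and> ''D'' \<notin> rreg_writes c"

lemma ready_frame:
  assumes "ready q G s" "frame c s s'" "keeps_structure c"
  shows "ready q G s'"
proof -
  have arr: "narr s' = narr s" "rarr s' = rarr s"
    using assms(2,3) by (auto simp: frame_def keeps_structure_def fun_eq_iff)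
  have reg: "nreg s' ''q'' = nreg s ''q''" "rreg s' ''D'' = rreg s ''D''"
    "nreg s' ''n'' = nreg s ''n''" "nreg s' ''m'' = nreg s ''m''" "nreg s' ''p'' = nreg s ''p''"
    using assms(2,3) by (auto simp: frame_def keeps_structure_def)
  show ?thesis
    using assms(1)
    unfolding ready_def has_input_def laid_def sizes_def recorded_def paths_done_def arr reg .
qed

lemma emit_point_exec:
  assumes W: "10 * n \<le> W" and inp: "has_input N s" and laid: "laid s" and j: "j < p" "t < len j"
    and reg: "nreg s ''k'' = st j + t" "rreg s ''z'' = z"
  shows "safe W emit_point s" "reported (exec emit_point s) = reported s @ [addr j t z]"
proof -
  note l = laidD[OF laid]
  note inp = has_inputD[OF inp]
  have b: "st j + t < m" "E j t < m" "V j t < n"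
    using flat_less[OF j] E_bound[OF j] V_vertex[of j t] j by auto
  have st: "src N (E j t) < n" using src_tgt_lt b by auto
  have w: "weight N (E j t) \<noteq> 0" using E_vertices[OF j] by simp
  have bW: "st j + t \<le> W" "E j t \<le> W" "V j t \<le> W" "src N (E j t) \<le> W"
    using b st m_le_2n W by linarith+
  show "safe W emit_point s"
    by (simp add: emit_point_def reg l(2,4,8) l(13,15,17)[OF j] inp b bW w)
  show "reported (exec emit_point s) = reported s @ [addr j t z]"
    by (simp add: emit_point_def reg l(13,15,17)[OF j] inp b addr_def pos_Suc)
qed

lemma emit_point_frame: "frame emit_point s (exec emit_point s)"
  by (simp add: emit_point_def frame_def)

lemma flat_cell:
  assumes laid: "laid s" and j: "j < p" and k: "st j \<le> k" "k < st j + len j"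
    and z: "0 \<le> z" "z \<le> rarr s ''pos'' ! k" "st j < k \<longrightarrow> rarr s ''pos'' ! (k - 1) < z"
  shows "cell j (k - st j) z"
proof -
  obtain t where t: "k = st j + t" "t < len j" using k by (metis add_less_cancel_left le_Suc_ex)
  have "pos j t \<le> z"
  proof (cases t)
    case (Suc t')
    then show ?thesis using laidD(17)[OF laid j, of t'] z(3) t by simp
  qed (use z in simp)
  moreover have "z \<le> pos j (Suc t)" using laidD(17)[OF laid j, of t] z(2) t by simp
  ultimately show ?thesis using t by (simp add: cell_def)
qed

subsection \<open>Reporting on a group of longest paths\<close>

definition position :: "state \<Rightarrow> real \<Rightarrow> nat \<Rightarrow> nat \<Rightarrow> bool" where
  "position s z r t \<longleftrightarrow> narr s ''off'' ! Suc r \<le> t \<and> t < narr s ''off'' ! r \<and> z \<le> rarr s ''key'' ! t \<and>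
     (narr s ''off'' ! Suc r < t \<longrightarrow> rarr s ''key'' ! (t - 1) < z)"

text \<open>
  All paths in the segment \<open>b \<le> r < e\<close> of the group have length \<open>M\<close>.  If \<open>z\<close> is a terminal,
  then they share the point at \<open>z\<close>, and only the first one is reported.
\<close>

definition stop :: "real \<Rightarrow> real \<Rightarrow> nat \<Rightarrow> nat \<Rightarrow> nat" where
  "stop z M b e = (if 0 < z \<and> z < M then e else Suc b)"

lemma report_loop_runs:
  assumes W: "10 * n \<le> W" and rdy: "ready q G s"
    and seg: "b < e" "e \<le> q" "\<And>r. b \<le> r \<Longrightarrow> r < e \<Longrightarrow> L (G r) = M" "e < q \<Longrightarrow> L (G e) < M" "G b \<noteq> i" "i < p"
    and z: "0 \<le> z" "z \<le> M"
    and regs: "nreg s ''i'' = i" "nreg s ''j'' = b" "rreg s ''z'' = z" "rreg s ''M'' = M"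
    and t: "position s z b (nreg s ''t'')"
  shows "runs W report_loop s (loop_time report_guard report_body (stop z M b e - b))
    (\<lambda>s'. \<exists>out. reported s' = reported s @ out \<and> set out \<subseteq> addresses N \<and>
      map (point_at N) out = map (\<lambda>r. pt (G r) z) (filter (\<lambda>r. G r \<noteq> i) [b..<stop z M b e]))"
proof -
  let ?e = "stop z M b e"
  have e: "b < ?e" "?e \<le> e" using seg by (auto simp: stop_def)
  define result where "result s' c \<longleftrightarrow> (\<exists>out. reported s' = reported s @ out \<and> set out \<subseteq> addresses N \<and>
      map (point_at N) out = map (\<lambda>r. pt (G r) z) (filter (\<lambda>r. G r \<noteq> i) [b..<c]))" for s' :: state and c
  \<comment> \<open>As the choice between the two cells of \<open>level_next\<close> is postponed,
    register \<open>t\<close> may be one short of the true position.\<close>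
  define current where "current s' = (if rarr s' ''key'' ! nreg s' ''t'' < z then Suc (nreg s' ''t'')
      else nreg s' ''t'')" for s' :: state
  \<comment> \<open>\<open>c\<close> is the first unprocessed index. It equals \<open>j\<close> as
    long as the loop goes on; after the exit at a terminal position \<open>j\<close> is
    \<open>Suc q\<close>, while only index \<open>b\<close> has been processed.\<close>
  define I where "I k s' \<longleftrightarrow> (\<exists>c. (c = nreg s' ''j'' \<and> (0 < z \<and> z < M \<or> c = b) \<or>
      \<not> (0 < z \<and> z < M) \<and> nreg s' ''j'' = Suc q \<and> c = Suc b) \<and> b \<le> c \<and> c \<le> ?e \<and> k = ?e - c \<and> result s' c \<and>
      (c < ?e \<longrightarrow> nreg s' ''t'' < 2 * m \<and> position s' z c (current s')))" for k :: nat and s' :: state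
  show ?thesis
    unfolding report_loop_def
  proof (rule runs_While[where k = "?e - b" and I = I, OF _ _ _ _ order_refl])
    show "\<not> allocates report_body" by (simp add: report_body_def emit_point_def)
    have "nreg s ''t'' < 2 * m"
      using t readyD(12)[OF rdy, of b] seg by (simp add: position_def)
    \<comment> \<open>The binary search delivers an exact position, which the postponed comparison
      leaves unchanged.\<close>
    moreover have "current s = nreg s ''t''" using t by (simp add: current_def position_def)
    ultimately show "I (?e - b) s"
      unfolding I_def result_def using regs t e by (intro exI[of _ b]) simp
  next
    fix k s'
    assume fr: "frame report_body s s'" and "I k s'"
    then obtain c where c: "c = nreg s' ''j'' \<and> (0 < z \<and> z < M \<or> c = b) \<or>
        \<not> (0 < z \<and> z < M) \<and> nreg s' ''j'' = Suc q \<and> c = Suc b" "b \<le> c" "c \<le> ?e" "k = ?e - c" "result s' c"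
        "c < ?e \<Longrightarrow> nreg s' ''t'' < 2 * m" "c < ?e \<Longrightarrow> position s' z c (current s')"
      unfolding I_def by blast
    have rdy': "ready q G s'"
      by (rule ready_frame[OF rdy fr]) (simp add: keeps_structure_def report_body_def emit_point_def)
    note rd = readyD[OF rdy']
    note l = laidD[OF rd(2)]
    have same: "nreg s' ''i'' = i" "rreg s' ''z'' = z" "rreg s' ''M'' = M"
      using frame_nreg[OF fr] frame_rreg[OF fr] regs
      by (simp_all add: report_body_def emit_point_def)
    have q: "q \<le> p" "q \<le> m" using grouped_le[OF rd(7)] p_le_m by auto
    have Gp: "G r < p" if "r < q" for r using rd(7) that by (simp add: grouped_def)
    have W': "q \<le> W" "Suc q \<le> W" "i \<le> W" "2 * m + 2 \<le> W" "Suc 0 \<le> W"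
      using W q m_le_2n n_ge_2 p_le_n seg(6) by linarith+
    define j where "j = nreg s' ''j''"
    have j: "nreg s' ''j'' = j" by (simp add: j_def)
    have jq: "j \<le> Suc q" using c(1,3) e seg(2) by (auto simp: j)
    have gm: "G j < m" "G j \<le> W" "j < Suc m" if "j < q"
      using Gp[OF that] that p_le_m q W' by linarith+
    show "bok W s' report_guard"
      using jq gm W' by (auto simp: report_guard_def j rd(4,5,6) l(9))
    have guard: "bval s' report_guard \<longleftrightarrow> j < q \<and> M \<le> L (G j)"
      using Gp[of j] by (auto simp: report_guard_def j rd(4,6) l(12) same not_less)
    {
      assume "\<not> bval s' report_guard"
      then have g: "\<not> (j < q \<and> M \<le> L (G j))" using guard by simp
      have "c = ?e"
      proof (rule ccontr)
        assume "c \<noteq> ?e"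
        then have "c < ?e" using c(3) by simp
        then have "c = j" using c(1) by (auto simp: j stop_def split: if_splits)
        then show False using g seg(2) seg(3)[of j] c(2) e \<open>c < ?e\<close> by simp
      qed
      then show "\<exists>out. reported s' = reported s @ out \<and> set out \<subseteq> addresses N \<and>
          map (point_at N) out = map (\<lambda>r. pt (G r) z) (filter (\<lambda>r. G r \<noteq> i) [b..<?e])"
        using c(5) by (simp add: result_def)
    next
      assume "bval s' report_guard"
      then have g: "j < q" "M \<le> L (G j)" using guard by auto
      have cj: "c = j" using c(1) g by (auto simp: j)
      \<comment> \<open>The guard rejects whatever follows the segment, and after an exit at a
        terminal \<open>j\<close> exceeds \<open>q\<close>.\<close>
      have ce: "c < ?e"
      proof (rule ccontr)
        assume "\<not> c < ?e"
        then have "c = ?e" using c(3) by simp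
        then have "c \<noteq> b" "c \<le> q" using e seg(2) by auto
        then have "0 < z \<and> z < M" using c(1) cj by (auto simp: j)
        then have "c = e" using \<open>c = ?e\<close> by (simp add: stop_def)
        then show False using g cj seg(4) by simp
      qed
      note gm = gm[OF g(1)]
      have Lj: "L (G j) = M" using seg(3)[of j] c(2) ce e(2) cj by simp
      define key where "key = rarr s' ''key''"
      define ap where "ap = narr s' ''ap''"
      define bp where "bp = narr s' ''bp''"
      define off where "off = narr s' ''off''"
      define P where "P = rarr s' ''pos''"
      define t0 where "t0 = nreg s' ''t''"
      define t where "t = current s'"
      have arr: "rarr s' ''key'' = key" "narr s' ''ap'' = ap" "narr s' ''bp'' = bp"
        "narr s' ''off'' = off" "rarr s' ''pos'' = P" "nreg s' ''t'' = t0"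
        by (simp_all add: key_def ap_def bp_def off_def P_def t0_def)
      have pos: "off ! Suc j \<le> t" "t < off ! j" "z \<le> key ! t" "off ! Suc j < t \<longrightarrow> key ! (t - 1) < z"
        using c(7)[OF ce] cj unfolding position_def arr t_def by auto
      have t0: "t0 < 2 * m" "t = (if key ! t0 < z then Suc t0 else t0)"
        using c(6)[OF ce] arr by (simp_all add: t_def current_def)
      have tm: "t < 2 * m" using pos(2) rd(12)[OF g(1)] arr by simp
      have lev: "level key ap bp P (off ! (r + 2)) (off ! Suc r) (st (G r)) (st (G r) + len (G r)) (off ! r)"
        if "r < q" for r
        using rd(13)[OF that] unfolding arr .
      have Pl: "P ! (st (G r) + len (G r) - 1) = L (G r)" "asc P (st (G r)) (st (G r) + len (G r))"
        if "r < q" for r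
        using pos_last[OF rd(2) Gp[OF that]] pos_asc[OF rd(2) Gp[OF that]] unfolding arr by blast+
      have "0 < len (G j)" using len_pos Gp g(1) by blast
      then have k1: "st (G j) \<le> ap ! t" "ap ! t < st (G j) + len (G j)" "z \<le> P ! (ap ! t)"
        "st (G j) < ap ! t \<longrightarrow> P ! (ap ! t - 1) < z"
        using level_locate[OF lev[OF g(1)] pos] Pl[OF g(1)] z Lj by auto
      have cell: "cell (G j) (ap ! t - st (G j)) z"
        by (rule flat_cell[OF rd(2) Gp[OF g(1)]]) (use k1 z arr in auto)
      then have tl: "ap ! t - st (G j) < len (G j)" by (simp add: cell_def)
      have apm: "ap ! t \<le> W" using k1(2) st_bound[of "G j" "len (G j)"] st_p Gp[OF g(1)] W' by simp
      have bpW: "bp ! t \<le> W"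
      proof -
        have "bp ! t \<le> Suc (off ! Suc j)"
          using lev[OF g(1)] pos(1,2) by (simp add: level_def cut_def)
        then show ?thesis using pos(1) tm W' by linarith
      qed
      have tW: "t0 \<le> W" "Suc t0 \<le> W" "t \<le> W" using t0 tm W' by auto
      define s1 where "s1 = s'\<lparr>nreg := (nreg s')(''t'' := t)\<rparr>"
      define s2 where "s2 = s1\<lparr>nreg := (nreg s1)(''k'' := ap ! t)\<rparr>"
      define s3 where "s3 = exec emit_point s2"
      have e2: "safe W emit_point s2" "reported s3 = reported s' @ [addr (G j) (ap ! t - st (G j)) z]"
      proof -
        have "has_input N s2" using rd(1) by (simp add: s1_def s2_def has_input_def)
        moreover have "laid s2"
          using rd(2) by (simp add: s1_def s2_def laid_def sizes_def recorded_def paths_done_def)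
        moreover have "nreg s2 ''k'' = st (G j) + (ap ! t - st (G j))" "rreg s2 ''z'' = z"
          using k1(1) same by (simp_all add: s1_def s2_def)
        ultimately show "safe W emit_point s2"
          "reported s3 = reported s' @ [addr (G j) (ap ! t - st (G j)) z]"
          using emit_point_exec[OF W _ _ Gp[OF g(1)] tl, of s2 z]
          by (simp_all add: s3_def) (simp add: s1_def s2_def)
      qed
      have fr3: "frame emit_point s2 s3" unfolding s3_def by (rule emit_point_frame)
      have s3: "nreg s3 ''t'' = t" "nreg s3 ''j'' = j" "nreg s3 ''q'' = q" "narr s3 ''bp'' = bp"
        "rreg s3 ''z'' = z" "rreg s3 ''M'' = M" "narr s3 ''off'' = off" "rarr s3 ''key'' = key"
        by (simp_all add: frame_nreg[OF fr3] frame_narr[OF fr3] frame_rreg[OF fr3] frame_rarr[OF fr3]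
            emit_point_def s1_def s2_def same rd(4) arr j)
      define int where "int \<longleftrightarrow> 0 < z \<and> z < M"
      define s4 where "s4 = (if G j = i then s1 else if int then s3 else s3\<lparr>nreg := (nreg s3)(''j'' := q)\<rparr>)"
      define s5 where "s5 = s4\<lparr>nreg := (nreg s4)(''t'' := bp ! t - 1, ''j'' := Suc (nreg s4 ''j''))\<rparr>"
      have s1': "nreg s1 ''t'' = t" "nreg s1 ''j'' = j" "nreg s1 ''q'' = q" "narr s1 ''bp'' = bp"
        "narr s1 ''off'' = off" "rarr s1 ''key'' = key" "narr s1 ''gp'' = narr s' ''gp''" "nreg s1 ''i'' = i"
        "narr s1 ''ap'' = ap"
        by (simp_all add: s1_def arr j rd(4) same)
      have s4: "nreg s4 ''t'' = t" "nreg s4 ''j'' = (if G j = i \<or> int then j else q)" "narr s4 ''bp'' = bp"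
        "narr s4 ''off'' = off" "rarr s4 ''key'' = key"
        by (simp_all add: s4_def s3 s1')
      define c1 where "c1 = Cond (RLess (RGet ''key'' (NReg ''t'')) (RReg ''z''))
          (NAssign ''t'' (NAdd (NReg ''t'') (NConst 1))) Skip"
      define c2 where "c2 = Cond (NEq (NGet ''gp'' (NReg ''j'')) (NReg ''i'')) Skip (block [
         NAssign ''k'' (NGet ''ap'' (NReg ''t'')),
         emit_point,
         Cond (BAnd (RLess (RConst 0) (RReg ''z'')) (RLess (RReg ''z'') (RReg ''M''))) Skip
           (NAssign ''j'' (NReg ''q''))])"
      have body: "report_body = block [c1, c2, NAssign ''t'' (NSub (NGet ''bp'' (NReg ''t'')) (NConst 1)),
          NAssign ''j'' (NAdd (NReg ''j'') (NConst 1))]"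
        by (simp only: report_body_def c1_def c2_def)
      have ex1: "exec c1 s' = s1"
      proof -
        have "s'\<lparr>nreg := (nreg s')(''t'' := t0)\<rparr> = s'"
          unfolding fun_upd_idem[of "nreg s'" "''t''", OF arr(6)] by simp
        then show ?thesis using t0(2) by (simp add: c1_def s1_def arr same)
      qed
      have sf1: "safe W c1 s'"
        using tW t0(1) W' by (simp add: c1_def arr same rd(8)[unfolded arr])
      have s2e: "exec (NAssign ''k'' (NGet ''ap'' (NReg ''t''))) s1 = s2"
        by (simp add: s2_def s1')
      have ex2: "exec c2 s1 = s4"
        using s3 s2e by (auto simp: c2_def s4_def s1' rd(6)[OF g(1)] s3_def[symmetric] int_def)
      have sf2: "safe W c2 s1"
        using s2e e2(1) gm W' tW apm tm g(1)
        by (simp add: c2_def s1' rd(5,6,9)[unfolded arr] rd(6)[OF g(1)] s3_def[symmetric] s3)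
      have ex: "exec report_body s' = s5"
        by (simp add: body ex1 ex2 s5_def s4)
      have "nreg s4 ''j'' \<le> q" using g(1) by (simp add: s4)
      then have sf: "safe W report_body s'"
        using sf1 sf2 tW bpW tm W' by (simp add: body ex1 ex2 s4 rd(10)[unfolded arr])
      have res: "result s5 (Suc c)"
      proof (cases "G j = i")
        case True
        then have "reported s5 = reported s'" by (simp add: s5_def s4_def s1_def)
        then show ?thesis using c(2,5) cj True by (simp add: result_def)
      next
        case False
        obtain out where out: "reported s' = reported s @ out" "set out \<subseteq> addresses N"
          "map (point_at N) out = map (\<lambda>r. pt (G r) z) (filter (\<lambda>r. G r \<noteq> i) [b..<c])"
          using c(5) by (auto simp: result_def)
        let ?A = "addr (G j) (ap ! t - st (G j)) z"
        have "reported s5 = reported s @ (out @ [?A])"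
          using False e2(2) out(1) by (simp add: s5_def s4_def)
        moreover have "?A \<in> addresses N" "point_at N ?A = pt (G j) z"
          using addr_in_addresses pt_cell Gp[OF g(1)] cell by blast+
        ultimately show ?thesis
          unfolding result_def using out False cj c(2) by (intro exI[of _ "out @ [?A]"]) simp
      qed
      have nxt: "nreg s5 ''t'' < 2 * m \<and> position s5 z (Suc c) (current s5)" if "Suc c < ?e"
      proof -
        have jq: "Suc j < q" using that cj e seg(2) by simp
        have "L (G (Suc j)) = M" using seg(3)[of "Suc j"] that c(2) cj e(2) by simp
        then have zz: "z \<le> P ! (st (G (Suc j)) + len (G (Suc j)) - 1)" using Pl(1)[OF jq] z by simp
        have lev': "level key ap bp P (off ! (Suc j + 2)) (off ! (j + 2)) (st (G (Suc j)))
            (st (G (Suc j)) + len (G (Suc j))) (off ! Suc j)" using lev[OF jq] by simp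
        note nx = level_next[OF lev[OF g(1)] lev' pos zz]
        have o: "off ! Suc j \<le> 2 * m" using rd(12)[OF jq] arr by simp
        have "current s5 = (if key ! (bp ! t - 1) < z then bp ! t else bp ! t - 1)"
          using nx(1) by (simp add: current_def s5_def s4)
        then show ?thesis
          using nx(2-6) o cj by (simp add: position_def s5_def s4)
      qed
      have "I (?e - Suc c) s5"
        unfolding I_def
      proof (intro exI[of _ "Suc c"] conjI)
        show "Suc c = nreg s5 ''j'' \<and> (0 < z \<and> z < M \<or> Suc c = b) \<or>
            \<not> (0 < z \<and> z < M) \<and> nreg s5 ''j'' = Suc q \<and> Suc c = Suc b"
        proof (cases int)
          case True
          then show ?thesis by (simp add: s5_def s4 cj int_def)
        next
          case False
          \<comment> \<open>At a terminal position the iteration at \<open>b\<close> is the one that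
            reports: \<open>G b\<close> differs from \<open>i\<close>, so it is not skipped and the
            exit is taken.\<close>
          then have "c = b" using c(1) cj g(1) by (auto simp: int_def j)
          with False seg(5) cj show ?thesis by (simp add: s5_def s4 int_def)
        qed
      qed (use c(2) ce res nxt in auto)
      moreover have "?e - Suc c < k" using c(4) ce by simp
      ultimately show "safe W report_body s' \<and> (\<exists>k'<k. I k' (exec report_body s'))"
        using ex sf by auto
    }
  qed
qed

end

section \<open>Composing timed statements along blocks\<close>

lemma runs_straight:
  "\<not> allocates c \<Longrightarrow> safe W c s \<Longrightarrow> runs W c s (max_time 0 c) (\<lambda>s'. s' = exec c s)"
  by (rule runs_exec) simp_all

lemma runs_block_Nil: "Q s \<Longrightarrow> runs W (block []) s 1 Q"
  by (simp add: runs_Skip)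

lemma runs_block_Cons:
  assumes "runs W c s T P" "\<And>s'. frame c s s' \<Longrightarrow> P s' \<Longrightarrow> runs W (block cs) s' T' Q"
  shows "runs W (block (c # cs)) s (1 + T + T') Q"
  unfolding block.simps by (rule runs_Seq[OF assms order_refl])

subsection \<open>The query program\<close>

definition locate_source :: prog where
  "locate_source = block [
     NAssign ''k'' (NGet ''idx'' (NReg ''edge'')),
     NAssign ''i'' (NGet ''pid'' (NReg ''edge'')),
     RAssign ''w'' (RGet ''weight'' (NReg ''edge'')),
     Cond (NEq (NGet ''src'' (NReg ''edge'')) (NGet ''vin'' (NReg ''k'')))
       (RAssign ''x'' (RAdd (RSub (RGet ''pos'' (NReg ''k'')) (RReg ''w'')) (RMul (RReg ''lambda'') (RReg ''w''))))
       (RAssign ''x'' (RSub (RGet ''pos'' (NReg ''k'')) (RMul (RReg ''lambda'') (RReg ''w'')))),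
     RAssign ''h'' (RGet ''len'' (NReg ''i''))]"

text \<open>With one path there is no other path to compare with, so the two ends are tested
  directly. They lie on the edges stored first and last, at \<open>0\<close> and
  \<open>m - 1\<close>.\<close>

definition single_prog :: prog where
  "single_prog = block [
     Cond (RLess (RAdd (RReg ''x'') (RReg ''x'')) (RReg ''h'')) Skip
       (block [NAssign ''k'' (NConst 0), RAssign ''z'' (RConst 0), emit_point]),
     Cond (RLess (RReg ''h'') (RAdd (RReg ''x'') (RReg ''x''))) Skip
       (block [NAssign ''k'' (NSub (NReg ''m'') (NConst 1)), RAssign ''z'' (RReg ''h''), emit_point])]"

text \<open>
  Afterwards \<open>U\<close> is the distance to the farthest point in the interior of the own path, at
  position \<open>y\<close> (and 0 if there is none), and \<open>V\<close> is the distance to the farthest points on the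
  other paths.
\<close>

definition prepare_prog :: prog where
  "prepare_prog = block [
     Cond (RLess (RReg ''x'') (RAdd (RSub (RReg ''h'') (RReg ''x'')) (RReg ''D'')))
       (RAssign ''du'' (RReg ''x''))
       (RAssign ''du'' (RAdd (RSub (RReg ''h'') (RReg ''x'')) (RReg ''D''))),
     Cond (RLess (RSub (RReg ''h'') (RReg ''x'')) (RAdd (RReg ''x'') (RReg ''D'')))
       (RAssign ''dv'' (RSub (RReg ''h'') (RReg ''x'')))
       (RAssign ''dv'' (RAdd (RReg ''x'') (RReg ''D''))),
     Cond (NEq (NReg ''i'') (NGet ''gp'' (NConst 0))) (NAssign ''s'' (NConst 1)) (NAssign ''s'' (NConst 0)),
     RAssign ''M'' (RGet ''len'' (NGet ''gp'' (NReg ''s''))),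
     RAssign ''V'' (RDiv (RAdd (RAdd (RReg ''du'') (RReg ''dv'')) (RReg ''M'')) (RConst 2)),
     RAssign ''U'' (RConst 0),
     RAssign ''c'' (RDiv (RAdd (RReg ''h'') (RReg ''D'')) (RConst 2)),
     Cond (RLess (RMul (RConst 2) (RReg ''x'')) (RSub (RReg ''h'') (RReg ''D'')))
       (block [RAssign ''U'' (RReg ''c''), RAssign ''y'' (RAdd (RReg ''x'') (RReg ''c''))])
       (Cond (RLess (RAdd (RReg ''h'') (RReg ''D'')) (RMul (RConst 2) (RReg ''x'')))
         (block [RAssign ''U'' (RReg ''c''), RAssign ''y'' (RSub (RReg ''x'') (RReg ''c''))]) Skip)]"

definition own_start :: prog where
  "own_start = block [
     NAssign ''lo'' (NGet ''st'' (NReg ''i'')),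
     NAssign ''hi'' (NSub (NGet ''en'' (NReg ''i'')) (NConst 1)),
     RAssign ''z'' (RReg ''y'')]"

text \<open>The position of the antipode is unrelated to the position \<open>z\<close> on the other
  paths, so it takes a binary search of its own, in the segment of \<open>pos\<close> that belongs
  to the path.\<close>

definition own_prog :: prog where
  "own_prog = block [own_start, search ''pos'', block [NAssign ''k'' (NReg ''lo''), emit_point]]"

definition other_start :: prog where
  "other_start = block [
     RAssign ''z'' (RDiv (RAdd (RSub (RReg ''dv'') (RReg ''du'')) (RReg ''M'')) (RConst 2)),
     NAssign ''lo'' (NGet ''off'' (NAdd (NReg ''s'') (NConst 1))),
     NAssign ''hi'' (NSub (NGet ''off'' (NReg ''s'')) (NConst 1))]"

definition other_prog :: prog where
  "other_prog = block [other_start, search ''key'',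
     block [NAssign ''t'' (NReg ''lo''), NAssign ''j'' (NReg ''s'')], report_loop]"

definition query_prog :: prog where
  "query_prog = block [locate_source,
     Cond (NEq (NReg ''p'') (NConst 1)) single_prog
       (block [prepare_prog,
          Cond (RLess (RReg ''U'') (RReg ''V'')) Skip own_prog,
          Cond (RLess (RReg ''V'') (RReg ''U'')) Skip other_prog])]"

lemmas query_defs = locate_source_def single_prog_def prepare_prog_def own_start_def own_prog_def
  other_start_def other_prog_def query_prog_def emit_point_def report_loop_def report_body_def
  search_def search_body_def

definition search_time :: "nat \<Rightarrow> nat" where
  "search_time k = loop_time (NLess (NReg ''lo'') (NReg ''hi'')) (search_body ''pos'') k"

lemma search_time_eq: "loop_time (NLess (NReg ''lo'') (NReg ''hi'')) (search_body a) k = search_time k"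
  by (simp add: search_time_def loop_time_def search_body_def)

context layout begin

lemma locate_source_exec:
  assumes W: "10 * n \<le> W" and rdy: "ready q G s" and a: "(e, l) \<in> addresses N"
    and reg: "nreg s ''edge'' = e" "rreg s ''lambda'' = l"
  obtains i x where "i < p" "0 \<le> x" "x \<le> L i" "point_at N (e, l) = pt i x" "safe W locate_source s"
    "nreg (exec locate_source s) ''i'' = i" "rreg (exec locate_source s) ''x'' = x"
    "rreg (exec locate_source s) ''h'' = L i"
proof -
  note rd = readyD[OF rdy]
  note ld = laidD[OF rd(2)]
  note inp = has_inputD[OF rd(1)]
  from address_cases[OF a] obtain j t y where y: "j < p" "cell j t y" "addr j t y = (e, l)"
    "y = pos j t + (if src N e = V j t then l else 1 - l) * weight N e" by metis
  have t: "t < len j" "e = E j t" using y by (auto simp: cell_def addr_def)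
  have b: "st j + t < m" "E j t < m" "V j t < n" "j < m"
    using flat_less[OF y(1) t(1)] E_bound[OF y(1) t(1)] V_vertex[of j t] y(1) t(1) p_le_m by auto
  have st: "src N (E j t) < n" using src_tgt_lt b by auto
  have bW: "st j + t \<le> W" "E j t \<le> W" "V j t \<le> W" "src N (E j t) \<le> W" "j \<le> W"
    using b st m_le_2n W by linarith+
  note f = ld(13,14,15,16,17)[OF y(1) t(1)]
  show ?thesis
  proof (rule that[of j y])
    show "j < p" "0 \<le> y" "y \<le> L j" using y(1) cell_bounds[OF y(1,2)] by auto
    show "point_at N (e, l) = pt j y" using pt_cell[OF y(1,2)] y(3) by simp
    show "safe W locate_source s"
      by (simp add: locate_source_def reg t(2) f b bW ld(3,4,5,8,9) inp)
    show "nreg (exec locate_source s) ''i'' = j"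
      by (simp add: locate_source_def reg t(2) f)
    show "rreg (exec locate_source s) ''x'' = y"
      using y(4) by (simp add: locate_source_def reg t(2) f b inp pos_Suc left_diff_distrib)
    show "rreg (exec locate_source s) ''h'' = L j"
      using ld(12)[OF y(1)] by (simp add: locate_source_def reg t(2) f)
  qed
qed

lemma emit_cell:
  assumes W: "10 * n \<le> W" and rdy: "ready q G s" and j: "j < p" and c: "cell j t z"
    and reg: "nreg s ''k'' = st j + t" "rreg s ''z'' = z"
  shows "safe W emit_point s" "\<exists>a \<in> addresses N. reported (exec emit_point s) = reported s @ [a] \<and>
    point_at N a = pt j z"
proof -
  note rd = readyD[OF rdy]
  have t: "t < len j" using c by (simp add: cell_def)
  note e = emit_point_exec[OF W rd(1,2) j t reg]
  show "safe W emit_point s" by (rule e(1))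
  show "\<exists>a \<in> addresses N. reported (exec emit_point s) = reported s @ [a] \<and> point_at N a = pt j z"
    using e(2) addr_in_addresses[OF j c] pt_cell[OF j c] by blast
qed

lemma single_prog_runs:
  assumes W: "10 * n \<le> W" and rdy: "ready q G s" and p: "p = 1" and x: "0 \<le> x" "x \<le> L 0"
    and reg: "rreg s ''x'' = x" "rreg s ''h'' = L 0" and rep: "reported s = []"
  shows "runs W single_prog s (max_time 0 single_prog)
    (\<lambda>s'. reports N (reported s') (farthest_points N (pt 0 x)))"
proof -
  have p0: "0 < p" using p by simp
  have len0: "0 < len 0" using len_pos p0 by blast
  have L0: "0 < L 0" using L_pos p0 by blast
  have c1: "cell 0 0 0" using len0 pos_mono[OF p0, of 0 "Suc 0"] by (simp add: cell_def)
  have c2: "cell 0 (len 0 - 1) (L 0)"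
    using len0 pos_le_L[OF p0, of "len 0 - 1"] by (simp add: cell_def L_def)
  have st: "st 0 + (len 0 - 1) = m - 1" using st_p p len0 by (simp add: st_def)
  have nW: "0 < W" using W n_ge_2 by simp
  let ?c1 = "Cond (RLess (RAdd (RReg ''x'') (RReg ''x'')) (RReg ''h'')) Skip
       (block [NAssign ''k'' (NConst 0), RAssign ''z'' (RConst 0), emit_point])"
  let ?c2 = "Cond (RLess (RReg ''h'') (RAdd (RReg ''x'') (RReg ''x''))) Skip
       (block [NAssign ''k'' (NSub (NReg ''m'') (NConst 1)), RAssign ''z'' (RReg ''h''), emit_point])"
  have 1: "runs W ?c1 s (max_time 0 ?c1) (\<lambda>s'. \<exists>out. reported s' = out \<and> set out \<subseteq> addresses N \<and>
      map (point_at N) out = (if L 0 \<le> 2 * x then [pt 0 0] else []))"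
  proof (rule runs_exec)
    define s1 where "s1 = s\<lparr>nreg := (nreg s)(''k'' := 0), rreg := (rreg s)(''z'' := 0)\<rparr>"
    have "frame (block [NAssign ''k'' (NConst 0), RAssign ''z'' (RConst 0)]) s s1"
      by (simp add: s1_def frame_def)
    then have rdy1: "ready q G s1"
      by (rule ready_frame[OF rdy]) (simp add: keeps_structure_def)
    have r1: "nreg s1 ''k'' = st 0 + 0" "rreg s1 ''z'' = 0" "reported s1 = []"
      using rep by (simp_all add: s1_def)
    note e = emit_cell[OF W rdy1 p0 c1 r1(1,2)]
    show "\<not> allocates ?c1" by (simp add: emit_point_def)
    show "safe W ?c1 s" using e(1) by (simp add: s1_def)
    show "\<exists>out. reported (exec ?c1 s) = out \<and> set out \<subseteq> addresses N \<and>
        map (point_at N) out = (if L 0 \<le> 2 * x then [pt 0 0] else [])"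
    proof (cases "L 0 \<le> 2 * x")
      case True
      with e(2) r1(3) obtain a where "a \<in> addresses N" "reported (exec emit_point s1) = [a]"
        "point_at N a = pt 0 0" by auto
      moreover have "exec ?c1 s = exec emit_point s1" using True reg by (simp add: s1_def)
      ultimately show ?thesis using True by simp
    next
      case False
      then show ?thesis using reg rep by simp
    qed
  qed simp
  have 2: "runs W ?c2 s' (max_time 0 ?c2) (\<lambda>s'. \<exists>out'. reported s' = out @ out' \<and> set out' \<subseteq> addresses N \<and>
      map (point_at N) out' = (if 2 * x \<le> L 0 then [pt 0 (L 0)] else []))"
    if fr: "frame ?c1 s s'" and out: "reported s' = out" for s' out
  proof (rule runs_exec)
    have rdy': "ready q G s'"
      by (rule ready_frame[OF rdy fr]) (simp add: keeps_structure_def emit_point_def)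
    have reg': "rreg s' ''x'' = x" "rreg s' ''h'' = L 0" "nreg s' ''m'' = m"
      using frame_rreg[OF fr] reg has_inputD(2)[OF readyD(1)[OF rdy']] by (simp_all add: emit_point_def)
    define s1 where "s1 = s'\<lparr>nreg := (nreg s')(''k'' := m - 1), rreg := (rreg s')(''z'' := L 0)\<rparr>"
    have "frame (block [NAssign ''k'' (NConst 0), RAssign ''z'' (RConst 0)]) s' s1"
      by (simp add: s1_def frame_def)
    then have rdy1: "ready q G s1"
      by (rule ready_frame[OF rdy']) (simp add: keeps_structure_def)
    have r1: "nreg s1 ''k'' = st 0 + (len 0 - 1)" "rreg s1 ''z'' = L 0" "reported s1 = out"
      using st out by (simp_all add: s1_def)
    note e = emit_cell[OF W rdy1 p0 c2 r1(1,2)]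
    show "\<not> allocates ?c2" by (simp add: emit_point_def)
    show "safe W ?c2 s'" using e(1) reg' W m_le_2n nW by (simp add: s1_def)
    show "\<exists>out'. reported (exec ?c2 s') = out @ out' \<and> set out' \<subseteq> addresses N \<and>
        map (point_at N) out' = (if 2 * x \<le> L 0 then [pt 0 (L 0)] else [])"
    proof (cases "2 * x \<le> L 0")
      case True
      with e(2) r1(3) obtain a where "a \<in> addresses N" "reported (exec emit_point s1) = out @ [a]"
        "point_at N a = pt 0 (L 0)" by auto
      moreover have "exec ?c2 s' = exec emit_point s1" using True reg' by (simp add: s1_def)
      ultimately show ?thesis using True by (intro exI[of _ "[a]"]) simp
    next
      case False
      then show ?thesis using reg' out by simp
    qed
  qed simp
  have ne: "pt 0 0 \<noteq> pt 0 (L 0)" using pt_eq_iff[OF p0 _ _ p0, of 0 "L 0"] L0 by simp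
  have "runs W (block [?c1, ?c2]) s (1 + max_time 0 ?c1 + (1 + max_time 0 ?c2 + 1))
    (\<lambda>s'. reports N (reported s') (farthest_points N (pt 0 x)))"
  proof (rule runs_block_Cons[OF 1], elim exE conjE, rule runs_block_Cons[OF 2],
      assumption, assumption, rule runs_block_Nil, elim exE conjE)
    fix s1 s2 out out'
    assume "reported s2 = out @ out'" "set out \<subseteq> addresses N" "set out' \<subseteq> addresses N"
      and m: "map (point_at N) out = (if L 0 \<le> 2 * x then [pt 0 0] else [])"
        "map (point_at N) out' = (if 2 * x \<le> L 0 then [pt 0 (L 0)] else [])"
    moreover have "map (point_at N) (out @ out') =
        (if L 0 \<le> 2 * x then [pt 0 0] else []) @ (if 2 * x \<le> L 0 then [pt 0 (L 0)] else [])"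
      by (simp only: map_append m)
    ultimately show "reports N (reported s2) (farthest_points N (pt 0 x))"
      unfolding reports_def farthest_single[OF p x] using ne by (simp del: map_append)
  qed
  then show ?thesis
    unfolding single_prog_def by (rule runs_weaken) simp_all
qed

lemma own_prog_runs:
  assumes W: "10 * n \<le> W" and rdy: "ready q G s" and i: "i < p" and y: "0 \<le> y" "y \<le> L i"
    and reg: "nreg s ''i'' = i" "rreg s ''y'' = y" and k: "2 * m < 2 ^ k"
  shows "runs W own_prog s (search_time k + 100)
    (\<lambda>s'. \<exists>a \<in> addresses N. reported s' = reported s @ [a] \<and> point_at N a = pt i y)"
proof -
  note rd = readyD[OF rdy]
  note ld = laidD[OF rd(2)]
  have len: "0 < len i" using len_pos i by blast
  have stm: "st i + len i \<le> m" "i < m" using st_bound[OF i, of "len i"] st_p i p_le_m by simp_all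
  have bW: "i \<le> W" "st i \<le> W" "st i + len i \<le> W" "Suc 0 \<le> W" using stm W m_le_2n n_ge_2 by linarith+
  let ?h = "st i + len i - 1"
  have hS: "Suc ?h = st i + len i" using len by simp
  define P where "P = rarr s ''pos''"
  have P: "asc P (st i) (Suc ?h)" "P ! ?h = L i" "length P = m"
    using pos_asc[OF rd(2) i] pos_last[OF rd(2) i] ld(8) hS unfolding P_def by simp_all
  have s0: "runs W own_start s (max_time 0 own_start) (\<lambda>s'. s' = exec own_start s)"
    by (rule runs_straight)
      (simp_all add: own_start_def reg ld(6,7) ld(10,11)[OF i] stm bW)
  have "runs W own_prog s (1 + max_time 0 own_start + (1 + search_time k +
      (1 + max_time 0 (block [NAssign ''k'' (NReg ''lo''), emit_point]) + 1)))
    (\<lambda>s'. \<exists>a \<in> addresses N. reported s' = reported s @ [a] \<and> point_at N a = pt i y)"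
    unfolding own_prog_def
  proof (rule runs_block_Cons[OF s0])
    fix s1 assume fr1: "frame own_start s s1" and s1: "s1 = exec own_start s"
    have r1: "rarr s1 ''pos'' = P" "rreg s1 ''z'' = y" "nreg s1 ''lo'' = st i" "nreg s1 ''hi'' = ?h"
      "reported s1 = reported s"
      by (simp_all add: s1 own_start_def P_def reg ld(10,11)[OF i])
    have rdy1: "ready q G s1"
      by (rule ready_frame[OF rdy fr1]) (simp add: keeps_structure_def own_start_def)
    have se: "runs W (search ''pos'') s1 (search_time k)
      (\<lambda>s'. st i \<le> nreg s' ''lo'' \<and> nreg s' ''lo'' \<le> ?h \<and> y \<le> P ! nreg s' ''lo'' \<and>
        (st i < nreg s' ''lo'' \<longrightarrow> P ! (nreg s' ''lo'' - 1) < y))"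
      unfolding search_time_eq[symmetric, of k "''pos''"]
    proof (rule search_runs[OF r1(1) P(1) _ _ r1(2) _ r1(3,4)])
      show "?h < length P" "st i \<le> ?h" "2 * ?h + 2 \<le> W" "?h - st i < 2 ^ k"
        using P(3) stm len W m_le_2n n_ge_2 k by linarith+
      show "y \<le> P ! ?h" using P(2) y by simp
    qed
    show "runs W (block [search ''pos'', block [NAssign ''k'' (NReg ''lo''), emit_point]]) s1
      (1 + search_time k + (1 + max_time 0 (block [NAssign ''k'' (NReg ''lo''), emit_point]) + 1))
      (\<lambda>s'. \<exists>a \<in> addresses N. reported s' = reported s @ [a] \<and> point_at N a = pt i y)"
    proof (rule runs_block_Cons[OF se])
      fix s2 assume fr2: "frame (search ''pos'') s1 s2"
        and s2: "st i \<le> nreg s2 ''lo'' \<and> nreg s2 ''lo'' \<le> ?h \<and> y \<le> P ! nreg s2 ''lo'' \<and>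
          (st i < nreg s2 ''lo'' \<longrightarrow> P ! (nreg s2 ''lo'' - 1) < y)"
      have rdy2: "ready q G s2"
        by (rule ready_frame[OF rdy1 fr2]) (simp add: keeps_structure_def search_def search_body_def)
      have r2: "rreg s2 ''z'' = y" "reported s2 = reported s" "rarr s2 ''pos'' = P"
        using frame_rreg[OF fr2] frame_reported[OF fr2] frame_rarr[OF fr2] r1
        by (simp_all add: search_def search_body_def)
      define s3 where "s3 = s2\<lparr>nreg := (nreg s2)(''k'' := nreg s2 ''lo'')\<rparr>"
      have "frame (NAssign ''k'' (NReg ''lo'')) s2 s3" by (simp add: s3_def frame_def)
      then have rdy3: "ready q G s3" by (rule ready_frame[OF rdy2]) (simp add: keeps_structure_def)
      have cell: "cell i (nreg s2 ''lo'' - st i) y"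
        by (rule flat_cell[OF readyD(2)[OF rdy2] i]) (use s2 y hS r2 in auto)
      have r3: "nreg s3 ''k'' = st i + (nreg s2 ''lo'' - st i)" "rreg s3 ''z'' = y"
        using s2 r2 by (simp_all add: s3_def)
      note e = emit_cell[OF W rdy3 i cell r3]
      have loW: "nreg s2 ''lo'' \<le> W" using s2 hS bW by linarith
      have ex: "runs W (block [NAssign ''k'' (NReg ''lo''), emit_point]) s2
          (max_time 0 (block [NAssign ''k'' (NReg ''lo''), emit_point]))
          (\<lambda>s'. \<exists>a \<in> addresses N. reported s' = reported s @ [a] \<and> point_at N a = pt i y)"
      proof (rule runs_exec)
        show "\<not> allocates (block [NAssign ''k'' (NReg ''lo''), emit_point])" by (simp add: emit_point_def)
        show "safe W (block [NAssign ''k'' (NReg ''lo''), emit_point]) s2"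
          using e(1) loW by (simp add: s3_def)
        show "\<exists>a \<in> addresses N. reported (exec (block [NAssign ''k'' (NReg ''lo''), emit_point]) s2) =
            reported s @ [a] \<and> point_at N a = pt i y"
          using e(2) r2(2) by (simp add: s3_def)
      qed simp
      show "runs W (block [block [NAssign ''k'' (NReg ''lo''), emit_point]]) s2
        (1 + max_time 0 (block [NAssign ''k'' (NReg ''lo''), emit_point]) + 1)
        (\<lambda>s'. \<exists>a \<in> addresses N. reported s' = reported s @ [a] \<and> point_at N a = pt i y)"
        by (rule runs_block_Cons[OF ex], rule runs_block_Nil)
    qed
  qed
  then show ?thesis
    by (rule runs_weaken) (simp_all add: own_start_def emit_point_def)
qed

lemma other_prog_runs:
  assumes W: "10 * n \<le> W" and rdy: "ready q G s"
    and seg: "b < e" "e \<le> q" "\<And>r. b \<le> r \<Longrightarrow> r < e \<Longrightarrow> L (G r) = M" "e < q \<Longrightarrow> L (G e) < M" "G b \<noteq> i" "i < p"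
    and z: "0 \<le> z" "z \<le> M" "z = (dv i x - du i x + M) / 2"
    and regs: "nreg s ''i'' = i" "nreg s ''s'' = b" "rreg s ''M'' = M" "rreg s ''du'' = du i x"
      "rreg s ''dv'' = dv i x"
    and k: "2 * m < 2 ^ k"
  shows "runs W other_prog s (search_time k + loop_time report_guard report_body (stop z M b e - b) + 100)
    (\<lambda>s'. \<exists>out. reported s' = reported s @ out \<and> set out \<subseteq> addresses N \<and>
      map (point_at N) out = map (\<lambda>r. pt (G r) z) (filter (\<lambda>r. G r \<noteq> i) [b..<stop z M b e]))"
    (is "runs W other_prog s ?T ?Q")
proof -
  note rd = readyD[OF rdy]
  have bq: "b < q" using seg by simp
  have Gb: "G b < p" "L (G b) = M" using rd(7) bq seg(1,3) by (auto simp: grouped_def)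
  have qm: "q \<le> m" using grouped_le[OF rd(7)] p_le_m by simp
  define key where "key = rarr s ''key''"
  define off where "off = narr s ''off''"
  define h where "h = off ! b - 1"
  have lev: "level key (narr s ''ap'') (narr s ''bp'') (rarr s ''pos'') (off ! (b + 2)) (off ! Suc b)
      (st (G b)) (st (G b) + len (G b)) (off ! b)"
    using rd(13)[OF bq] by (simp add: key_def off_def)
  have o: "off ! Suc b < off ! b" "off ! b \<le> 2 * m"
    using lev rd(12)[OF bq] by (simp_all add: level_def off_def)
  have hS: "Suc h = off ! b" using o(1) by (simp add: h_def)
  have key: "asc key (off ! Suc b) (Suc h)" "z \<le> key ! h" "length key = 2 * m"
    using lev pos_last[OF rd(2) Gb(1)] Gb(2) z(2) rd(8) by (simp_all add: level_def hS h_def key_def)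
  have bW: "b \<le> W" "Suc b \<le> W" "off ! Suc b \<le> W" "off ! b \<le> W" "Suc 0 \<le> W"
    using bq qm o W m_le_2n n_ge_2 by linarith+
  let ?r = "block [NAssign ''t'' (NReg ''lo''), NAssign ''j'' (NReg ''s'')]"
  have s0: "runs W other_start s (max_time 0 other_start) (\<lambda>s'. s' = exec other_start s)"
    by (rule runs_straight)
      (use bq qm rd(11) in \<open>simp_all add: other_start_def regs bW off_def[symmetric]\<close>)
  have "runs W other_prog s (1 + max_time 0 other_start + (1 + search_time k + (1 + max_time 0 ?r +
      (1 + loop_time report_guard report_body (stop z M b e - b) + 1)))) ?Q"
    unfolding other_prog_def
  proof (rule runs_block_Cons[OF s0])
    fix s1 assume fr1: "frame other_start s s1" and s1: "s1 = exec other_start s"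
    have r1: "rarr s1 ''key'' = key" "rreg s1 ''z'' = z" "nreg s1 ''lo'' = off ! Suc b" "nreg s1 ''hi'' = h"
      "reported s1 = reported s" "nreg s1 ''s'' = b" "nreg s1 ''i'' = i" "rreg s1 ''M'' = M"
      "narr s1 ''off'' = off"
      by (simp_all add: s1 other_start_def key_def off_def h_def regs z(3))
    have rdy1: "ready q G s1"
      by (rule ready_frame[OF rdy fr1]) (simp add: keeps_structure_def other_start_def)
    have se: "runs W (search ''key'') s1 (search_time k)
      (\<lambda>s'. off ! Suc b \<le> nreg s' ''lo'' \<and> nreg s' ''lo'' \<le> h \<and> z \<le> key ! nreg s' ''lo'' \<and>
        (off ! Suc b < nreg s' ''lo'' \<longrightarrow> key ! (nreg s' ''lo'' - 1) < z))"
      unfolding search_time_eq[symmetric, of k "''key''"]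
    proof (rule search_runs[OF r1(1) key(1) _ _ r1(2) key(2) r1(3,4)])
      show "h < length key" "off ! Suc b \<le> h" "2 * h + 2 \<le> W" "h - off ! Suc b < 2 ^ k"
        using key(3) o hS W m_le_2n n_ge_2 k by linarith+
    qed
    show "runs W (block [search ''key'', ?r, report_loop]) s1 (1 + search_time k + (1 + max_time 0 ?r +
        (1 + loop_time report_guard report_body (stop z M b e - b) + 1))) ?Q"
    proof (rule runs_block_Cons[OF se])
      fix s2 assume fr2: "frame (search ''key'') s1 s2"
        and s2: "off ! Suc b \<le> nreg s2 ''lo'' \<and> nreg s2 ''lo'' \<le> h \<and> z \<le> key ! nreg s2 ''lo'' \<and>
          (off ! Suc b < nreg s2 ''lo'' \<longrightarrow> key ! (nreg s2 ''lo'' - 1) < z)"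
      have rdy2: "ready q G s2"
        by (rule ready_frame[OF rdy1 fr2]) (simp add: keeps_structure_def search_def search_body_def)
      have r2: "rreg s2 ''z'' = z" "reported s2 = reported s" "rarr s2 ''key'' = key" "nreg s2 ''s'' = b"
        "nreg s2 ''i'' = i" "rreg s2 ''M'' = M" "narr s2 ''off'' = off"
        using frame_rreg[OF fr2] frame_nreg[OF fr2] frame_reported[OF fr2] frame_rarr[OF fr2]
          frame_narr[OF fr2] r1
        by (simp_all add: search_def search_body_def)
      have loW: "nreg s2 ''lo'' \<le> W" using s2 hS bW by linarith
      have ex: "runs W ?r s2 (max_time 0 ?r) (\<lambda>s'. s' = exec ?r s2)"
        by (rule runs_straight) (simp_all add: r2 loW bW)
      show "runs W (block [?r, report_loop]) s2 (1 + max_time 0 ?r +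
          (1 + loop_time report_guard report_body (stop z M b e - b) + 1)) ?Q"
      proof (rule runs_block_Cons[OF ex])
        fix s3 assume fr3: "frame ?r s2 s3" and s3: "s3 = exec ?r s2"
        have rdy3: "ready q G s3"
          by (rule ready_frame[OF rdy2 fr3]) (simp add: keeps_structure_def)
        have r3: "nreg s3 ''i'' = i" "nreg s3 ''j'' = b" "rreg s3 ''z'' = z" "rreg s3 ''M'' = M"
          "position s3 z b (nreg s3 ''t'')" "reported s3 = reported s"
          using s2 hS by (simp_all add: s3 r2 position_def less_Suc_eq_le)
        have "runs W report_loop s3 (loop_time report_guard report_body (stop z M b e - b)) ?Q"
          using report_loop_runs[OF W rdy3 seg z(1,2) r3(1-5)] r3(6) by simp
        then show "runs W (block [report_loop]) s3
            (1 + loop_time report_guard report_body (stop z M b e - b) + 1) ?Q"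
          by (rule runs_block_Cons) (rule runs_block_Nil)
      qed
    qed
  qed
  then show ?thesis
    by (rule runs_weaken) (simp_all add: other_start_def)
qed

end

section \<open>Candidate paths of a query and the number of iterations\<close>

context layout begin

text \<open>If the query point lies on \<open>G 0\<close>, the candidates are the tail of the array;
  otherwise they start with \<open>G 0\<close> and include the tail exactly if its length is the
  same. Path \<open>i\<close> may occur among them, but never in the first place, so at least one
  candidate remains.\<close>

lemma group_segment:
  assumes G: "grouped q G" and i: "i < p" and p2: "2 \<le> p"
  defines "b \<equiv> if i = G 0 then 1 else 0"
  defines "M \<equiv> L (G b)"
  defines "e \<equiv> if b = 1 \<or> 1 < q \<and> L (G 1) = M then q else 1"
  shows "b < e" "e \<le> q" "\<And>r. b \<le> r \<Longrightarrow> r < e \<Longrightarrow> L (G r) = M" "e < q \<Longrightarrow> L (G e) < M" "G b \<noteq> i"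
    "\<And>j. j < p \<Longrightarrow> j \<noteq> i \<Longrightarrow> L j \<le> M"
    "{j. j < p \<and> j \<noteq> i \<and> L j = M} = G ` {r. b \<le> r \<and> r < e \<and> G r \<noteq> i}"
proof -
  have g: "1 \<le> q" "\<And>r. r < q \<Longrightarrow> G r < p" "inj_on G {..<q}" "\<And>j. j < p \<Longrightarrow> L j \<le> L (G 0)"
    "\<And>r j. 1 \<le> r \<Longrightarrow> r < q \<Longrightarrow> j < p \<Longrightarrow> j \<noteq> G 0 \<Longrightarrow> L j \<le> L (G r)"
    "\<And>j. j < p \<Longrightarrow> j \<noteq> G 0 \<Longrightarrow> (\<forall>i < p. i \<noteq> G 0 \<longrightarrow> L i \<le> L j) \<Longrightarrow> \<exists>r. 1 \<le> r \<and> r < q \<and> G r = j"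
    using G unfolding grouped_def by blast+
  have G_inj: "G r = G r' \<Longrightarrow> r < q \<Longrightarrow> r' < q \<Longrightarrow> r = r'" for r r'
    using g(3) by (simp add: inj_on_def)
  \<comment> \<open>As there are at least two paths, a longest one among those other than
    \<open>G 0\<close> exists; it is listed in the array, so the tail is not empty.\<close>
  let ?R = "{..<p} - {G 0}"
  have "?R \<noteq> {}"
  proof
    assume "?R = {}"
    then have "{..<p} \<subseteq> {G 0}" by blast
    from card_mono[OF _ this] p2 show False by simp
  qed
  then have "Max (L ` ?R) \<in> L ` ?R" by (intro Max_in) auto
  then obtain j0 where j0: "Max (L ` ?R) = L j0" "j0 \<in> ?R" by (rule imageE)
  have "L i' \<le> L j0" if "i' < p" "i' \<noteq> G 0" for i'
    using Max_ge[of "L ` ?R" "L i'"] that j0(1) by simp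
  with j0 have "j0 < p" "j0 \<noteq> G 0" "\<forall>i < p. i \<noteq> G 0 \<longrightarrow> L i \<le> L j0" by simp_all
  with g(6) obtain r0 where "1 \<le> r0" "r0 < q" by blast
  then have q2: "1 < q" by simp
  have G1: "G 1 \<noteq> G 0" "G 1 < p" using G_inj[of 1 0] g(2) q2 by auto
  have same: "L (G r) = L (G 1)" if "1 \<le> r" "r < q" for r
  proof (rule order_antisym)
    have "G r \<noteq> G 0" using G_inj[of r 0] that by auto
    then show "L (G r) \<le> L (G 1)" using g(5)[of 1 "G r"] g(2)[OF that(2)] q2 by simp
    show "L (G 1) \<le> L (G r)" using g(5)[of r "G 1"] that G1 by simp
  qed
  have b: "b = 1 \<and> i = G 0 \<or> b = 0 \<and> i \<noteq> G 0" by (simp add: b_def)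
  show "b < e" "e \<le> q" using b q2 by (auto simp: e_def)
  show seg: "L (G r) = M" if "b \<le> r" "r < e" for r
    using b
  proof
    assume "b = 1 \<and> i = G 0"
    then show ?thesis using same[of r] that q2 by (simp add: M_def e_def)
  next
    assume b0: "b = 0 \<and> i \<noteq> G 0"
    show ?thesis
    proof (cases "r = 0")
      case False
      then have "e = q" "L (G 1) = M" using that b0 by (auto simp: e_def split: if_splits)
      then show ?thesis using same[of r] that False by simp
    qed (use b0 in \<open>simp add: M_def\<close>)
  qed
  show "L (G e) < M" if "e < q"
  proof -
    have "e = 1" "L (G 1) \<noteq> M" "b = 0" using that q2 b by (auto simp: e_def split: if_splits)
    then show ?thesis using g(4)[OF G1(2)] by (simp add: M_def)
  qed
  show "G b \<noteq> i" using b G1 by auto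
  show M: "L j \<le> M" if "j < p" "j \<noteq> i" for j
    using b that g(4)[of j] g(5)[of 1 j] q2 by (auto simp: M_def)
  show "{j. j < p \<and> j \<noteq> i \<and> L j = M} = G ` {r. b \<le> r \<and> r < e \<and> G r \<noteq> i}"
  proof (intro equalityI subsetI)
    fix j assume "j \<in> {j. j < p \<and> j \<noteq> i \<and> L j = M}"
    then have j: "j < p" "j \<noteq> i" "L j = M" by auto
    have "\<exists>r. b \<le> r \<and> r < e \<and> G r = j"
    proof (cases "j = G 0")
      case True
      then show ?thesis using b j \<open>b < e\<close> by (intro exI[of _ 0]) auto
    next
      case False
      have "L i' \<le> L j" if "i' < p" "i' \<noteq> G 0" for i'
        using M[OF that(1)] j(3) b that g(4)[OF that(1)] by (cases "b = 1") (auto simp: M_def)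
      with g(6)[OF j(1) False] obtain r where r: "1 \<le> r" "r < q" "G r = j" by blast
      then have "L (G 1) = M" using same[of r] j(3) by simp
      then have "e = q" using q2 by (simp add: e_def)
      then show ?thesis using r b by (intro exI[of _ r]) auto
    qed
    then show "j \<in> G ` {r. b \<le> r \<and> r < e \<and> G r \<noteq> i}" using j(2) by blast
  next
    fix j assume "j \<in> G ` {r. b \<le> r \<and> r < e \<and> G r \<noteq> i}"
    then obtain r where "b \<le> r" "r < e" "G r \<noteq> i" "j = G r" by blast
    then show "j \<in> {j. j < p \<and> j \<noteq> i \<and> L j = M}" using seg[of r] g(2)[of r] \<open>e \<le> q\<close> by auto
  qed
qed

text \<open>Strictly between the terminals, different paths give different points, and of all
  iterations only the one at path \<open>i\<close> reports nothing; there is at most one, since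
  \<open>G\<close> is injective. At a terminal all candidates are one point and \<open>stop\<close>
  admits one iteration. This converts iterations into reported points.\<close>

lemma other_points:
  assumes G: "grouped q G" and be: "b < e" "e \<le> q" "G b \<noteq> i" and i: "i < p"
    and M: "\<And>r. b \<le> r \<Longrightarrow> r < e \<Longrightarrow> L (G r) = M"
    and set: "{j. j < p \<and> j \<noteq> i \<and> L j = M} = G ` {r. b \<le> r \<and> r < e \<and> G r \<noteq> i}"
    and z: "0 \<le> z" "z \<le> M"
  defines "ps \<equiv> map (\<lambda>r. pt (G r) z) (filter (\<lambda>r. G r \<noteq> i) [b..<stop z M b e])"
  shows "set ps = {pt j z | j. j < p \<and> j \<noteq> i \<and> L j = M}" "distinct ps" "stop z M b e - b \<le> Suc (length ps)"
proof -
  have Gp: "G r < p" if "r < e" for r using G that be by (simp add: grouped_def)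
  have G_inj: "G r = G r' \<Longrightarrow> r < e \<Longrightarrow> r' < e \<Longrightarrow> r = r'" for r r'
    using G be(2) by (auto simp: grouped_def inj_on_def)
  have all: "{pt j z | j. j < p \<and> j \<noteq> i \<and> L j = M} = (\<lambda>r. pt (G r) z) ` {r. b \<le> r \<and> r < e \<and> G r \<noteq> i}"
  proof -
    have "{pt j z | j. j < p \<and> j \<noteq> i \<and> L j = M} = (\<lambda>j. pt j z) ` {j. j < p \<and> j \<noteq> i \<and> L j = M}" by blast
    then show ?thesis unfolding set by (simp add: image_image)
  qed
  have Mpos: "0 < M" using M[of b] L_pos[OF Gp[OF be(1)]] be(1) by simp
  have eq: "pt (G r) z = pt (G r') z \<longleftrightarrow> r = r' \<or> \<not> (0 < z \<and> z < M)"
    if "b \<le> r" "r < e" "b \<le> r'" "r' < e" for r r'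
    using pt_eq_iff[of "G r" z "G r'" z] Gp that z M[of r] M[of r'] G_inj[of r r'] by auto
  have "set ps = {pt j z | j. j < p \<and> j \<noteq> i \<and> L j = M} \<and> distinct ps \<and> stop z M b e - b \<le> Suc (length ps)"
  proof (cases "0 < z \<and> z < M")
    case True
    then have st: "stop z M b e = e" by (simp add: stop_def)
    have "set ps = {pt j z | j. j < p \<and> j \<noteq> i \<and> L j = M}"
      unfolding all ps_def st by auto
    moreover have "distinct ps"
      unfolding ps_def st distinct_map using eq True by (auto intro!: inj_onI)
    moreover have "e - b \<le> Suc (length ps)"
    proof -
      have "length (filter (\<lambda>r. \<not> G r \<noteq> i) [b..<e]) \<le> 1"
      proof -
        have "length (filter (\<lambda>r. \<not> G r \<noteq> i) [b..<e]) = card {r. b \<le> r \<and> r < e \<and> G r = i}"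
          by (subst distinct_card[symmetric]) (auto intro: arg_cong[where f = card])
        also have "\<dots> \<le> 1"
          using G_inj by (subst One_nat_def, subst card_le_Suc0_iff_eq) auto
        finally show ?thesis .
      qed
      then show ?thesis
        using sum_length_filter_compl[of "\<lambda>r. G r \<noteq> i" "[b..<e]"] unfolding ps_def st length_map length_upt
        by linarith
    qed
    ultimately show ?thesis using st by simp
  next
    case False
    then have st: "stop z M b e = Suc b" by (simp only: stop_def if_False)
    have ps: "ps = [pt (G b) z]" using be(3) by (simp add: ps_def st)
    have "pt (G r) z = pt (G b) z" if "b \<le> r" "r < e" for r
      using eq[of r b] that be(1) False by simp
    moreover have "b \<in> {r. b \<le> r \<and> r < e \<and> G r \<noteq> i}" using be(1,3) by simp
    ultimately have "(\<lambda>r. pt (G r) z) ` {r. b \<le> r \<and> r < e \<and> G r \<noteq> i} = {pt (G b) z}" by blast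
    then show ?thesis unfolding all ps st by simp
  qed
  then show "set ps = {pt j z | j. j < p \<and> j \<noteq> i \<and> L j = M}" "distinct ps"
    "stop z M b e - b \<le> Suc (length ps)" by blast+
qed

lemma state_if:
  "nreg (if b then s else t) x = (if b then nreg s x else nreg t x)"
  "rreg (if b then s else t) x = (if b then rreg s x else rreg t x)"
  "narr (if b then s else t) x = (if b then narr s x else narr t x)"
  "rarr (if b then s else t) x = (if b then rarr s x else rarr t x)"
  "reported (if b then s else t) = (if b then reported s else reported t)"
  by simp_all

definition parallel_prog :: prog where
  "parallel_prog = block [prepare_prog,
     Cond (RLess (RReg ''U'') (RReg ''V'')) Skip own_prog,
     Cond (RLess (RReg ''V'') (RReg ''U'')) Skip other_prog]"

text \<open>Two binary searches, at most one iteration per reported point, and one more for skipping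
  the path of the query point; the constant covers the straight-line parts.\<close>

definition parallel_time :: "nat \<Rightarrow> nat \<Rightarrow> nat" where
  "parallel_time k c = 2 * search_time k + loop_time report_guard report_body (Suc c) + 400"

lemma parallel_prog_runs:
  assumes W: "10 * n \<le> W" and rdy: "ready q G s" and p2: "2 \<le> p" and i: "i < p" "0 \<le> x" "x \<le> L i"
    and reg: "nreg s ''i'' = i" "rreg s ''x'' = x" "rreg s ''h'' = L i" and rep: "reported s = []"
    and k: "2 * m < 2 ^ k"
  shows "runs W parallel_prog s (parallel_time k (card (farthest_points N (pt i x))))
    (\<lambda>s'. reports N (reported s') (farthest_points N (pt i x)))"
proof -
  note rd = readyD[OF rdy]
  note ld = laidD[OF rd(2)]
  define b where "b = (if i = G 0 then 1 else 0 :: nat)"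
  define M where "M = L (G b)"
  define e where "e = (if b = 1 \<or> 1 < q \<and> L (G 1) = M then q else 1)"
  note seg = group_segment[OF rd(7) i(1) p2, folded b_def, folded M_def, folded e_def]
  have bq: "b < q" using seg(1,2) by simp
  have q0: "0 < q" using bq by simp
  have Gb: "G b < p" using rd(7) bq by (simp add: grouped_def)
  have G0: "G 0 < p" using rd(7) q0 by (simp add: grouped_def)
  define z where "z = (dv i x - du i x + M) / 2"
  define Vv where "Vv = (du i x + dv i x + M) / 2"
  define c where "c = (L i + D) / 2"
  have DM: "D \<le> M" using D_le[OF Gb] by (simp add: M_def)
  have z: "0 \<le> z" "z \<le> M" using other_position[OF i DM] by (simp_all add: z_def)
  have far: "farthest_points N (pt i x) =
    (if own i x \<and> Vv \<le> c then {pt i (antipode i x)} else {}) \<union>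
    (if own i x \<and> Vv < c then {} else {pt j z | j. j < p \<and> j \<noteq> i \<and> L j = M})"
    using farthest_parallel[OF i seg(6) Gb seg(5) M_def[symmetric]] unfolding z_def Vv_def c_def .
  define others where "others = map (\<lambda>r. pt (G r) z) (filter (\<lambda>r. G r \<noteq> i) [b..<stop z M b e])"
  note op = other_points[OF rd(7) seg(1,2,5) i(1) seg(3,7) z, folded others_def]
  define owns where "owns = (if own i x \<and> Vv \<le> c then [pt i (antipode i x)] else [])"
  define result where "result = owns @ (if own i x \<and> Vv < c then [] else others)"
  have result: "set result = farthest_points N (pt i x)"
    unfolding far result_def owns_def using op(1) by auto
  \<comment> \<open>The antipode is an inner point of path \<open>i\<close>, so it differs from
    every point reported on another path.\<close>
  have distinct: "distinct result"
  proof -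
    have "pt i (antipode i x) \<notin> {pt j z | j. j < p \<and> j \<noteq> i \<and> L j = M}" if "own i x"
    proof
      assume "pt i (antipode i x) \<in> {pt j z | j. j < p \<and> j \<noteq> i \<and> L j = M}"
      then obtain j where "j < p" "j \<noteq> i" "L j = M" "pt i (antipode i x) = pt j z" by blast
      then show False
        using pt_eq_iff[of i "antipode i x" j z] own_dist(1,2)[OF i that] z i by simp
    qed
    then show ?thesis
      using op(1,2) by (cases "own i x \<and> Vv \<le> c") (auto simp: result_def owns_def)
  qed
  have card: "card (farthest_points N (pt i x)) = length result"
    using distinct_card[OF distinct] result by simp
  have Mpos: "0 < M" using L_pos[OF Gb] by (simp add: M_def)
  have duv: "0 \<le> du i x" "0 \<le> dv i x" using i D_pos by (simp_all add: du_def dv_def)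
  \<comment> \<open>The value 0 of register \<open>U\<close> stands for a missing antipode. As
    \<open>Vv\<close> is positive, the two comparisons then skip \<open>own_prog\<close> and run
    \<open>other_prog\<close>.\<close>
  have Vpos: "0 < Vv" using Mpos duv by (simp add: Vv_def)
  have bW: "i \<le> W" "b \<le> W" "G 0 \<le> W" "G b \<le> W" "Suc 0 \<le> W" "G b < m" "b < Suc m" "0 < Suc m"
    using i(1) Gb G0 bq grouped_le[OF rd(7)] p_le_m W p_le_n n_ge_2 by linarith+
  have gp: "narr s ''gp'' ! 0 = G 0" "narr s ''gp'' ! b = G b"
    using rd(6) bq q0 by blast+
  have gp_ne: "narr s ''gp'' \<noteq> []" using rd(5) by auto
  have s0: "runs W prepare_prog s (max_time 0 prepare_prog) (\<lambda>s'. s' = exec prepare_prog s)"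
  proof (rule runs_straight)
    show "\<not> allocates prepare_prog" by (simp add: prepare_prog_def)
    have gpb: "length (narr s ''gp'') = Suc m" "length (rarr s ''len'') = m" using rd(5) ld(9) by auto
    show "safe W prepare_prog s"
    proof (cases "i = G 0")
      case True
      then have b1: "b = 1" by (simp add: b_def)
      show ?thesis
        by (simp add: prepare_prog_def reg rd(3) gpb gp[unfolded b1, simplified] gp_ne True
            bW[unfolded b1, simplified] state_if cong: if_cong split del: if_split)
    next
      case False
      then have b0: "b = 0" by (simp add: b_def)
      show ?thesis
        by (simp add: prepare_prog_def reg rd(3) gpb gp(1) gp_ne False bW[unfolded b0, simplified]
            state_if cong: if_cong split del: if_split)
    qed
  qed
  let ?own = "Cond (RLess (RReg ''U'') (RReg ''V'')) Skip own_prog"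
  let ?other = "Cond (RLess (RReg ''V'') (RReg ''U'')) Skip other_prog"
  have T: "1 + max_time 0 prepare_prog + (1 + (4 + (search_time k + 100)) +
      (1 + (4 + (search_time k + loop_time report_guard report_body (Suc (length result)) + 100)) + 1))
      \<le> parallel_time k (card (farthest_points N (pt i x)))"
    unfolding card by (simp add: parallel_time_def prepare_prog_def)
  have "runs W parallel_prog s (1 + max_time 0 prepare_prog + (1 + (4 + (search_time k + 100)) +
      (1 + (4 + (search_time k + loop_time report_guard report_body (Suc (length result)) + 100)) + 1)))
    (\<lambda>s'. reports N (reported s') (farthest_points N (pt i x)))"
    unfolding parallel_prog_def
  proof (rule runs_block_Cons[OF s0])
    fix s1 assume fr1: "frame prepare_prog s s1" and s1: "s1 = exec prepare_prog s"
    have rdy1: "ready q G s1"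
      by (rule ready_frame[OF rdy fr1]) (simp add: keeps_structure_def prepare_prog_def)
    have r1: "nreg s1 ''i'' = i" "nreg s1 ''s'' = b" "rreg s1 ''M'' = M" "rreg s1 ''du'' = du i x"
      "rreg s1 ''dv'' = dv i x" "rreg s1 ''V'' = Vv" "reported s1 = []"
      "rreg s1 ''U'' = (if own i x then c else 0)" "own i x \<Longrightarrow> rreg s1 ''y'' = antipode i x"
    proof -
      have b': "(if i = G 0 then Suc 0 else 0) = b" by (simp add: b_def)
      have lb: "rarr s ''len'' ! G b = M" using ld(12)[OF Gb] by (simp add: M_def)
      note eval = s1 prepare_prog_def reg rd(3) gp b' lb state_if
      show "nreg s1 ''i'' = i" by (simp add: eval cong: if_cong split del: if_split)
      show "nreg s1 ''s'' = b" by (simp add: eval cong: if_cong split del: if_split)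
      show "rreg s1 ''M'' = M" by (simp add: eval cong: if_cong split del: if_split)
      show "rreg s1 ''du'' = du i x"
        by (simp add: eval cong: if_cong split del: if_split) (simp add: du_def min_def)
      show "rreg s1 ''dv'' = dv i x"
        by (simp add: eval cong: if_cong split del: if_split) (simp add: dv_def min_def)
      show "rreg s1 ''V'' = Vv"
        by (simp add: eval cong: if_cong split del: if_split) (simp add: Vv_def du_def dv_def min_def)
      show "reported s1 = []" using rep by (simp add: eval cong: if_cong split del: if_split)
      show "rreg s1 ''U'' = (if own i x then c else 0)"
        by (simp add: eval cong: if_cong split del: if_split) (simp add: own_def c_def)
      show "rreg s1 ''y'' = antipode i x" if "own i x"
        by (simp add: eval cong: if_cong split del: if_split)
          (use that in \<open>auto simp: own_def antipode_def\<close>)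
    qed
    have UV: "rreg s1 ''U'' < Vv \<longleftrightarrow> \<not> (own i x \<and> Vv \<le> c)" "Vv < rreg s1 ''U'' \<longleftrightarrow> own i x \<and> Vv < c"
      using r1(8) Vpos by auto
    have own_run: "runs W ?own s1 (4 + (search_time k + 100))
      (\<lambda>s'. \<exists>out. reported s' = out \<and> set out \<subseteq> addresses N \<and> map (point_at N) out = owns)"
    proof (rule runs_Cond)
      show "bok W s1 (RLess (RReg ''U'') (RReg ''V''))" by simp
      show "runs W Skip s1 (search_time k + 100)
          (\<lambda>s'. \<exists>out. reported s' = out \<and> set out \<subseteq> addresses N \<and> map (point_at N) out = owns)"
        if "bval s1 (RLess (RReg ''U'') (RReg ''V''))"
        by (rule runs_Skip) (use that UV(1) r1(6,7) in \<open>simp_all add: owns_def\<close>)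
      show "runs W own_prog s1 (search_time k + 100)
          (\<lambda>s'. \<exists>out. reported s' = out \<and> set out \<subseteq> addresses N \<and> map (point_at N) out = owns)"
        if "\<not> bval s1 (RLess (RReg ''U'') (RReg ''V''))"
      proof -
        have o: "own i x" "Vv \<le> c" using that UV(1) r1(6) by simp_all
        note a = own_dist(1,2)[OF i o(1)]
        have "runs W own_prog s1 (search_time k + 100)
          (\<lambda>s'. \<exists>a\<in>addresses N. reported s' = reported s1 @ [a] \<and> point_at N a = pt i (antipode i x))"
          by (rule own_prog_runs[OF W rdy1 i(1) _ _ r1(1) r1(9)[OF o(1)] k]) (use a in simp_all)
        then show ?thesis
          by (rule runs_weaken[OF _ order_refl]) (use o r1(7) in \<open>auto simp: owns_def\<close>)
      qed
    qed simp
    show "runs W (block [?own, ?other]) s1 (1 + (4 + (search_time k + 100)) +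
        (1 + (4 + (search_time k + loop_time report_guard report_body (Suc (length result)) + 100)) + 1))
      (\<lambda>s'. reports N (reported s') (farthest_points N (pt i x)))"
    proof (rule runs_block_Cons[OF own_run], elim exE conjE)
      fix s2 out
      assume fr2: "frame ?own s1 s2" and out: "reported s2 = out" "set out \<subseteq> addresses N"
        "map (point_at N) out = owns"
      have rdy2: "ready q G s2"
        by (rule ready_frame[OF rdy1 fr2])
          (simp add: keeps_structure_def own_prog_def own_start_def search_def search_body_def emit_point_def)
      have r2: "nreg s2 ''i'' = i" "nreg s2 ''s'' = b" "rreg s2 ''M'' = M" "rreg s2 ''du'' = du i x"
        "rreg s2 ''dv'' = dv i x" "rreg s2 ''V'' = Vv" "rreg s2 ''U'' = rreg s1 ''U''"
        using frame_nreg[OF fr2] frame_rreg[OF fr2] r1(1-6)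
        by (simp_all add: own_prog_def own_start_def search_def search_body_def emit_point_def)
      let ?Q = "\<lambda>s'. reports N (reported s') (farthest_points N (pt i x))"
      let ?T = "search_time k + loop_time report_guard report_body (Suc (length result)) + 100"
      have fin: "reports N (out @ out') (farthest_points N (pt i x))"
        if "set out' \<subseteq> addresses N" "map (point_at N) (out @ out') = result" for out'
        unfolding reports_def that(2) using that(1) out(2) distinct result by simp
      have "runs W ?other s2 (4 + ?T) ?Q"
      proof (rule runs_Cond)
        show "bok W s2 (RLess (RReg ''V'') (RReg ''U''))" by simp
        show "runs W Skip s2 ?T ?Q" if "bval s2 (RLess (RReg ''V'') (RReg ''U''))"
        proof (rule runs_Skip)
          have "own i x \<and> Vv < c" using that UV(2) r2(6,7) by simp
          then have "map (point_at N) (out @ []) = result" using out(3) by (simp add: result_def)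
          then show "?Q s2" using fin[of "[]"] out(1) by simp
        qed simp
        show "runs W other_prog s2 ?T ?Q" if "\<not> bval s2 (RLess (RReg ''V'') (RReg ''U''))"
        proof -
          have "\<not> (own i x \<and> Vv < c)" using that UV(2) r2(6,7) by simp
          then have res: "result = owns @ others" by (auto simp: result_def)
          have "stop z M b e - b \<le> Suc (length result)" using op(3) res by simp
          then have "loop_time report_guard report_body (stop z M b e - b) \<le>
              loop_time report_guard report_body (Suc (length result))"
            unfolding loop_time_def by (intro mult_le_mono2) simp
          then have T': "search_time k + loop_time report_guard report_body (stop z M b e - b) + 100 \<le> ?T"
            by simp
          have run: "runs W other_prog s2
            (search_time k + loop_time report_guard report_body (stop z M b e - b) + 100)
            (\<lambda>s'. \<exists>out'. reported s' = reported s2 @ out' \<and> set out' \<subseteq> addresses N \<and>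
              map (point_at N) out' = map (\<lambda>r. pt (G r) z) (filter (\<lambda>r. G r \<noteq> i) [b..<stop z M b e]))"
            by (rule other_prog_runs[OF W rdy2 seg(1,2) _ seg(4,5) i(1) z z_def r2(1-5) k])
              (rule seg(3))
          show ?thesis
          proof (rule runs_weaken[OF run T'])
            fix s3 assume "\<exists>out'. reported s3 = reported s2 @ out' \<and> set out' \<subseteq> addresses N \<and>
              map (point_at N) out' = map (\<lambda>r. pt (G r) z) (filter (\<lambda>r. G r \<noteq> i) [b..<stop z M b e])"
            then obtain out' where o: "reported s3 = out @ out'" "set out' \<subseteq> addresses N"
              "map (point_at N) out' = others" using out(1) by (auto simp: others_def)
            have "map (point_at N) (out @ out') = result" using o(3) out(3) res by simp
            then show "?Q s3" using fin[OF o(2)] o(1) by simp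
          qed
        qed
      qed simp
      then show "runs W (block [?other]) s2 (1 + (4 + ?T) + 1) ?Q"
        by (rule runs_block_Cons) (rule runs_block_Nil)
    qed
  qed
  then show ?thesis by (rule runs_weaken) (use T in simp_all)
qed

lemma query_prog_runs:
  assumes W: "10 * n \<le> W" and rdy: "ready q G s" and a: "a \<in> addresses N"
    and reg: "nreg s ''edge'' = fst a" "rreg s ''lambda'' = snd a" and rep: "reported s = []"
    and k: "2 * m < 2 ^ k"
  shows "runs W query_prog s (parallel_time k (card (farthest_points N (point_at N a))) + 100)
    (\<lambda>s'. reports N (reported s') (farthest_points N (point_at N a)))"
proof -
  have pW: "Suc 0 \<le> W" "p \<le> W" using W n_ge_2 p_le_n by linarith+
  have "(fst a, snd a) \<in> addresses N" using a by simp
  from locate_source_exec[OF W rdy this reg] obtain i x where ix: "i < p" "0 \<le> x" "x \<le> L i"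
    "point_at N (fst a, snd a) = pt i x" "safe W locate_source s"
    "nreg (exec locate_source s) ''i'' = i" "rreg (exec locate_source s) ''x'' = x"
    "rreg (exec locate_source s) ''h'' = L i" by blast
  have pa: "point_at N a = pt i x" using ix(4) by simp
  let ?k = "parallel_time k (card (farthest_points N (pt i x)))"
  let ?Q = "\<lambda>s'. reports N (reported s') (farthest_points N (pt i x))"
  have s0: "runs W locate_source s (max_time 0 locate_source) (\<lambda>s'. s' = exec locate_source s)"
  proof (rule runs_straight[OF _ ix(5)])
    show "\<not> allocates locate_source" by (simp add: locate_source_def)
  qed
  have "runs W query_prog s (1 + max_time 0 locate_source + (1 + (4 + ?k) + 1)) ?Q"
    unfolding query_prog_def parallel_prog_def[symmetric]
  proof (rule runs_block_Cons[OF s0])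
    fix s1 assume fr: "frame locate_source s s1" and s1: "s1 = exec locate_source s"
    have rdy1: "ready q G s1"
      by (rule ready_frame[OF rdy fr]) (simp add: keeps_structure_def locate_source_def)
    have rep1: "reported s1 = []"
      using frame_reported[OF fr] rep by (simp add: locate_source_def)
    have rp: "nreg s1 ''p'' = p" using laidD(1)[OF readyD(2)[OF rdy1]] .
    have "runs W (Cond (NEq (NReg ''p'') (NConst 1)) single_prog parallel_prog) s1 (4 + ?k) ?Q"
    proof (rule runs_Cond)
      show "bok W s1 (NEq (NReg ''p'') (NConst 1))" using pW rp by simp
      show "runs W single_prog s1 ?k ?Q" if "bval s1 (NEq (NReg ''p'') (NConst 1))"
      proof -
        have p1: "p = 1" using that rp by simp
        then have i0: "i = 0" using ix(1) by simp
        have "runs W single_prog s1 (max_time 0 single_prog) ?Q"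
          using single_prog_runs[OF W rdy1 p1 ix(2) _ _ _ rep1] ix(3,7,8) i0 s1 by simp
        then show ?thesis
          by (rule runs_weaken) (simp_all add: parallel_time_def single_prog_def emit_point_def)
      qed
      show "runs W parallel_prog s1 ?k ?Q" if "\<not> bval s1 (NEq (NReg ''p'') (NConst 1))"
      proof (rule parallel_prog_runs[OF W rdy1 _ ix(1-3) _ _ _ rep1 k])
        show "2 \<le> p" using that rp p_pos by simp
      qed (use ix s1 in simp_all)
    qed simp
    then show "runs W (block [Cond (NEq (NReg ''p'') (NConst 1)) single_prog parallel_prog]) s1
        (1 + (4 + ?k) + 1) ?Q"
      by (rule runs_block_Cons) (rule runs_block_Nil)
  qed
  then show ?thesis unfolding pa by (rule runs_weaken) (simp_all add: locate_source_def)
qed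

end

subsection \<open>Running the construction\<close>

definition build_prog :: prog where
  "build_prog = block [alloc_prog, degree_loop, terminal_init, terminal_loop, traverse_init,
     traverse_loop, extremes_init, extremes_loop, group_init, group_loop, cascade_init, cascade_loop,
     NPut ''off'' (NConst 0) (NReg ''o'')]"

lemmas loop_defs = degree_loop_def degree_body_def count_end_def terminal_loop_def terminal_body_def
  traverse_loop_def traverse_body_def record_edge_def extremes_loop_def extremes_body_def
  group_loop_def group_body_def cascade_loop_def cascade_body_def next_level_def merge_step_def
  cascade_guard_def level_finished_def

lemmas init_defs = terminal_init_def traverse_init_def extremes_init_def group_init_def cascade_init_def

context layout begin

definition allocated :: "state \<Rightarrow> bool" where
  "allocated s \<longleftrightarrow> sizes s \<and> length (narr s ''gp'') = Suc m \<and> narr s ''off'' = replicate (m + 2) 0 \<and>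
     length (rarr s ''key'') = 2 * m \<and> length (narr s ''ap'') = 2 * m \<and> length (narr s ''bp'') = 2 * m"

lemma tables_frame:
  assumes "frame c s s'"
    "narr_writes c \<inter> {''gp'', ''off'', ''ap'', ''bp''} = {}" "''key'' \<notin> rarr_writes c"
  shows "narr s' ''gp'' = narr s ''gp''" "narr s' ''off'' = narr s ''off''"
    "narr s' ''ap'' = narr s ''ap''" "narr s' ''bp'' = narr s ''bp''" "rarr s' ''key'' = rarr s ''key''"
  using assms by (auto simp: frame_def)

text \<open>The fifteen allocations are charged with \<open>W\<close> each, which
  \<open>20 * W\<close> covers together with small terms. All loops have fuel linear in
  \<open>p\<close>, \<open>m\<close> and \<open>n\<close>, hence in \<open>n\<close>.\<close>

lemma build_prog_runs:
  assumes W: "10 * n \<le> W"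
    and uv: "if {a \<in> vertices N. card (incident N a) \<noteq> 2} = {} then u = src N 0 \<and> v = tgt N 0
     else {a \<in> vertices N. card (incident N a) \<noteq> 2} = {u, v} \<and> u < v"
  shows "runs W build_prog (construction_input N) (20 * W + 5000 * n) (\<lambda>s. \<exists>q G. ready q G s)"
proof -
  let ?Q = "\<lambda>s. \<exists>q G. ready q G s"
  let ?s = "construction_input N"
  note b = m_le_2n n_ge_2 W p_le_n p_le_m m_pos p_pos
  have inp0: "has_input N ?s" by (simp add: construction_input_def has_input_def)
  \<comment> \<open>The tails of the program and, with matching numbers, their time bounds. Each
    tail is shown to establish \<open>ready\<close> from what the preceding phases leave behind,
    beginning with the last one.\<close>
  let ?c13 = "[NPut ''off'' (NConst 0) (NReg ''o'')]"
  let ?c12 = "cascade_loop # ?c13"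
  let ?c11 = "cascade_init # ?c12"
  let ?c10 = "group_loop # ?c11"
  let ?c9 = "group_init # ?c10"
  let ?c8 = "extremes_loop # ?c9"
  let ?c7 = "extremes_init # ?c8"
  let ?c6 = "traverse_loop # ?c7"
  let ?c5 = "traverse_init # ?c6"
  let ?c4 = "terminal_loop # ?c5"
  let ?c3 = "terminal_init # ?c4"
  let ?c2 = "degree_loop # ?c3"
  let ?g2 = "NLess (NReg ''e'') (NReg ''m'')"
  let ?g4 = "NLess (NReg ''x'') (NReg ''n'')"
  let ?g6 = "BNot (BAnd (BNot (NLess (NReg ''e'') (NReg ''m''))) (NEq (NReg ''x'') (NReg ''v'')))"
  let ?g8 = "NLess (NReg ''j'') (NReg ''p'')"
  let ?t13 = "1 + max_time 0 (NPut ''off'' (NConst 0) (NReg ''o'')) + 1"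
  let ?t12 = "1 + loop_time cascade_guard cascade_body (p + 2 * m) + ?t13"
  let ?t11 = "1 + max_time 0 cascade_init + ?t12"
  let ?t10 = "1 + loop_time ?g8 group_body p + ?t11"
  let ?t9 = "1 + max_time 0 group_init + ?t10"
  let ?t8 = "1 + loop_time ?g8 extremes_body p + ?t9"
  let ?t7 = "1 + max_time 0 extremes_init + ?t8"
  let ?t6 = "1 + loop_time ?g6 traverse_body (m + m) + ?t7"
  let ?t5 = "1 + max_time 0 traverse_init + ?t6"
  let ?t4 = "1 + loop_time ?g4 terminal_body n + ?t5"
  let ?t3 = "1 + max_time 0 terminal_init + ?t4"
  let ?t2 = "1 + loop_time ?g2 degree_body m + ?t3"
  let ?t1 = "1 + max_time W alloc_prog + ?t2"

  \<comment> \<open>The last command stores the end of level 0, so far held in \<open>o\<close>. All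
    other levels refer to offsets of positive index, which this write does not touch.\<close>
  have last: "runs W (block ?c13) s ?t13 ?Q"
    if "has_input N s" "laid s" "rreg s ''D'' = D" "nreg s ''q'' = q" "length (narr s ''gp'') = Suc m"
      "grouped q ((!) (narr s ''gp''))" "length (rarr s ''key'') = 2 * m" "length (narr s ''ap'') = 2 * m"
      "length (narr s ''bp'') = 2 * m" "length (narr s ''off'') = m + 2" "nreg s ''o'' \<le> 2 * m"
      and off: "\<forall>r < q. 0 < r \<longrightarrow> narr s ''off'' ! r \<le> 2 * m"
      and lev: "\<forall>r. 0 < r \<longrightarrow> r < q \<longrightarrow> level (rarr s ''key'') (narr s ''ap'') (narr s ''bp'') (rarr s ''pos'')
        (narr s ''off'' ! (r + 2)) (narr s ''off'' ! Suc r) (st (narr s ''gp'' ! r))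
        (st (narr s ''gp'' ! r) + len (narr s ''gp'' ! r)) (narr s ''off'' ! r)"
      and lev0: "level (rarr s ''key'') (narr s ''ap'') (narr s ''bp'') (rarr s ''pos'')
        (narr s ''off'' ! (0 + 2)) (narr s ''off'' ! Suc 0) (st (narr s ''gp'' ! 0))
        (st (narr s ''gp'' ! 0) + len (narr s ''gp'' ! 0)) (nreg s ''o'')" for s q
  proof (rule runs_block_Cons[where P = "ready q ((!) (narr s ''gp''))"], rule runs_exec)
    let ?p = "NPut ''off'' (NConst 0) (NReg ''o'')"
    show "\<not> allocates ?p" by simp
    show "safe W ?p s" using that(10,11) b by simp
    have fr: "frame ?p s (exec ?p s)" by (simp add: frame_def)
    have "has_input N (exec ?p s)" by (rule has_input_frame[OF that(1) fr]) simp_all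
    moreover have "laid (exec ?p s)" by (rule laid_frame[OF that(2) fr]) simp_all
    moreover have "(narr s ''off'')[0 := nreg s ''o''] ! r \<le> 2 * m \<and>
        level (rarr s ''key'') (narr s ''ap'') (narr s ''bp'') (rarr s ''pos'')
        ((narr s ''off'')[0 := nreg s ''o''] ! (r + 2)) ((narr s ''off'')[0 := nreg s ''o''] ! Suc r)
        (st (narr s ''gp'' ! r)) (st (narr s ''gp'' ! r) + len (narr s ''gp'' ! r))
        ((narr s ''off'')[0 := nreg s ''o''] ! r)" if "r < q" for r
      using off lev lev0 that \<open>nreg s ''o'' \<le> 2 * m\<close> \<open>length (narr s ''off'') = m + 2\<close>
      by (cases "r = 0") simp_all
    ultimately show "ready q ((!) (narr s ''gp'')) (exec ?p s)"
      unfolding ready_def using that(3-10) by simp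
  next
    fix s' assume "ready q ((!) (narr s ''gp'')) s'"
    then show "runs W (block []) s' 1 ?Q" by (intro runs_block_Nil) blast
  qed simp

  have cascade: "runs W (block ?c11) s ?t11 ?Q"
    if inp: "has_input N s" and laid: "laid s" and D: "rreg s ''D'' = D" and q: "nreg s ''q'' = q" "q \<le> Suc p"
      and gp: "length (narr s ''gp'') = Suc m" and G: "grouped q ((!) (narr s ''gp''))"
      and al: "length (rarr s ''key'') = 2 * m" "length (narr s ''ap'') = 2 * m"
      "length (narr s ''bp'') = 2 * m" "narr s ''off'' = replicate (m + 2) 0" for s q
  proof (rule runs_block_Cons[OF runs_straight])
    show "\<not> allocates cascade_init" by (simp add: cascade_init_def)
    show "safe W cascade_init s" using q b by (simp add: cascade_init_def)
    fix s1 assume fr1: "frame cascade_init s s1" and s1: "s1 = exec cascade_init s"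
    have inp1: "has_input N s1" by (rule has_input_frame[OF inp fr1]) (simp_all add: cascade_init_def)
    have laid1: "laid s1" by (rule laid_frame[OF laid fr1]) (simp_all add: cascade_init_def)
    note tab = tables_frame[OF fr1, simplified cascade_init_def, simplified]
    have r1: "nreg s1 ''jj'' = q" "nreg s1 ''o'' = 0" "nreg s1 ''base'' = 0" "nreg s1 ''ia'' = 0"
      "nreg s1 ''ea'' = 0" "nreg s1 ''ib'' = 0" "nreg s1 ''eb'' = 0" "nreg s1 ''q'' = q" "rreg s1 ''D'' = D"
      using q D by (simp_all add: s1 cascade_init_def)
    have gp1: "length (narr s1 ''gp'') = Suc m" "narr s1 ''gp'' = narr s ''gp''"
      "length (rarr s1 ''key'') = 2 * m" "length (narr s1 ''ap'') = 2 * m"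
      "length (narr s1 ''bp'') = 2 * m" "narr s1 ''off'' = replicate (m + 2) 0"
      using tab gp al by simp_all
    note run = cascade_loop_runs[OF W laid1 gp1(1,2) G r1(1-7) gp1(3-6)]
    have "loop_time cascade_guard cascade_body (q + 2 * m) \<le>
        loop_time cascade_guard cascade_body (p + 2 * m)"
      unfolding loop_time_def using grouped_le[OF G] by (intro mult_le_mono2) simp
    note run = runs_weaken[OF run this]
    show "runs W (block ?c12) s1 ?t12 ?Q"
    proof (rule runs_block_Cons[OF run], assumption, elim conjE)
      fix s2 assume fr2: "frame cascade_loop s1 s2"
      assume post: "\<forall>r. 0 < r \<longrightarrow> r < q \<longrightarrow> level (rarr s2 ''key'') (narr s2 ''ap'') (narr s2 ''bp'')
          (rarr s2 ''pos'') (narr s2 ''off'' ! (r + 2)) (narr s2 ''off'' ! Suc r) (st (narr s ''gp'' ! r))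
          (st (narr s ''gp'' ! r) + len (narr s ''gp'' ! r)) (narr s2 ''off'' ! r)"
        "level (rarr s2 ''key'') (narr s2 ''ap'') (narr s2 ''bp'')
          (rarr s2 ''pos'') (narr s2 ''off'' ! (0 + 2)) (narr s2 ''off'' ! Suc 0) (st (narr s ''gp'' ! 0))
          (st (narr s ''gp'' ! 0) + len (narr s ''gp'' ! 0)) (nreg s2 ''o'')"
        "\<forall>r<q. 0 < r \<longrightarrow> narr s2 ''off'' ! r \<le> 2 * m" "nreg s2 ''o'' \<le> 2 * m"
        "length (rarr s2 ''key'') = 2 * m" "length (narr s2 ''ap'') = 2 * m"
        "length (narr s2 ''bp'') = 2 * m" "length (narr s2 ''off'') = m + 2"
      have inp2: "has_input N s2" by (rule has_input_frame[OF inp1 fr2]) (simp_all add: loop_defs)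
      have laid2: "laid s2" by (rule laid_frame[OF laid1 fr2]) (simp_all add: loop_defs)
      have gp2: "narr s2 ''gp'' = narr s ''gp''" "nreg s2 ''q'' = q" "rreg s2 ''D'' = D"
        using frame_narr[OF fr2] frame_nreg[OF fr2] frame_rreg[OF fr2] gp1 r1
        by (simp_all add: loop_defs)
      show "runs W (block ?c13) s2 ?t13 ?Q"
        by (rule last[of s2 q]) (use inp2 laid2 gp2 gp G post in simp_all)
    qed
  qed

  have grouping: "runs W (block ?c7) s ?t7 ?Q"
    if inp: "has_input N s" and laid: "laid s" and al: "allocated s" for s
  proof (rule runs_block_Cons[OF runs_straight])
    note l = laidD[OF laid]
    show "\<not> allocates extremes_init" by (simp add: extremes_init_def)
    show "safe W extremes_init s" using l(9) m_pos by (auto simp: extremes_init_def)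
    fix s1 assume fr1: "frame extremes_init s s1" and s1: "s1 = exec extremes_init s"
    have inp1: "has_input N s1" by (rule has_input_frame[OF inp fr1]) (simp_all add: extremes_init_def)
    have laid1: "laid s1" by (rule laid_frame[OF laid fr1]) (simp_all add: extremes_init_def)
    note tab1 = tables_frame[OF fr1, simplified extremes_init_def, simplified]
    have r1: "nreg s1 ''a'' = 0" "nreg s1 ''j'' = 0" "rreg s1 ''D'' = L 0"
      using l(12)[OF p_pos] by (simp_all add: s1 extremes_init_def)
    show "runs W (block ?c8) s1 ?t8 ?Q"
    proof (rule runs_block_Cons[OF extremes_loop_runs[OF W laid1 r1]], elim conjE)
      fix s2 assume fr2: "frame extremes_loop s1 s2" and a: "nreg s2 ''a'' < p"
        "\<forall>j<p. L j \<le> L (nreg s2 ''a'')" and D2: "rreg s2 ''D'' = D"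
      have inp2: "has_input N s2" by (rule has_input_frame[OF inp1 fr2]) (simp_all add: loop_defs)
      have laid2: "laid s2" by (rule laid_frame[OF laid1 fr2]) (simp_all add: loop_defs)
      note tab2 = tables_frame[OF fr2, simplified loop_defs, simplified]
      have gp2: "length (narr s2 ''gp'') = Suc m" using tab1 tab2 al by (simp add: allocated_def)
      show "runs W (block ?c9) s2 ?t9 ?Q"
      proof (rule runs_block_Cons[OF runs_straight])
        show "\<not> allocates group_init" by (simp add: group_init_def)
        have "narr s2 ''gp'' \<noteq> []" using gp2 by auto
        then show "safe W group_init s2" using a(1) b by (simp add: group_init_def)
        fix s3 assume fr3: "frame group_init s2 s3" and s3: "s3 = exec group_init s2"
        have inp3: "has_input N s3" by (rule has_input_frame[OF inp2 fr3]) (simp_all add: group_init_def)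
        have laid3: "laid s3" by (rule laid_frame[OF laid2 fr3]) (simp_all add: group_init_def)
        have r3: "nreg s3 ''a'' = nreg s2 ''a''" "nreg s3 ''q'' = 1" "nreg s3 ''j'' = 0" "rreg s3 ''l'' = 0"
          "length (narr s3 ''gp'') = Suc m" "narr s3 ''gp'' ! 0 = nreg s2 ''a''" "rreg s3 ''D'' = D"
          using gp2 D2 by (simp_all add: s3 group_init_def)
        show "runs W (block ?c10) s3 ?t10 ?Q"
        proof (rule runs_block_Cons[OF group_loop_runs[OF W laid3 r3(1) a r3(2-6)]], elim conjE)
          fix s4 assume fr4: "frame group_loop s3 s4" and g4: "length (narr s4 ''gp'') = Suc m"
            "nreg s4 ''q'' \<le> Suc p" "grouped (nreg s4 ''q'') ((!) (narr s4 ''gp''))"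
          have inp4: "has_input N s4" by (rule has_input_frame[OF inp3 fr4]) (simp_all add: loop_defs)
          have laid4: "laid s4" by (rule laid_frame[OF laid3 fr4]) (simp_all add: loop_defs)
          have D4: "rreg s4 ''D'' = D" using frame_rreg[OF fr4] r3 by (simp add: loop_defs)
          have al4: "rarr s4 ''key'' = rarr s ''key''" "narr s4 ''ap'' = narr s ''ap''"
            "narr s4 ''bp'' = narr s ''bp''" "narr s4 ''off'' = narr s ''off''"
            using frame_rarr[OF fr4] frame_narr[OF fr4] frame_rarr[OF fr3] frame_narr[OF fr3] tab1 tab2
            by (simp_all add: loop_defs group_init_def)
          show "runs W (block ?c11) s4 ?t11 ?Q"
            by (rule cascade[OF inp4 laid4 D4 refl g4(2,1,3)])
              (use al al4 in \<open>simp_all add: allocated_def del: replicate.simps\<close>)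
        qed
      qed
    qed
  qed

  have "runs W (block (alloc_prog # ?c2)) ?s ?t1 ?Q"
  proof (rule runs_block_Cons[OF runs_exec_alloc[OF _ order_refl, where Q = "\<lambda>s'. s' = exec alloc_prog ?s"]])
    show "safe W alloc_prog ?s"
      using b by (simp add: alloc_prog_def construction_input_def)
    fix s1 assume fr1: "frame alloc_prog ?s s1" and s1: "s1 = exec alloc_prog ?s"
    have inp1: "has_input N s1" by (rule has_input_frame[OF inp0 fr1]) (simp_all add: alloc_prog_def)
    have n0: "nreg ?s ''n'' = n" "nreg ?s ''m'' = m" by (simp_all add: construction_input_def)
    have al1: "allocated s1"
      by (simp add: s1 alloc_prog_def allocated_def sizes_def n0 del: replicate.simps)
    have r1: "nreg s1 ''e'' = 0" "narr s1 ''deg'' = replicate n 0" "narr s1 ''sum'' = replicate n 0"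
      by (simp_all add: s1 alloc_prog_def n0)
    show "runs W (block ?c2) s1 ?t2 ?Q"
    proof (rule runs_block_Cons[OF degree_loop_runs[OF W inp1 r1]])
      fix s2 assume fr2: "frame degree_loop s1 s2" and c2: "counted n (incident N) s2"
      have inp2: "has_input N s2" by (rule has_input_frame[OF inp1 fr2]) (simp_all add: loop_defs)
      note i2 = has_inputD[OF inp2]
      show "runs W (block ?c3) s2 ?t3 ?Q"
      proof (rule runs_block_Cons[OF runs_straight])
        show "\<not> allocates terminal_init" by (simp add: terminal_init_def)
        have "src N 0 \<le> W" "tgt N 0 \<le> W" using src_tgt_lt[of 0] b by auto
        then show "safe W terminal_init s2" using i2 m_pos by (auto simp: terminal_init_def)
        fix s3 assume fr3: "frame terminal_init s2 s3" and s3: "s3 = exec terminal_init s2"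
        have inp3: "has_input N s3" by (rule has_input_frame[OF inp2 fr3]) (simp_all add: terminal_init_def)
        have r3: "nreg s3 ''x'' = 0" "nreg s3 ''u'' = src N 0" "nreg s3 ''v'' = tgt N 0"
          using i2(6,7)[OF m_pos] by (simp_all add: s3 terminal_init_def)
        have c3: "counted n (incident N) s3"
          using c2 by (simp add: s3 terminal_init_def counted_def)
        have d3: "length (narr s3 ''deg'') = n" "\<And>a. a < n \<Longrightarrow> narr s3 ''deg'' ! a = card (incident N a)"
          using c3 by (simp_all add: counted_def)
        show "runs W (block ?c4) s3 ?t4 ?Q"
        proof (rule runs_block_Cons[OF terminal_loop_runs[OF W inp3 r3 d3 uv]], assumption, elim conjE)
          fix s4 assume fr4: "frame terminal_loop s3 s4" and uv4: "nreg s4 ''u'' = u" "nreg s4 ''v'' = v"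
          have inp4: "has_input N s4" by (rule has_input_frame[OF inp3 fr4]) (simp_all add: loop_defs)
          have c4: "counted n (incident N) s4"
            using c3 frame_narr[OF fr4] by (simp add: counted_def loop_defs)
          show "runs W (block ?c5) s4 ?t5 ?Q"
          proof (rule runs_block_Cons[OF runs_straight])
            show "\<not> allocates traverse_init" by (simp add: traverse_init_def)
            have "v \<le> W" using V_vertex[OF p_pos, of "len 0"] V_last[OF p_pos] b by simp
            then show "safe W traverse_init s4" using uv4 by (simp add: traverse_init_def)
            fix s5 assume fr5: "frame traverse_init s4 s5" and s5: "s5 = exec traverse_init s4"
            have inp5: "has_input N s5" by (rule has_input_frame[OF inp4 fr5]) (simp_all add: traverse_init_def)
            have r5: "nreg s5 ''u'' = u" "nreg s5 ''v'' = v" "nreg s5 ''e'' = 0" "nreg s5 ''x'' = v"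
              "nreg s5 ''p'' = 0" "nreg s5 ''k'' = 0"
              using uv4 by (simp_all add: s5 traverse_init_def)
            have c5: "counted n (incident N) s5"
              using c4 by (simp add: s5 traverse_init_def counted_def)
            have al5: "allocated s5"
              using al1 frame_narr[OF fr2] frame_narr[OF fr3] frame_narr[OF fr4] frame_narr[OF fr5]
                frame_rarr[OF fr2] frame_rarr[OF fr3] frame_rarr[OF fr4] frame_rarr[OF fr5]
              by (simp add: allocated_def sizes_def loop_defs init_defs del: replicate.simps)
            have siz5: "sizes s5" using al5 by (simp add: allocated_def)
            show "runs W (block ?c6) s5 ?t6 ?Q"
            proof (rule runs_block_Cons[OF traverse_loop_runs[OF W inp5 c5 r5 siz5]])
              fix s6 assume fr6: "frame traverse_loop s5 s6"
                and tr: "sizes s6 \<and> recorded m s6 \<and> paths_done p s6 \<and> nreg s6 ''p'' = p"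
              have inp6: "has_input N s6" by (rule has_input_frame[OF inp5 fr6]) (simp_all add: loop_defs)
              have laid6: "laid s6" using tr by (simp add: laid_def)
              note tab6 = tables_frame[OF fr6, simplified loop_defs, simplified]
              have "allocated s6" using al5 tr tab6 by (simp add: allocated_def del: replicate.simps)
              then show "runs W (block ?c7) s6 ?t7 ?Q" by (rule grouping[OF inp6 laid6])
            qed
          qed
        qed
      qed
    qed
  qed simp
  then have "runs W build_prog ?s ?t1 ?Q" by (simp only: build_prog_def)
  moreover have "?t1 \<le> 20 * W + 5000 * n"
    using b by (simp add: loop_time_def loop_defs init_defs alloc_prog_def)
  ultimately show ?thesis by (rule runs_weaken)
qed

end

section \<open>Resource bounds of the data structure\<close>

context layout begin

lemma query_prog_keeps: "keeps_structure query_prog"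
  by (simp add: keeps_structure_def query_defs)

lemma ready_query_input:
  assumes "ready q G s" shows "ready q G (query_input s a)"
  using assms
  by (simp add: ready_def query_input_def has_input_def laid_def sizes_def recorded_def paths_done_def)

lemma query_prog_preserves:
  assumes "ready q G s" "run W query_prog (query_input s a) t s'"
  shows "ready q G s'" "state_size s' = state_size s"
proof -
  have fr: "frame query_prog (query_input s a) s'" using run_frame[OF assms(2)] .
  show "ready q G s'" by (rule ready_frame[OF ready_query_input[OF assms(1)] fr query_prog_keeps])
  have "narr s' = narr s" "rarr s' = rarr s"
    using fr query_prog_keeps by (auto simp: frame_def keeps_structure_def query_input_def fun_eq_iff)
  then show "state_size s' = state_size s" by (simp add: state_size_def)
qed

lemma state_size_construction_input:
  "finite_state (construction_input N)" "state_size (construction_input N) \<le> 3 * m"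
proof -
  have "{a. narr (construction_input N) a \<noteq> []} \<subseteq> {''src'', ''tgt''}"
    "{a. rarr (construction_input N) a \<noteq> []} \<subseteq> {''weight''}"
    by (auto simp: construction_input_def split: if_splits)
  note sub = this
  then show "finite_state (construction_input N)"
    unfolding finite_state_def by (meson finite.emptyI finite.insertI finite_subset)
  have "(\<Sum>a | narr (construction_input N) a \<noteq> []. length (narr (construction_input N) a)) \<le>
      (\<Sum>a\<in>{''src'', ''tgt''}. length (narr (construction_input N) a))"
    by (rule sum_mono2) (use sub in auto)
  moreover have "(\<Sum>a | rarr (construction_input N) a \<noteq> []. length (rarr (construction_input N) a)) \<le>
      (\<Sum>a\<in>{''weight''}. length (rarr (construction_input N) a))"
    by (rule sum_mono2) (use sub in auto)
  ultimately show "state_size (construction_input N) \<le> 3 * m"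
    by (simp add: state_size_def construction_input_def)
qed

text \<open>With \<open>n < 2 ^ (k + 1)\<close> and \<open>m \<le> 2 * n\<close>, the number
  \<open>2 ^ (k + 3)\<close> exceeds \<open>2 * m\<close>, the length of the longest array searched.
  The additive constants are absorbed by the logarithm, which is at least 1 since there are two
  vertices.\<close>

lemma parallel_time_le:
  assumes "2 \<le> n"
  obtains k where "2 * m < 2 ^ k"
    "real (parallel_time k c + 100) \<le> 6000 * (real c + log 2 (real n))"
proof -
  have n1: "1 \<le> n" using assms by simp
  obtain k where k: "2 ^ k \<le> n" "n < 2 ^ (k + 1)"
    using ex_power_ivl1[of 2 n] n1 by auto
  have kl: "real k \<le> log 2 (real n)"
  proof -
    have "(2::real) ^ k \<le> real n" using k(1) by (metis of_nat_le_iff of_nat_numeral of_nat_power)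
    then have "log 2 (2 ^ k) \<le> log 2 (real n)" using n1 by (subst log_le_cancel_iff) auto
    then show ?thesis by simp
  qed
  have l1: "1 \<le> log 2 (real n)"
  proof -
    have "log 2 2 \<le> log 2 (real n)" using assms by (subst log_le_cancel_iff) auto
    then show ?thesis by simp
  qed
  have "2 * m < 2 ^ (k + 3)" using k(2) m_le_2n by (simp add: power_add)
  moreover have "real (parallel_time (k + 3) c + 100) \<le> 6000 * (real c + log 2 (real n))"
  proof -
    have "parallel_time (k + 3) c + 100 \<le> 1000 * k + 1000 * c + 3000"
      by (simp add: parallel_time_def search_time_def loop_time_def search_body_def report_body_def
          report_guard_def emit_point_def)
    then have "real (parallel_time (k + 3) c + 100) \<le> real (1000 * k + 1000 * c + 3000)"
      by (simp only: of_nat_le_iff)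
    also have "\<dots> \<le> 6000 * (real c + log 2 (real n))" using kl l1 by simp
    finally show ?thesis .
  qed
  ultimately show ?thesis by (rule that)
qed

text \<open>The constant comes from the space bound: the construction takes at most
  \<open>20 * (10 * n) + 5000 * n = 5200 * n\<close> steps and allocates no more cells than that,
  and the input occupies another \<open>3 * m \<le> 6 * n\<close>. The value 6000 leaves room for
  both and for the query time.\<close>

lemma data_structure:
  assumes uv: "if {a \<in> vertices N. card (incident N a) \<noteq> 2} = {} then u = src N 0 \<and> v = tgt N 0
     else {a \<in> vertices N. card (incident N a) \<noteq> 2} = {u, v} \<and> u < v"
    and C: "C = 6000" and W: "W = C * n"
  shows "\<exists>t s. run W build_prog (construction_input N) t s \<and> t \<le> C * n"
    and "ds_state W build_prog query_prog N s \<Longrightarrow> state_size s \<le> C * n"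
    and "ds_state W build_prog query_prog N s \<Longrightarrow> a \<in> addresses N \<Longrightarrow> \<exists>t s'.
      run W query_prog (query_input s a) t s' \<and>
      reports N (reported s') (farthest_points N (point_at N a)) \<and>
      real t \<le> real C * (real (card (farthest_points N (point_at N a))) + log 2 (real n))"
proof -
  have le: "10 * n \<le> W" using C W by simp
  from build_prog_runs[OF order_refl uv] obtain t0 s0 where
    r0: "run (10 * n) build_prog (construction_input N) t0 s0" "t0 \<le> 20 * (10 * n) + 5000 * n"
    "\<exists>q G. ready q G s0"
    unfolding runs_def by blast
  then obtain q G where rdy0: "ready q G s0" by blast
  have r1: "run W build_prog (construction_input N) t0 s0" by (rule run_mono[OF r0(1) le])
  show "\<exists>t s. run W build_prog (construction_input N) t s \<and> t \<le> C * n"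
    using r1 r0(2) C by (intro exI[of _ t0] exI[of _ s0]) simp
  have size0: "state_size s0 \<le> C * n"
    using run_state_size[OF r1 state_size_construction_input(1)] state_size_construction_input(2)
      r0(2) m_le_2n C by simp
  have inv: "ready q G s \<and> state_size s \<le> C * n" if "ds_state W build_prog query_prog N s" for s
    using that
  proof induction
    case (constructed t s)
    then have "s = s0" using run_deterministic[OF r1] by blast
    then show ?case using rdy0 size0 by simp
  next
    case (queried s a t s')
    then show ?case using query_prog_preserves[of q G s W a t s'] by simp
  qed
  show "state_size s \<le> C * n" if "ds_state W build_prog query_prog N s"
    using inv[OF that] by simp
  show "\<exists>t s'. run W query_prog (query_input s a) t s' \<and>
      reports N (reported s') (farthest_points N (point_at N a)) \<and>
      real t \<le> real C * (real (card (farthest_points N (point_at N a))) + log 2 (real n))"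
    if ds: "ds_state W build_prog query_prog N s" and a: "a \<in> addresses N"
  proof -
    let ?c = "card (farthest_points N (point_at N a))"
    obtain k where k: "2 * m < 2 ^ k"
      "real (parallel_time k ?c + 100) \<le> 6000 * (real ?c + log 2 (real n))"
      using parallel_time_le[OF n_ge_2] by blast
    have rdy: "ready q G (query_input s a)" using ready_query_input inv[OF ds] by blast
    have "runs W query_prog (query_input s a) (parallel_time k ?c + 100)
        (\<lambda>s'. reports N (reported s') (farthest_points N (point_at N a)))"
      by (rule query_prog_runs[OF le rdy a _ _ _ k(1)]) (simp_all add: query_input_def)
    then obtain t s' where "run W query_prog (query_input s a) t s'" "t \<le> parallel_time k ?c + 100"
      "reports N (reported s') (farthest_points N (point_at N a))"
      unfolding runs_def by blast
    moreover from this k(2) have "real t \<le> real C * (real ?c + log 2 (real n))"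
      unfolding C by simp
    ultimately show ?thesis by blast
  qed
qed

end

theorem theorem1:
  shows "\<exists>(build :: prog) (query :: prog) (C :: nat). \<forall>N. parallel_path_network N \<longrightarrow>
    (let n = vertex_count N; W = C * n in
      (\<exists>t s. run W build (construction_input N) t s \<and> t \<le> C * n) \<and>
      (\<forall>s. ds_state W build query N s \<longrightarrow>
        state_size s \<le> C * n \<and>
        (\<forall>p \<in> addresses N. \<exists>t s'.
          run W query (query_input s p) t s' \<and>
          reports N (reported s') (farthest_points N (point_at N p)) \<and>
          real t \<le> real C * (real (card (farthest_points N (point_at N p))) + log 2 (real n)))))"
proof (rule exI[of _ build_prog], rule exI[of _ query_prog], rule exI[of _ 6000], intro allI impI)
  fix N assume "parallel_path_network N"
  then obtain u v p len V E where lay: "layout N u v p len V E" and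
    uv: "if {a \<in> vertices N. card (incident N a) \<noteq> 2} = {} then u = src N 0 \<and> v = tgt N 0
     else {a \<in> vertices N. card (incident N a) \<noteq> 2} = {u, v} \<and> u < v"
    using layout_exists by blast
  interpret layout N u v p len V E by (rule lay)
  note ds = data_structure[OF uv refl refl]
  show "let n = vertex_count N; W = 6000 * n in
      (\<exists>t s. run W build_prog (construction_input N) t s \<and> t \<le> 6000 * n) \<and>
      (\<forall>s. ds_state W build_prog query_prog N s \<longrightarrow>
        state_size s \<le> 6000 * n \<and>
        (\<forall>p \<in> addresses N. \<exists>t s'.
          run W query_prog (query_input s p) t s' \<and>
          reports N (reported s') (farthest_points N (point_at N p)) \<and>
          real t \<le> real 6000 * (real (card (farthest_points N (point_at N p))) + log 2 (real n))))"
    unfolding Let_def using ds by blast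
qed

end
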